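(* Let $V$ be a distribution of $k$-planes in $\mathbb{R}^n$, and let $d$ be a metric on $\mathbb{R}^n$. (1) If $d$ is $\eta$-squeezed on $V$ for some $\eta\in(1,2)$, then there exist a compact set $K\subset\mathbb{R}^k$ and a Lipschitz function $f:K\to(\mathbb{R}^n,d)$ such that $\mathscr{H}^k_d(f(K))>0$. (2) If $d$ is $\eta$-squeezed on $V$ with $\eta=2$ and $V$ is non-involutive, then the metric space $(\mathbb{R}^n,d)$ is $k$-purely unrectifiable.
   Context: Standing setting: $V$ and $W$ are distributions of $k$-planes and $(n-k)$-planes in $\mathbb{R}^n$ (i.e. maps to the corresponding Grassmannians), spanned at every point by smooth vector fields $X_1,\dots,X_k$ and $X_{k+1},\dots,X_n$ respectively, with $\mathbb{R}^n=V(x)\oplus W(x)$ for every $x$. $\Pi^V_x$ is the projection onto $V(x)$ along $W(x)$ and $\Pi^W_x:=\mathrm{id}-\Pi^V_x$. For $\eta\in[1,2]$, a metric $d$ on $\mathbb{R}^n$ is $\eta$-squeezed on $V$ if for every compact set $K\subset\mathbb{R}^n$ there are constants $C=C(d,K)>1$ and $r=r(d,K)>0$ such that $$C^{-1}\big(|\Pi^V_x[y-x]|+|\Pi^W_x[y-x]|^{1/\eta}\big)\le d(x,y)\le C\big(|\Pi^V_x[y-x]|+|\Pi^W_x[y-x]|^{1/\eta}\big)$$ for every $x\in K$ and every $y\in B_d(x,r)$, the closed $d$-ball of center $x$ and radius $r$. $V$ is non-involutive if at every $x\in\mathbb{R}^n$ there are $C^1$ vector fields $X,X'$ tangent to $V$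 (i.e. with values in $V$) such that the Lie bracket $[X,X'](x)\notin V(x)$. A metric space $(X,d)$ is $k$-purely unrectifiable if for every compact $K\subset\mathbb{R}^k$ and every Lipschitz map $f:K\to X$ (Euclidean distance on $K$) one has $\mathscr{H}^k_d(f(K))=0$, where $\mathscr{H}^k_d$ is the $k$-dimensional Hausdorff measure with respect to $d$.
   Formalization: In part (1) the metric d is additionally assumed to induce the Euclidean topology; without this the claim fails, e.g. for the discrete metric, which is η-squeezed on every V (small balls are single points) while Lipschitz images of compact sets are finite. *)

theory Defs
  imports "HOL-Analysis.Analysis"
begin

text \<open>For a finite-dimensional domain, the following recursion on directional derivatives gives
  the usual global classes: \<open>C_diff 1\<close> is \<open>C\<^sup>1\<close> and \<open>smooth_map\<close> is \<open>C\<^sup>\<infinity>\<close>.\<close>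

primrec C_diff :: "nat \<Rightarrow> ('a::euclidean_space \<Rightarrow> 'b::euclidean_space) \<Rightarrow> bool" where
  "C_diff 0 f \<longleftrightarrow> continuous_on UNIV f"
| "C_diff (Suc m) f \<longleftrightarrow> (\<forall>x. f differentiable (at x)) \<and>
     (\<forall>v. C_diff m (\<lambda>x. frechet_derivative f (at x) v))"

definition smooth_map :: "('a::euclidean_space \<Rightarrow> 'b::euclidean_space) \<Rightarrow> bool" where
  "smooth_map f \<longleftrightarrow> (\<forall>m. C_diff m f)"

definition lie_bracket ::
    "('a::euclidean_space \<Rightarrow> 'a) \<Rightarrow> ('a \<Rightarrow> 'a) \<Rightarrow> 'a \<Rightarrow> 'a" where
  "lie_bracket X Y x = frechet_derivative Y (at x) (X x) - frechet_derivative X (at x) (Y x)"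

definition plane_distribution :: "nat \<Rightarrow> ('a::euclidean_space \<Rightarrow> 'a set) \<Rightarrow> bool" where
  "plane_distribution k V \<longleftrightarrow> (\<forall>x. subspace (V x) \<and> dim (V x) = k)"

definition complementary_distributions ::
    "nat \<Rightarrow> ('a::euclidean_space \<Rightarrow> 'a set) \<Rightarrow> ('a \<Rightarrow> 'a set) \<Rightarrow> bool" where
  "complementary_distributions k V W \<longleftrightarrow>
     k \<le> DIM('a) \<and> plane_distribution k V \<and> plane_distribution (DIM('a) - k) W \<and>
     (\<exists>X :: nat \<Rightarrow> 'a \<Rightarrow> 'a. (\<forall>i\<in>{1..DIM('a)}. smooth_map (X i)) \<and>
        (\<forall>x. V x = span ((\<lambda>i. X i x) ` {1..k}) \<and> W x = span ((\<lambda>i. X i x) ` {k+1..DIM('a)}))) \<and>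
     (\<forall>x. V x \<inter> W x = {0} \<and> {v + w |v w. v \<in> V x \<and> w \<in> W x} = UNIV)"

text \<open>Projection onto \<open>S\<close> along \<open>T\<close>; meaningful when the space is the direct sum of
  the subspaces \<open>S\<close> and \<open>T\<close>.\<close>

definition proj_along :: "'a::real_vector set \<Rightarrow> 'a set \<Rightarrow> 'a \<Rightarrow> 'a" where
  "proj_along S T v = (THE s. s \<in> S \<and> v - s \<in> T)"

text \<open>Here \<open>compact\<close> and \<open>norm\<close> are Euclidean, while the closed ball is that of \<open>d\<close>.
  Pitfall: if the points of \<open>d\<close> are isolated, small balls are singletons and the condition is
  void; so the discrete metric is squeezed for every \<open>\<eta> > 0\<close>. Existence of Lipschitz images of
  positive measure therefore needs that \<open>d\<close> induces the Euclidean topology.\<close>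

definition squeezed ::
    "real \<Rightarrow> ('a::euclidean_space \<Rightarrow> 'a set) \<Rightarrow> ('a \<Rightarrow> 'a set) \<Rightarrow> 'a metric \<Rightarrow> bool" where
  "squeezed \<eta> V W d \<longleftrightarrow>
     (\<forall>K. compact K \<longrightarrow> (\<exists>C r. C > 1 \<and> r > 0 \<and>
        (\<forall>x\<in>K. \<forall>y\<in>mcball_of d x r.
           let p = proj_along (V x) (W x) (y - x);
               N = norm p + norm ((y - x) - p) powr (1 / \<eta>)
           in inverse C * N \<le> mdist d x y \<and> mdist d x y \<le> C * N)))"

definition non_involutive :: "('a::euclidean_space \<Rightarrow> 'a set) \<Rightarrow> bool" where
  "non_involutive V \<longleftrightarrow>
     (\<forall>x. \<exists>X X'. C_diff 1 X \<and> C_diff 1 X' \<and> (\<forall>y. X y \<in> V y \<and> X' y \<in> V y) \<and>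
        lie_bracket X X' x \<notin> V x)"

definition mdiam :: "'a metric \<Rightarrow> 'a set \<Rightarrow> ennreal" where
  "mdiam m A = (SUP x\<in>A. SUP y\<in>A. ennreal (mdist m x y))"

text \<open>The factor is the volume of the Euclidean \<open>k\<close>-ball of diameter 1. Empty covering sets
  count 0 also for \<open>k = 0\<close>, where \<open>0 ^ 0 = 1\<close>.\<close>

definition hausdorff_premeasure :: "'a metric \<Rightarrow> nat \<Rightarrow> real \<Rightarrow> 'a set \<Rightarrow> ennreal" where
  "hausdorff_premeasure m k \<delta> A =
     (INF C \<in> {C :: nat \<Rightarrow> 'a set.
        A \<subseteq> (\<Union>i. C i) \<and> (\<forall>i. C i \<subseteq> mspace m \<and> mdiam m (C i) \<le> ennreal \<delta>)}.
      ennreal (unit_ball_vol (real k) / 2 ^ k) *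
        (\<Sum>i. if C i = {} then 0 else mdiam m (C i) ^ k))"

definition hausdorff_measure :: "'a metric \<Rightarrow> nat \<Rightarrow> 'a set \<Rightarrow> ennreal" where
  "hausdorff_measure m k A = (SUP \<delta>\<in>{0<..}. hausdorff_premeasure m k \<delta> A)"

text \<open>The dimension \<open>k\<close> is the cardinality of the index type \<open>'k\<close>.\<close>

definition purely_unrectifiable :: "'k::finite itself \<Rightarrow> 'a metric \<Rightarrow> bool" where
  "purely_unrectifiable _ m \<longleftrightarrow>
     (\<forall>(K :: (real^'k) set) f. compact K \<longrightarrow>
        Lipschitz_continuous_map (submetric euclidean_metric K) m f \<longrightarrow>
        hausdorff_measure m CARD('k) (f ` K) = 0)"

end

theory Submission
  imports Defs
begin

text \<open>
  Near a compact set, the space is described by a smooth frame \<open>X\<^sub>1, \<dots>, X\<^sub>n\<close> whose members with index in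
  \<open>I\<close> span \<open>V\<close> and whose other members span \<open>W\<close>. Write \<open>y - x = \<Sum>\<^sub>i a\<^sub>i X\<^sub>i(x)\<close> and call the
  coefficients with \<open>i \<in> I\<close> tangential, the others normal. Squeezing says that \<open>d(x, y)\<close> is
  comparable to the size of the tangential part plus the size of the normal part to the power \<open>1/\<eta>\<close>
  (\<open>squeezed_coords\<close>). So, for pairs of points with \<open>d\<close>-close
  images, a map \<open>f\<close> defined on a set \<open>K \<subseteq> \<real>\<^sup>k\<close> is Lipschitz for \<open>d\<close> iff the tangential part of
  \<open>f(t) - f(s)\<close>, seen from \<open>f(s)\<close>, is \<open>O(\<bar>t - s\<bar>)\<close> and its normal part is \<open>O(\<bar>t - s\<bar>\<^sup>\<eta>)\<close>.

  For \<open>\<eta> < 2\<close> such a map exists on a fat Cantor set. All points of that set stay at distance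
  \<open>c(\<theta>/2)\<^sup>j\<close> from the coordinate hyperplanes of the dyadic grid of level \<open>j\<close>, with some \<open>\<theta> < 1\<close>. Two
  of its points whose dyadic cubes agree up to level \<open>j\<close> but not at level \<open>j + 1\<close> are therefore at
  distance at least a multiple of \<open>(\<theta>/2)\<^sup>j\<close>. The map follows an Euler scheme along the tree of dyadic
  cubes: from the corner of a cube to the corner of a subcube it moves in the direction of \<open>V\<close> at the
  point already reached. For two points in one cube of level \<open>j\<close> the deviation from a displacement
  along \<open>V\<close> is \<open>O(4\<^sup>-\<^sup>j)\<close> (\<open>euler_scheme\<close>), and the choice \<open>(\<theta>/2)\<^sup>\<eta> = 1/4\<close> makes this
  \<open>O(\<bar>t - s\<bar>\<^sup>\<eta>)\<close>; it satisfies \<open>\<theta> < 1\<close> because \<open>\<eta> < 2\<close>. The tangential part bounds the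
  distances of images below by a multiple of \<open>\<bar>t - s\<bar>\<close>, hence the image has positive measure
  (\<open>hausdorff_measure_pos_of_expanding\<close>).

  For \<open>\<eta> = 2\<close> the normal part of \<open>f(t) - f(s)\<close> is quadratic in \<open>t - s\<close>. At almost every \<open>s \<in> K\<close> the
  dyadic rescalings of \<open>f\<close> subconverge to a linear map \<open>A\<close>, and those of \<open>K\<close> fill the space
  (\<open>AE_blow_up\<close>): by the parallelogram law, the second differences at scale \<open>2\<^sup>-\<^sup>j\<close> of a compactly
  supported Lipschitz function, divided by the scale, have square integrals with bounded sum over
  \<open>j\<close>, so they tend to \<open>0\<close> almost everywhere. This is applied to the components of \<open>f\<close> and to the
  distance from \<open>K\<close>. Now look at the normal displacement between two rescaled points \<open>a\<close> and \<open>b\<close>, in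
  units of the squared scale. Up to an error that is quadratic in \<open>b - a\<close> it is a bilinear expression
  in \<open>A a\<close> and \<open>A (b - a)\<close>, the twist, which measures how fast the tangential vectors of the frame
  leave \<open>V(f(s))\<close>. Bisecting the segment from \<open>a\<close> to \<open>b\<close> halves the total error, so in the limit the
  displacement is exactly half the twist at \<open>A (a + b)\<close> and \<open>A (b - a)\<close> (\<open>normal_diff_tendsto\<close>).
  Displacements around a triangle add up to zero, hence the twist is symmetric on the image of \<open>A\<close>
  (\<open>twist_symmetric\<close>). Its antisymmetric part on \<open>V\<close> is the normal part of the Lie bracket. If \<open>A\<close>
  were injective, its image would be all of \<open>V(f(s))\<close> and \<open>V\<close> could not be non-involutive
  (\<open>blow_up_not_inj\<close>).

  So \<open>A\<close> kills some direction. The formula for the displacements also bounds \<open>d\<close>-distances at scale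
  \<open>h\<close> by a multiple of \<open>\<bar>A (t - s)\<bar>\<close>, up to \<open>o(h)\<close> (\<open>blow_up_distance\<close>). Cutting a ball of radius
  \<open>h\<close> into \<open>O(N\<^sup>k\<^sup>-\<^sup>1)\<close> tubes parallel to the killed direction, each with image of diameter \<open>O(h/N)\<close>,
  shows that the image of the ball has premeasure \<open>O(h\<^sup>k/N)\<close> (\<open>blow_up_small_premeasure\<close>). The Vitali
  covering lemma sums these bounds (\<open>hausdorff_premeasure_Vitali\<close>), and it also disposes of the
  exceptional null set.
\<close>

section \<open>Adapted frames\<close>

text \<open>Tangential and normal parts are both vectors of the full coefficient space, padded with zeros, so
  that a coefficient vector is the sum of its two parts.\<close>
definition cut :: "'n set \<Rightarrow> real^'n \<Rightarrow> real^'n" where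
  "cut J a = (\<chi> i. if i \<in> J then a $ i else 0)"

lemma cut_nth [simp]: "cut J a $ i = (if i \<in> J then a $ i else 0)"
  by (simp add: cut_def)

lemma linear_cut: "linear (cut J)"
  by (rule linearI) (auto simp: vec_eq_iff)

lemma bounded_linear_cut: "bounded_linear (cut J :: real^'n::finite \<Rightarrow> real^'n)"
  using linear_cut linear_conv_bounded_linear by blast

lemma cut_add: "cut J (a + b) = cut J a + cut J b"
  and cut_diff: "cut J (a - b) = cut J a - cut J b"
  and cut_scaleR: "cut J (t *\<^sub>R a) = t *\<^sub>R cut J a"
  and cut_0 [simp]: "cut J 0 = 0"
  by (auto simp: vec_eq_iff)

lemma cut_split: "cut J a + cut (-J) a = a"
  by (auto simp: vec_eq_iff)

lemma cut_cut [simp]: "cut J (cut J a) = cut J a" "cut J (cut (-J) a) = 0" "cut (-J) (cut J a) = 0"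
  by (auto simp: vec_eq_iff)

lemma norm_cut_le: "norm (cut J a) \<le> norm (a :: real^'n::finite)"
  by (rule norm_le_componentwise_cart) auto

lemma norm_le_cut: "norm (a :: real^'n::finite) \<le> norm (cut J a) + norm (cut (-J) a)"
  by (metis cut_split norm_triangle_ineq)

lemmas tendsto_cut = bounded_linear.tendsto [OF bounded_linear_cut]

locale adapted_frame =
  fixes X :: "'n::finite \<Rightarrow> real^'n \<Rightarrow> real^'n" and I :: "'n set"
  assumes C1: "\<And>i. C_diff 1 (X i)"
    and inj_frame: "\<And>x. inj (\<lambda>a :: real^'n. \<Sum>i\<in>UNIV. a $ i *\<^sub>R X i x)"
begin

definition comb :: "real^'n \<Rightarrow> real^'n \<Rightarrow> real^'n" where
  "comb x a = (\<Sum>i\<in>UNIV. a $ i *\<^sub>R X i x)"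

definition coords :: "real^'n \<Rightarrow> real^'n \<Rightarrow> real^'n" where
  "coords x = inv (comb x)"

lemma linear_comb: "linear (comb x)"
  by (rule linearI) (simp_all add: comb_def scaleR_add_left sum.distrib scaleR_sum_right)

lemma inj_comb: "inj (comb x)"
  using inj_frame[of x] by (simp add: comb_def[abs_def])

lemma surj_comb: "surj (comb x)"
  using linear_injective_imp_surjective[OF linear_comb inj_comb] by blast

lemma comb_coords [simp]: "comb x (coords x v) = v"
  by (simp add: coords_def surj_f_inv_f surj_comb)

lemma coords_comb [simp]: "coords x (comb x a) = a"
  by (simp add: coords_def inv_f_f inj_comb)

lemma comb_add: "comb x (a + b) = comb x a + comb x b"
  and comb_diff: "comb x (a - b) = comb x a - comb x b"
  and comb_scaleR: "comb x (t *\<^sub>R a) = t *\<^sub>R comb x a"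
  and comb_0 [simp]: "comb x 0 = 0"
  using linear_comb[of x] by (simp_all add: linear_add linear_diff linear_scale linear_0)

lemma linear_coords: "linear (coords x)"
  by (rule linearI) (metis comb_add comb_coords coords_comb, metis comb_scaleR comb_coords coords_comb)

lemma coords_add: "coords x (a + b) = coords x a + coords x b"
  and coords_diff: "coords x (a - b) = coords x a - coords x b"
  and coords_scaleR: "coords x (t *\<^sub>R a) = t *\<^sub>R coords x a"
  and coords_0 [simp]: "coords x 0 = 0"
  using linear_coords[of x] by (simp_all add: linear_add linear_diff linear_scale linear_0)

lemma coords_sum: "coords x (\<Sum>i\<in>A. g i) = (\<Sum>i\<in>A. coords x (g i))"
  using linear_sum[OF linear_coords] by blast

lemma bounded_linear_coords: "bounded_linear (coords x)"
  using linear_coords linear_conv_bounded_linear by blast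

lemma coords_X [simp]: "coords x (X i x) = axis i 1"
proof -
  have "comb x (axis i 1) = (\<Sum>j\<in>UNIV. if j = i then X i x else 0)"
    unfolding comb_def by (rule sum.cong) (auto simp: axis_def)
  also have "\<dots> = X i x"
    by simp
  finally show ?thesis
    by (metis coords_comb)
qed

lemma X_differentiable: "X i differentiable (at x)"
  using C1[of i] by (simp add: One_nat_def)

lemma continuous_X: "continuous_on S (X i)"
  by (meson X_differentiable differentiable_imp_continuous_within differentiable_at_withinI
      continuous_on_eq_continuous_within)

lemma continuous_on_comb: "continuous_on S (\<lambda>z. comb (fst z) (snd z))"
  unfolding comb_def
  by (intro continuous_intros continuous_on_compose2[OF continuous_X[of UNIV]]) auto

text \<open>By compactness of \<open>S\<close> times the unit sphere, where the norm of the combination does not vanish.\<close>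
lemma comb_lower_bound:
  assumes "compact S"
  obtains c where "c > 0" "\<And>x a. x \<in> S \<Longrightarrow> c * norm a \<le> norm (comb x a)"
proof (cases "S = {}")
  case True
  then show thesis using that[of 1] by auto
next
  case False
  let ?T = "S \<times> sphere (0::real^'n) 1"
  have "continuous_on ?T (\<lambda>z. norm (comb (fst z) (snd z)))"
    by (intro continuous_on_norm continuous_on_comb)
  moreover have "compact ?T"
    by (intro compact_Times assms compact_sphere)
  moreover have "?T \<noteq> {}"
    using False by (auto simp: sphere_eq_empty)
  ultimately obtain z where z: "z \<in> ?T"
    "\<And>w. w \<in> ?T \<Longrightarrow> norm (comb (fst z) (snd z)) \<le> norm (comb (fst w) (snd w))"
    using continuous_attains_inf by (metis (no_types, lifting))
  define c where "c = norm (comb (fst z) (snd z))"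
  have "snd z \<noteq> 0"
    using z(1) by auto
  then have "c > 0"
    unfolding c_def by (metis coords_comb coords_0 zero_less_norm_iff)
  moreover have "c * norm a \<le> norm (comb x a)" if "x \<in> S" for x a
  proof (cases "a = 0")
    case False
    have "c \<le> norm (comb x (inverse (norm a) *\<^sub>R a))"
      using z(2)[of "(x, inverse (norm a) *\<^sub>R a)"] that False by (simp add: c_def)
    also have "\<dots> = norm (comb x a) / norm a"
      by (simp add: comb_scaleR divide_inverse_commute)
    finally show ?thesis
      using False by (simp add: field_simps)
  qed simp
  ultimately show thesis
    using that by blast
qed

lemma comb_upper_bound:
  assumes "compact S"
  obtains M where "M > 0" "\<And>x a. x \<in> S \<Longrightarrow> norm (comb x a) \<le> M * norm a"
proof -
  have "\<exists>B>0. \<forall>x\<in>S. norm (X i x) \<le> B" for i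
    using compact_imp_bounded[OF compact_continuous_image[OF continuous_X assms]]
    by (auto simp: bounded_pos)
  then obtain B where B: "\<And>i. B i > 0" "\<And>i x. x \<in> S \<Longrightarrow> norm (X i x) \<le> B i"
    by metis
  have "norm (comb x a) \<le> (\<Sum>i\<in>UNIV. B i) * norm a" if "x \<in> S" for x a
  proof -
    have "norm (comb x a) \<le> (\<Sum>i\<in>UNIV. norm a * B i)"
      unfolding comb_def using B that
      by (intro order_trans[OF norm_sum] sum_mono) (auto intro!: mult_mono simp: component_le_norm_cart)
    then show ?thesis
      by (simp add: sum_distrib_left mult.commute)
  qed
  moreover have "(\<Sum>i\<in>UNIV. B i) > 0"
    using B(1) by (intro sum_pos) auto
  ultimately show thesis
    using that by blast
qed

text \<open>Each frame field is \<open>C\<^sup>1\<close>, so its derivative is bounded on the ball, and balls are convex.\<close>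
lemma comb_lipschitz:
  obtains L where "L > 0" "\<And>x y a. x \<in> cball 0 R \<Longrightarrow> y \<in> cball 0 R \<Longrightarrow>
    norm (comb x a - comb y a) \<le> L * norm (x - y) * norm a"
proof -
  have "\<exists>B>0. \<forall>x\<in>cball 0 R. \<forall>y\<in>cball 0 R. norm (X i x - X i y) \<le> B * norm (x - y)" for i
  proof -
    let ?D = "\<lambda>x. frechet_derivative (X i) (at x)"
    have cont: "continuous_on (cball 0 R) (\<lambda>x. ?D x v)" for v
      using C1[of i] by (auto simp: One_nat_def intro: continuous_on_subset)
    have "\<exists>B>0. \<forall>x\<in>cball 0 R. norm (?D x v) \<le> B" for v
      using compact_imp_bounded[OF compact_continuous_image[OF cont compact_cball]]
      by (auto simp: bounded_pos)
    then obtain B where B: "\<And>v. B v > 0" "\<And>v x. x \<in> cball 0 R \<Longrightarrow> norm (?D x v) \<le> B v"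
      by metis
    have der: "(X i has_derivative ?D x) (at x within cball 0 R)" for x
      using X_differentiable frechet_derivative_works has_derivative_at_withinI by blast
    have lin: "linear (?D x)" for x
      using X_differentiable[of i x] frechet_derivative_works has_derivative_linear by blast
    let ?B = "\<Sum>b\<in>Basis. B b"
    have "onorm (?D x) \<le> ?B" if "x \<in> cball 0 R" for x
    proof (rule onorm_le)
      fix v
      have "norm (?D x v) = norm (\<Sum>b\<in>Basis. (v \<bullet> b) *\<^sub>R ?D x b)"
      proof -
        have "?D x (\<Sum>b\<in>Basis. (v \<bullet> b) *\<^sub>R b) = (\<Sum>b\<in>Basis. (v \<bullet> b) *\<^sub>R ?D x b)"
          by (simp only: linear_sum[OF lin] linear_scale[OF lin])
        then show ?thesis
          by (simp only: euclidean_representation)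
      qed
      also have "\<dots> \<le> (\<Sum>b\<in>Basis. norm v * B b)"
        using B that by (intro order_trans[OF norm_sum] sum_mono) (auto intro!: mult_mono simp: Basis_le_norm)
      finally show "norm (?D x v) \<le> ?B * norm v"
        by (simp add: sum_distrib_left mult.commute)
    qed
    then have "norm (X i x - X i y) \<le> ?B * norm (x - y)" if "x \<in> cball 0 R" "y \<in> cball 0 R" for x y
      using differentiable_bound[OF convex_cball der] that by blast
    moreover have "?B > 0"
      using B(1) by (intro sum_pos) auto
    ultimately show ?thesis by blast
  qed
  then obtain B where B: "\<And>i. B i > 0" "\<And>i x y. x \<in> cball 0 R \<Longrightarrow> y \<in> cball 0 R \<Longrightarrow>
      norm (X i x - X i y) \<le> B i * norm (x - y)"
    by metis
  have "norm (comb x a - comb y a) \<le> (\<Sum>i\<in>UNIV. B i) * norm (x - y) * norm a"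
    if "x \<in> cball 0 R" "y \<in> cball 0 R" for x y a
  proof -
    have "comb x a - comb y a = (\<Sum>i\<in>UNIV. a $ i *\<^sub>R (X i x - X i y))"
      by (simp add: comb_def sum_subtractf scaleR_diff_right)
    also have "norm \<dots> \<le> (\<Sum>i\<in>UNIV. norm a * (B i * norm (x - y)))"
      using B that
      by (intro order_trans[OF norm_sum] sum_mono) (auto intro!: mult_mono simp: component_le_norm_cart)
    finally show ?thesis
      by (simp add: sum_distrib_left sum_distrib_right mult_ac)
  qed
  moreover have "(\<Sum>i\<in>UNIV. B i) > 0"
    using B(1) by (intro sum_pos) auto
  ultimately show thesis
    using that by blast
qed

text \<open>Coordinates depend continuously on the vector and on the base point jointly. The lower bound on the
  combination map, uniform near \<open>x0\<close>, turns the continuity of the frame into that of the coordinates.\<close>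
lemma coords_tendsto:
  assumes x: "(x \<longlongrightarrow> x0) F" and v: "(v \<longlongrightarrow> v0) F"
  shows "((\<lambda>j. coords (x j) (v j)) \<longlongrightarrow> coords x0 v0) F"
proof -
  obtain c where c: "c > 0" "\<And>y a. y \<in> cball x0 1 \<Longrightarrow> c * norm a \<le> norm (comb y a)"
    using comb_lower_bound[OF compact_cball] by blast
  let ?b = "coords x0 v0"
  have "((\<lambda>j. v j - comb (x j) ?b) \<longlongrightarrow> v0 - comb x0 ?b) F"
    unfolding comb_def
    by (intro tendsto_intros v isCont_tendsto_compose[OF _ x])
       (use continuous_X[of UNIV] in \<open>simp add: continuous_on_eq_continuous_at\<close>)
  then have "((\<lambda>j. v j - comb (x j) ?b) \<longlongrightarrow> 0) F"
    by simp
  from tendsto_divide[OF tendsto_norm[OF this] tendsto_const[of c]]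
  have lim: "((\<lambda>j. norm (v j - comb (x j) ?b) / c) \<longlongrightarrow> 0) F"
    using c(1) by simp
  have "\<forall>\<^sub>F j in F. norm (coords (x j) (v j) - ?b) \<le> norm (v j - comb (x j) ?b) / c"
    using x[unfolded tendsto_iff, rule_format, of 1, simplified]
  proof eventually_elim
    case (elim j)
    then have "c * norm (coords (x j) (v j) - ?b) \<le> norm (comb (x j) (coords (x j) (v j) - ?b))"
      by (intro c) (simp add: dist_commute)
    then show ?case
      using c(1) by (simp add: comb_diff field_simps)
  qed
  then have "((\<lambda>j. coords (x j) (v j) - ?b) \<longlongrightarrow> 0) F"
    using lim by (rule Lim_null_comparison)
  then show ?thesis
    by (rule LIM_zero_cancel)
qed

end

lemma proj_along_eqI:
  assumes "subspace S" "subspace T" "S \<inter> T = {0}" "s \<in> S" "v - s \<in> T"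
  shows "proj_along S T v = s"
  unfolding proj_along_def
proof (rule the_equality)
  show "s \<in> S \<and> v - s \<in> T"
    using assms(4,5) by blast
next
  fix s' assume s': "s' \<in> S \<and> v - s' \<in> T"
  have "s - s' \<in> S"
    using assms(1,4) s' subspace_diff by blast
  moreover have "s - s' \<in> T"
    using subspace_diff[OF assms(2) conjunct2[OF s'] assms(5)] by simp
  ultimately have "s - s' = 0"
    using assms(3) by blast
  then show "s' = s"
    by simp
qed

lemma span_image_cut:
  fixes Y :: "'n::finite \<Rightarrow> real^'m"
  shows "span (Y ` J) = {\<Sum>i\<in>UNIV. cut J a $ i *\<^sub>R Y i | a. True}"
proof -
  let ?c = "\<lambda>a :: real^'n. \<Sum>i\<in>UNIV. cut J a $ i *\<^sub>R Y i"
  have "?c (a + b) = ?c a + ?c b" for a b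
    by (simp only: cut_add vector_add_component scaleR_add_left sum.distrib)
  moreover have "?c (t *\<^sub>R a) = t *\<^sub>R ?c a" for t a
    by (simp add: cut_scaleR scaleR_sum_right del: cut_nth)
  ultimately have "linear ?c"
    by (rule linearI)
  then have "subspace (range ?c)"
    by (rule linear_subspace_image) (rule subspace_UNIV)
  moreover have "Y j \<in> range ?c" if "j \<in> J" for j
  proof
    have "?c (axis j 1) = (\<Sum>i\<in>UNIV. if i = j then Y j else 0)"
      using that by (intro sum.cong) (auto simp: axis_def)
    then show "Y j = ?c (axis j 1)"
      by simp
  qed simp
  ultimately have "span (Y ` J) \<subseteq> range ?c"
    by (intro span_minimal) auto
  moreover have "?c a \<in> span (Y ` J)" for a
    by (intro span_sum) (auto intro: span_scale span_base span_zero)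
  ultimately show ?thesis
    by (auto simp: full_SetCompr_eq)
qed

text \<open>The \<open>n\<close> spanning fields are reindexed by the coordinate type. Their combinations reach all of
  \<open>V(x) + W(x)\<close>, so they span, and \<open>n\<close> spanning vectors are independent.\<close>
lemma obtain_adapted_frame:
  fixes V W :: "real^'n::finite \<Rightarrow> (real^'n) set"
  assumes "complementary_distributions k V W"
  obtains X and I :: "'n set" where "adapted_frame X" "card I = k"
    "\<And>x. V x = {adapted_frame.comb X x (cut I a) | a. True}"
    "\<And>x. W x = {adapted_frame.comb X x (cut (-I) a) | a. True}"
proof -
  note cd = assms[unfolded complementary_distributions_def, simplified DIM_cart DIM_real mult_1_right]
  have k: "k \<le> CARD('n)"
    using cd by blast
  from cd obtain Z :: "nat \<Rightarrow> real^'n \<Rightarrow> real^'n" where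
    Z: "\<forall>i\<in>{1..CARD('n)}. smooth_map (Z i)"
    and VW': "\<forall>x. V x = span ((\<lambda>i. Z i x) ` {1..k}) \<and> W x = span ((\<lambda>i. Z i x) ` {k+1..CARD('n)})"
    by blast
  have VW: "V x = span ((\<lambda>i. Z i x) ` {1..k})" "W x = span ((\<lambda>i. Z i x) ` {k+1..CARD('n)})" for x
    using VW' by blast+
  have sum: "{v + w |v w. v \<in> V x \<and> w \<in> W x} = UNIV" for x
    using cd by blast
  obtain h :: "'n \<Rightarrow> nat" where h: "bij_betw h UNIV {1..CARD('n)}"
    using finite_same_card_bij[of "UNIV::'n set" "{1..CARD('n)}"] by auto
  define X where "X = (\<lambda>i. Z (h i))"
  define I where "I = {i. h i \<le> k}"
  have hI: "h ` I = {1..k}"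
  proof -
    have "h ` I \<subseteq> {1..k}" using h by (auto simp: I_def bij_betw_def)
    moreover have "j \<in> h ` I" if "j \<in> {1..k}" for j
    proof -
      have "j \<in> range h" using h k that by (auto simp: bij_betw_def)
      then show ?thesis using that by (auto simp: I_def)
    qed
    ultimately show ?thesis by auto
  qed
  have hI': "h ` (-I) = {k+1..CARD('n)}"
  proof -
    have "h ` (-I) = range h - h ` I"
      using h by (simp add: Compl_eq_Diff_UNIV image_set_diff bij_betw_def)
    then show ?thesis
      using h hI k by (auto simp: bij_betw_def)
  qed
  have card: "card I = k"
    using hI card_image[of h I] h by (metis bij_betw_def card_atLeastAtMost diff_Suc_1 inj_on_subset subset_UNIV)
  have V: "V x = {\<Sum>i\<in>UNIV. cut I a $ i *\<^sub>R X i x | a. True}" for x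
    unfolding VW hI[symmetric] image_image X_def by (rule span_image_cut)
  have W: "W x = {\<Sum>i\<in>UNIV. cut (-I) a $ i *\<^sub>R X i x | a. True}" for x
    unfolding VW hI'[symmetric] image_image X_def by (rule span_image_cut)
  have fr: "adapted_frame X"
  proof
    fix i
    show "C_diff 1 (X i)"
      using Z bij_betw_apply[OF h, of i] unfolding X_def smooth_map_def by blast
  next
    fix x
    let ?c = "\<lambda>a :: real^'n. \<Sum>i\<in>UNIV. a $ i *\<^sub>R X i x"
    have lin: "linear ?c"
      by (rule linearI) (simp_all add: scaleR_add_left sum.distrib scaleR_sum_right)
    have "y \<in> range ?c" for y
    proof -
      have "y \<in> {v + w |v w. v \<in> V x \<and> w \<in> W x}" using sum by blast
      then obtain a b where "y = ?c (cut I a) + ?c (cut (-I) b)"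
        unfolding V W by auto
      then show ?thesis
        using linear_add[OF lin, of "cut I a" "cut (-I) b"] by (intro image_eqI[of _ _ "cut I a + cut (-I) b"]) auto
    qed
    then show "inj ?c"
      using linear_surjective_imp_injective[OF lin] by blast
  qed
  then interpret adapted_frame X .
  show thesis
    using that[OF fr card] V W by (simp add: comb_def)
qed

text \<open>The projections along \<open>V\<close> and \<open>W\<close> correspond to cutting coefficient vectors, and on a compact set
  the frame distorts norms by bounded factors only.\<close>
lemma squeezed_coords:
  fixes d :: "(real^'n::finite) metric"
  assumes sq: "squeezed \<eta> V W d" and \<eta>: "\<eta> > 0" and sp: "mspace d = UNIV"
    and fr: "adapted_frame X"
    and V: "\<And>x. V x = {adapted_frame.comb X x (cut I a) | a. True}"
    and W: "\<And>x. W x = {adapted_frame.comb X x (cut (-I) a) | a. True}"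
    and S: "compact S"
  obtains C r where "C > 0" "r > 0"
    "\<And>x y. x \<in> S \<Longrightarrow> mdist d x y \<le> r \<Longrightarrow>
       norm (cut I (adapted_frame.coords X x (y - x)))
         + norm (cut (-I) (adapted_frame.coords X x (y - x))) powr (1/\<eta>) \<le> C * mdist d x y"
    "\<And>x y. x \<in> S \<Longrightarrow> mdist d x y \<le> r \<Longrightarrow>
       mdist d x y \<le> C * (norm (cut I (adapted_frame.coords X x (y - x)))
         + norm (cut (-I) (adapted_frame.coords X x (y - x))) powr (1/\<eta>))"
proof -
  interpret adapted_frame X by fact
  obtain C r where Cr: "C > 1" "r > 0" and
    est: "\<forall>x\<in>S. \<forall>y\<in>mcball_of d x r.
           let p = proj_along (V x) (W x) (y - x);
               N = norm p + norm ((y - x) - p) powr (1 / \<eta>)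
           in inverse C * N \<le> mdist d x y \<and> mdist d x y \<le> C * N"
    using sq S unfolding squeezed_def by blast
  obtain c where c: "c > 0" "\<And>x a. x \<in> S \<Longrightarrow> c * norm a \<le> norm (comb x a)"
    using comb_lower_bound[OF S] by blast
  obtain M where M: "M > 0" "\<And>x a. x \<in> S \<Longrightarrow> norm (comb x a) \<le> M * norm a"
    using comb_upper_bound[OF S] by blast
  have sub: "subspace (V x)" "subspace (W x)" "V x \<inter> W x = {0}" for x
  proof -
    have im: "V x = comb x ` (range (cut I))" "W x = comb x ` (range (cut (-I)))"
      by (auto simp: V W)
    show "subspace (V x)" "subspace (W x)"
      unfolding im by (intro linear_subspace_image linear_comb linear_cut subspace_UNIV)+
    have "cut I a = 0" if "comb x (cut I a) = comb x (cut (-I) b)" for a b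
      using arg_cong[OF that, of "\<lambda>z. cut I (coords x z)"] by simp
    then show "V x \<inter> W x = {0}"
      by (auto simp: V W intro: exI[of _ 0]) (metis comb_0)
  qed
  have proj: "proj_along (V x) (W x) v = comb x (cut I (coords x v))" for x v
  proof (rule proj_along_eqI[OF sub])
    show "v - comb x (cut I (coords x v)) \<in> W x"
      unfolding W using cut_split[of I "coords x v"]
      by (metis (mono_tags, lifting) add_diff_cancel_left' comb_coords comb_diff mem_Collect_eq)
  qed (auto simp: V)
  (* Distortion factors of the frame that serve both terms, the second one being raised to 1/eta. *)
  define m M' where "m = min c (c powr (1/\<eta>))" and "M' = max M (M powr (1/\<eta>))"
  have mM: "m > 0" "M' > 0" using c M by (auto simp: m_def M'_def)
  define D where "D = max (C / m) (C * M')"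
  have main: "norm (cut I (coords x (y - x)))
         + norm (cut (-I) (coords x (y - x))) powr (1/\<eta>) \<le> D * mdist d x y \<and>
         mdist d x y \<le> D * (norm (cut I (coords x (y - x)))
         + norm (cut (-I) (coords x (y - x))) powr (1/\<eta>))"
    if x: "x \<in> S" and xy: "mdist d x y \<le> r" for x y
  proof -
    let ?a = "cut I (coords x (y - x))" and ?b = "cut (-I) (coords x (y - x))"
    let ?N = "norm ?a + norm ?b powr (1/\<eta>)"
    have "(y - x) - comb x ?a = comb x ?b"
      using cut_split[of I "coords x (y - x)"]
      by (metis add_diff_cancel_left' comb_coords comb_diff)
    have y: "y \<in> mcball_of d x r"
      using xy sp by simp
    from \<open>(y - x) - comb x ?a = comb x ?b\<close>
    have e: "inverse C * (norm (comb x ?a) + norm (comb x ?b) powr (1/\<eta>)) \<le> mdist d x y"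
      "mdist d x y \<le> C * (norm (comb x ?a) + norm (comb x ?b) powr (1/\<eta>))"
      using est[rule_format, OF x y] by (simp_all add: proj Let_def)
    have "m * norm ?a \<le> norm (comb x ?a)"
      using c(2)[OF x, of ?a] by (smt (verit) m_def mult_right_mono norm_ge_zero)
    moreover have "m * norm ?b powr (1/\<eta>) \<le> norm (comb x ?b) powr (1/\<eta>)"
    proof -
      have "m * norm ?b powr (1/\<eta>) \<le> c powr (1/\<eta>) * norm ?b powr (1/\<eta>)"
        by (intro mult_right_mono) (auto simp: m_def)
      also have "\<dots> = (c * norm ?b) powr (1/\<eta>)"
        using c by (simp add: powr_mult)
      also have "\<dots> \<le> norm (comb x ?b) powr (1/\<eta>)"
        using c \<eta> x by (intro powr_mono2) auto
      finally show ?thesis .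
    qed
    ultimately have "m * ?N \<le> norm (comb x ?a) + norm (comb x ?b) powr (1/\<eta>)"
      by (simp add: distrib_left)
    also have "\<dots> \<le> C * mdist d x y"
      using e(1) Cr by (simp add: field_simps)
    finally have "?N \<le> C / m * mdist d x y"
      using mM by (simp add: field_simps)
    also have "\<dots> \<le> D * mdist d x y"
      by (intro mult_right_mono) (auto simp: D_def)
    finally have 1: "?N \<le> D * mdist d x y" .
    have "norm (comb x ?a) \<le> M' * norm ?a"
      using M(2)[OF x, of ?a] by (smt (verit) M'_def mult_right_mono norm_ge_zero)
    moreover have "norm (comb x ?b) powr (1/\<eta>) \<le> M' * norm ?b powr (1/\<eta>)"
    proof -
      have "norm (comb x ?b) powr (1/\<eta>) \<le> (M * norm ?b) powr (1/\<eta>)"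
        using M \<eta> x by (intro powr_mono2) auto
      also have "\<dots> = M powr (1/\<eta>) * norm ?b powr (1/\<eta>)"
        using M by (simp add: powr_mult)
      also have "\<dots> \<le> M' * norm ?b powr (1/\<eta>)"
        by (intro mult_right_mono) (auto simp: M'_def)
      finally show ?thesis .
    qed
    ultimately have "norm (comb x ?a) + norm (comb x ?b) powr (1/\<eta>) \<le> M' * ?N"
      by (simp add: distrib_left)
    then have "mdist d x y \<le> C * (M' * ?N)"
      using e(2) Cr by (smt (verit) mult_left_mono)
    also have "\<dots> \<le> D * ?N"
      unfolding mult.assoc[symmetric] by (intro mult_right_mono) (auto simp: D_def)
    finally show ?thesis using 1 by blast
  qed
  show thesis
    by (rule that[of D r]) (use main Cr mM in \<open>auto simp: D_def less_max_iff_disj\<close>)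
qed

section \<open>Hausdorff measure of expanding images\<close>

lemma mdist_le_mdiam:
  assumes "x \<in> A" "y \<in> A"
  shows "ennreal (mdist m x y) \<le> mdiam m A"
  unfolding mdiam_def using assms by (intro SUP_upper2[OF assms(1)] SUP_upper2[OF assms(2)]) auto

lemma emeasure_lborel_cbox_cart:
  fixes a b :: "real^'k"
  assumes "\<And>l. a $ l \<le> b $ l"
  shows "emeasure lborel (cbox a b) = ennreal (\<Prod>l\<in>UNIV. b $ l - a $ l)"
proof -
  have "cbox a b \<noteq> {}"
    using assms by (auto simp: interval_ne_empty_cart)
  then show ?thesis
    using content_cbox_cart[of a b] emeasure_eq_ennreal_measure[of lborel "cbox a b"]
      emeasure_lborel_cbox_finite[of a b] by auto
qed

text \<open>Pulling back a cover of \<open>f ` K\<close> by sets of diameters \<open>D\<^sub>i\<close> gives a cover of \<open>K\<close> by cubes of side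
  \<open>2 D\<^sub>i / c\<close>. Hence the sum of the \<open>D\<^sub>i\<^sup>k\<close> is bounded below by a multiple of the Lebesgue measure.\<close>
lemma hausdorff_measure_pos_of_expanding:
  fixes K :: "(real^'k) set"
  assumes K: "K \<in> sets lborel" "emeasure lborel K > 0" and c: "c > 0"
    and lower: "\<And>s t. s \<in> K \<Longrightarrow> t \<in> K \<Longrightarrow> c * norm (t - s) \<le> mdist d (f s) (f t)"
  shows "hausdorff_measure d CARD('k) (f ` K) > 0"
proof -
  let ?k = "CARD('k)"
  let ?u = "unit_ball_vol (real ?k) / 2 ^ ?k"
  let ?v = "ennreal (?u * (c/2)^?k) * emeasure lborel K"
  have u: "?u > 0" by simp
  have "?v \<le> hausdorff_premeasure d ?k 1 (f ` K)"
    unfolding hausdorff_premeasure_def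
  proof (rule INF_greatest)
    fix C :: "nat \<Rightarrow> 'a set"
    assume "C \<in> {C. f ` K \<subseteq> (\<Union>i. C i) \<and> (\<forall>i. C i \<subseteq> mspace d \<and> mdiam d (C i) \<le> ennreal 1)}"
    then have cov: "f ` K \<subseteq> (\<Union>i. C i)" and diam: "\<And>i. mdiam d (C i) \<le> ennreal 1"
      by auto
    define D where "D i = enn2real (mdiam d (C i))" for i
    have D: "ennreal (D i) = mdiam d (C i)" for i
      unfolding D_def using diam[of i] by (intro ennreal_enn2real) (auto simp: le_less_trans)
    have D0: "D i \<ge> 0" for i by (simp add: D_def)
    (* A centre in K for the cube around the preimage of C i. *)
    define g where "g i = (SOME s. s \<in> K \<and> f s \<in> C i)" for i
    define B where "B i = (if C i = {} then {} else cbox (g i - (\<chi> l. D i / c)) (g i + (\<chi> l. D i / c)))" for i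
    have "K \<subseteq> (\<Union>i. B i)"
    proof
      fix t assume t: "t \<in> K"
      then obtain i where i: "f t \<in> C i" using cov by auto
      then have g: "g i \<in> K \<and> f (g i) \<in> C i"
        unfolding g_def using t someI[of "\<lambda>s. s \<in> K \<and> f s \<in> C i" t] by blast
      have "ennreal (mdist d (f (g i)) (f t)) \<le> ennreal (D i)"
        unfolding D using g i by (intro mdist_le_mdiam) auto
      then have "mdist d (f (g i)) (f t) \<le> D i"
        using D0 by simp
      then have "c * norm (t - g i) \<le> D i"
        using lower[of "g i" t] g t by auto
      then have "norm (t - g i) \<le> D i / c"
        using c by (simp add: field_simps)
      then have "\<bar>t $ l - g i $ l\<bar> \<le> D i / c" for l
        using component_le_norm_cart[of "t - g i" l] by simp
      then have "t \<in> B i"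
        using i by (auto simp: B_def mem_box_cart abs_le_iff algebra_simps)
      then show "t \<in> (\<Union>i. B i)" by blast
    qed
    then have "emeasure lborel K \<le> emeasure lborel (\<Union>i. B i)"
      by (intro emeasure_mono) (auto simp: B_def)
    also have "\<dots> \<le> (\<Sum>i. emeasure lborel (B i))"
      by (intro emeasure_subadditive_countably) (auto simp: B_def)
    also have "\<dots> \<le> (\<Sum>i. ennreal ((2/c)^?k) * (if C i = {} then 0 else mdiam d (C i) ^ ?k))"
    proof (intro suminf_le summableI)
      fix i
      have "emeasure lborel (cbox (g i - (\<chi> l. D i / c)) (g i + (\<chi> l. D i / c)))
          = ennreal ((2/c * D i)^?k)"
      proof (subst emeasure_lborel_cbox_cart)
        show "(g i - (\<chi> l. D i / c)) $ l \<le> (g i + (\<chi> l. D i / c)) $ l" for l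
          using D0[of i] c by simp
        have "(g i + (\<chi> l. D i / c)) $ l - (g i - (\<chi> l. D i / c)) $ l = 2/c * D i" for l
          by simp
        then show "ennreal (\<Prod>l\<in>UNIV. (g i + (\<chi> l. D i / c)) $ l - (g i - (\<chi> l. D i / c)) $ l)
            = ennreal ((2/c * D i)^?k)"
          by simp
      qed
      also have "\<dots> = ennreal ((2/c)^?k) * mdiam d (C i) ^ ?k"
        unfolding D[symmetric] power_mult_distrib using c D0 by (simp add: ennreal_mult ennreal_power)
      finally show "emeasure lborel (B i) \<le> ennreal ((2/c)^?k) * (if C i = {} then 0 else mdiam d (C i) ^ ?k)"
        by (simp add: B_def)
    qed
    also have "\<dots> = ennreal ((2/c)^?k) * (\<Sum>i. if C i = {} then 0 else mdiam d (C i) ^ ?k)"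
      by (rule ennreal_suminf_cmult)
    finally have "?v \<le> ennreal (?u * (c/2)^?k) * (ennreal ((2/c)^?k) * (\<Sum>i. if C i = {} then 0 else mdiam d (C i) ^ ?k))"
      by (rule mult_left_mono) simp
    also have "\<dots> = ennreal (?u * (c/2)^?k) * ennreal ((2/c)^?k) * (\<Sum>i. if C i = {} then 0 else mdiam d (C i) ^ ?k)"
      by (simp only: mult.assoc)
    also have "ennreal (?u * (c/2)^?k) * ennreal ((2/c)^?k) = ennreal (?u * (c/2)^?k * (2/c)^?k)"
      using c u by (intro ennreal_mult[symmetric]) auto
    also have "?u * (c/2)^?k * (2/c)^?k = ?u"
      using c by (simp add: power_divide)
    finally show "?v \<le> ennreal ?u * (\<Sum>i. if C i = {} then 0 else mdiam d (C i) ^ ?k)" .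
  qed
  also have "\<dots> \<le> hausdorff_measure d ?k (f ` K)"
    unfolding hausdorff_measure_def by (rule SUP_upper) simp
  finally have "?v \<le> hausdorff_measure d ?k (f ` K)" .
  moreover have "?v > 0"
    using K(2) u c by (auto simp: ennreal_zero_less_mult_iff)
  ultimately show ?thesis by (rule less_le_trans[rotated])
qed

section \<open>A fat Cantor set that avoids the dyadic grid\<close>

text \<open>The gaps shrink by the factor \<open>\<theta>\<close> relative to the cubes, so the removed volume is summable, yet
  points in different cubes are separated by a power of the size of the cube.\<close>
definition dyadic_gap_set :: "real \<Rightarrow> real \<Rightarrow> (real^'k) set" where
  "dyadic_gap_set c \<theta> = {s. \<forall>i. 0 \<le> s $ i \<and> s $ i \<le> 1 \<and>
     (\<forall>(j::nat) (m::int). c * (\<theta> / 2)^j \<le> \<bar>s $ i - of_int m / 2^j\<bar>)}"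

lemma compact_dyadic_gap_set: "compact (dyadic_gap_set c \<theta> :: (real^'k) set)"
proof -
  have "closed (dyadic_gap_set c \<theta> :: (real^'k) set)"
    unfolding dyadic_gap_set_def
    by (intro closed_Collect_all closed_Collect_conj closed_Collect_le continuous_intros)
  moreover have "dyadic_gap_set c \<theta> \<subseteq> cbox (\<chi> i. 0) (\<chi> i. 1 :: real^'k)"
    by (auto simp: dyadic_gap_set_def mem_box_cart)
  ultimately show ?thesis
    using bounded_cbox bounded_subset compact_eq_bounded_closed by blast
qed

lemma emeasure_slab_le:
  fixes i :: "'k::finite"
  assumes "h \<ge> 0"
  shows "emeasure lborel {s :: real^'k. (\<forall>l. 0 \<le> s $ l \<and> s $ l \<le> 1) \<and> \<bar>s $ i - a\<bar> < h} \<le> ennreal (2 * h)"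
proof -
  define A B :: "real^'k" where "A = (\<chi> l. if l = i then a - h else 0)" and "B = (\<chi> l. if l = i then a + h else 1)"
  have "emeasure lborel {s :: real^'k. (\<forall>l. 0 \<le> s $ l \<and> s $ l \<le> 1) \<and> \<bar>s $ i - a\<bar> < h} \<le> emeasure lborel (cbox A B)"
    by (rule emeasure_mono) (auto simp: mem_box_cart A_def B_def abs_less_iff algebra_simps intro: less_imp_le)
  also have "\<dots> = ennreal (\<Prod>l\<in>UNIV. B $ l - A $ l)"
    using assms by (intro emeasure_lborel_cbox_cart) (auto simp: A_def B_def)
  also have "(\<Prod>l\<in>UNIV. B $ l - A $ l) = (\<Prod>l\<in>UNIV. if l = i then 2 * h else 1)"
    by (intro prod.cong) (auto simp: A_def B_def)
  also have "\<dots> = 2 * h"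
    by simp
  finally show ?thesis .
qed

text \<open>At level \<open>j\<close> at most \<open>k (2\<^sup>j + 1)\<close> slabs of width \<open>2c(\<theta>/2)\<^sup>j\<close> are removed from the unit cube. Their
  volume is at most \<open>4kc \<theta>\<^sup>j\<close>, which has sum \<open>1/2\<close> for the constant \<open>c\<close> chosen in the proof.\<close>
lemma emeasure_dyadic_gap_set_pos:
  assumes \<theta>: "0 < \<theta>" "\<theta> < 1"
  obtains c where "c > 0" "emeasure lborel (dyadic_gap_set c \<theta> :: (real^'k) set) > 0"
proof -
  let ?k = "real CARD('k)"
  define c where "c = (1 - \<theta>) / (8 * ?k)"
  have c: "c > 0" "c \<le> 1"
  proof -
    have "?k \<ge> 1"
      using zero_less_card_finite[where 'a='k] by linarith
    then have "8 * ?k > 0" "1 - \<theta> \<le> 8 * ?k"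
      using \<theta> by linarith+
    then show "c > 0" "c \<le> 1"
      unfolding c_def using \<theta> by (simp_all only: divide_le_eq_1_pos) (intro divide_pos_pos, auto)
  qed
  let ?K = "dyadic_gap_set c \<theta> :: (real^'k) set"
  define h where "h j = c * (\<theta> / 2)^j" for j :: nat
  have h: "h j \<ge> 0" for j using c \<theta> by (simp add: h_def)
  define slab :: "'k \<Rightarrow> nat \<Rightarrow> int \<Rightarrow> (real^'k) set" where
    "slab i j m = {s. (\<forall>l. 0 \<le> s $ l \<and> s $ l \<le> 1) \<and> \<bar>s $ i - of_int m / 2^j\<bar> < h j}" for i j m
  have slab_sets: "slab i j m \<in> sets lborel" for i j m
    unfolding slab_def by measurable
  let ?U = "\<lambda>j. \<Union>z\<in>UNIV \<times> {0..2^j}. slab (fst z) j (snd z)"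
  have sets_U: "?U j \<in> sets lborel" for j
    using slab_sets by (intro sets.finite_UN) auto
  have sets_K: "?K \<in> sets lborel"
    using borel_compact[OF compact_dyadic_gap_set[of c \<theta>]] by simp
  have sub: "cbox 0 1 \<subseteq> ?K \<union> (\<Union>j. ?U j)"
  proof
    fix s :: "real^'k" assume "s \<in> cbox 0 1"
    then have s: "\<And>l. 0 \<le> s $ l \<and> s $ l \<le> 1"
      by (simp add: mem_box_cart)
    show "s \<in> ?K \<union> (\<Union>j. ?U j)"
    proof (cases "s \<in> ?K")
      case False
      then obtain i j and m :: int where m: "\<bar>s $ i - of_int m / 2^j\<bar> < h j"
        using s by (auto simp: dyadic_gap_set_def h_def not_le)
      (* Since c (theta/2)^j <= 2^-j, only slabs around grid planes with 0 <= m <= 2^j meet the unit cube. *)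
      have "(\<theta> / 2)^j \<le> (1/2)^j"
        using \<theta> by (intro power_mono) auto
      then have "h j \<le> 1 * (1/2)^j"
        unfolding h_def using c \<theta> by (intro mult_mono) auto
      then have "\<bar>s $ i - of_int m / 2^j\<bar> < 1 / 2^j"
        using m by (simp add: power_one_over)
      then have "\<bar>2^j * s $ i - of_int m\<bar> < 1"
        by (simp add: abs_less_iff field_simps)
      moreover have "0 \<le> 2^j * s $ i" "2^j * s $ i \<le> 2^j"
        using s[of i] by (auto simp: mult_left_le)
      ultimately have "real_of_int m > -1" "real_of_int m < 2^j + 1"
        by linarith+
      then have "m > -1" "real_of_int m < real_of_int (2^j + 1)"
        by auto
      then have "m > -1" "m < 2^j + 1"
        by (auto simp only: of_int_less_iff)
      then have "m \<in> {0..2^j}" by auto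
      moreover have "s \<in> slab i j m"
        using s m by (simp add: slab_def)
      ultimately show ?thesis by force
    qed simp
  qed
  have U: "emeasure lborel (?U j) \<le> ennreal ((1 - \<theta>) / 2 * \<theta>^j)" for j
  proof -
    have "emeasure lborel (?U j) \<le> (\<Sum>z\<in>UNIV \<times> {0..2^j}. emeasure lborel (slab (fst z) j (snd z)))"
      using slab_sets by (intro emeasure_subadditive_finite) auto
    also have "\<dots> \<le> (\<Sum>z\<in>(UNIV :: 'k set) \<times> {0..2^j::int}. ennreal (2 * h j))"
      unfolding slab_def by (intro sum_mono emeasure_slab_le h)
    also have "\<dots> = ennreal (?k * (2^j + 1) * (2 * h j))"
    proof -
      have "(\<Sum>z\<in>(UNIV :: 'k set) \<times> {0..2^j::int}. ennreal (2 * h j))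
          = ennreal (\<Sum>z\<in>(UNIV :: 'k set) \<times> {0..2^j::int}. 2 * h j)"
        using h[of j] by (intro sum_ennreal) auto
      also have "(\<Sum>z\<in>(UNIV :: 'k set) \<times> {0..2^j::int}. 2 * h j) = ?k * (2^j + 1) * (2 * h j)"
        by (simp add: card_cartesian_product nat_add_distrib nat_power_eq algebra_simps)
      finally show ?thesis .
    qed
    also have "\<dots> \<le> ennreal ((1 - \<theta>) / 2 * \<theta>^j)"
    proof (rule ennreal_leI)
      have "?k * (2^j + 1) * (2 * h j) \<le> ?k * (2 * 2^j) * (2 * h j)"
        using h[of j] by (intro mult_mono) auto
      also have "\<dots> = (1 - \<theta>) / 2 * \<theta>^j"
        by (simp add: h_def c_def power_divide field_simps)
      finally show "?k * (2^j + 1) * (2 * h j) \<le> (1 - \<theta>) / 2 * \<theta>^j" .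
    qed
    finally show ?thesis .
  qed
  have geo: "(\<lambda>j. (1 - \<theta>) / 2 * \<theta>^j) sums (1 / 2)"
  proof -
    have "(1 - \<theta>) / 2 * (1 / (1 - \<theta>)) = 1 / 2"
      using \<theta> by simp
    moreover have "norm \<theta> < 1"
      using \<theta> by simp
    ultimately show ?thesis
      by (metis sums_mult geometric_sums)
  qed
  have "1 = emeasure lborel (cbox 0 (1 :: real^'k))"
    by (subst emeasure_lborel_cbox_cart) auto
  also have "\<dots> \<le> emeasure lborel (?K \<union> (\<Union>j. ?U j))"
    using sets_K sets_U by (intro emeasure_mono sub) auto
  also have "\<dots> \<le> emeasure lborel ?K + emeasure lborel (\<Union>j. ?U j)"
    using sets_K sets_U by (intro emeasure_subadditive) auto
  also have "emeasure lborel (\<Union>j. ?U j) \<le> (\<Sum>j. emeasure lborel (?U j))"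
    using sets_U by (intro emeasure_subadditive_countably) auto
  also have "\<dots> \<le> (\<Sum>j. ennreal ((1 - \<theta>) / 2 * \<theta>^j))"
    by (intro suminf_le summableI U)
  also have "\<dots> = ennreal (1/2)"
    using \<theta> by (intro suminf_ennreal_eq[OF _ geo]) auto
  finally have *: "1 \<le> emeasure lborel ?K + ennreal (1/2)"
    by (simp add: add_left_mono)
  have "emeasure lborel ?K \<noteq> 0"
  proof
    assume "emeasure lborel ?K = 0"
    then have "ennreal 1 \<le> ennreal (1/2)" using * by simp
    then show False by (subst (asm) ennreal_le_iff) auto
  qed
  then show thesis
    using that[of c] c by (simp add: zero_less_iff_neq_zero)
qed

text \<open>Take the first level at which the two points lie in different dyadic cubes. A grid hyperplane of that
  level separates them, and both keep their distance from it.\<close>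
lemma dyadic_gap_set_separated:
  fixes s t :: "real^'k"
  assumes s: "s \<in> dyadic_gap_set c \<theta>" and t: "t \<in> dyadic_gap_set c \<theta>" and ne: "s \<noteq> t" and c: "c > 0"
  obtains j :: nat where "\<And>i. \<lfloor>2^j * s $ i\<rfloor> = \<lfloor>2^j * t $ i\<rfloor>" "c * (\<theta> / 2)^(Suc j) \<le> norm (t - s)"
proof -
  let ?P = "\<lambda>j::nat. \<exists>i. \<lfloor>2^j * s $ i\<rfloor> \<noteq> \<lfloor>2^j * t $ i\<rfloor>"
  (* At level 0 all points lie in the same cube, because the planes 0 and 1 are avoided. *)
  have fl: "\<lfloor>r $ i\<rfloor> = 0" if "r \<in> dyadic_gap_set c \<theta>" for r :: "real^'k" and i
  proof -
    have b: "0 \<le> r $ i" "r $ i \<le> 1" "\<And>(j::nat) (m::int). c * (\<theta> / 2)^j \<le> \<bar>r $ i - of_int m / 2^j\<bar>"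
      using that by (auto simp: dyadic_gap_set_def)
    show ?thesis
      using b(1,2) b(3)[of 0 1] c by (auto simp: floor_eq_iff)
  qed
  have "\<not> ?P 0"
    using fl[OF s] fl[OF t] by simp
  moreover obtain n where "?P n"
  proof -
    obtain i where i: "s $ i \<noteq> t $ i" using ne by (auto simp: vec_eq_iff)
    obtain n where "1 / \<bar>s $ i - t $ i\<bar> < 2 ^ n"
      using real_arch_pow[of 2] by auto
    then have "1 < 2 ^ n * \<bar>s $ i - t $ i\<bar>"
      using i by (simp add: field_simps)
    also have "\<dots> = \<bar>2^n * s $ i - 2^n * t $ i\<bar>"
      by (simp add: abs_mult right_diff_distrib[symmetric])
    finally have "\<lfloor>2^n * s $ i\<rfloor> \<noteq> \<lfloor>2^n * t $ i\<rfloor>" by linarith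
    then show thesis using that by blast
  qed
  ultimately have "\<exists>j<n. (\<forall>i\<le>j. \<not> ?P i) \<and> ?P (Suc j)"
    by (intro ex_least_nat_less)
  then obtain j where j: "\<forall>i\<le>j. \<not> ?P i" "?P (Suc j)"
    by blast
  then obtain i where i: "\<lfloor>2^Suc j * s $ i\<rfloor> \<noteq> \<lfloor>2^Suc j * t $ i\<rfloor>" by blast
  have gap: "c * (\<theta> / 2)^(Suc j) \<le> y $ i - x $ i"
    if lt: "\<lfloor>2^Suc j * x $ i\<rfloor> < \<lfloor>2^Suc j * y $ i\<rfloor>" and y: "y \<in> dyadic_gap_set c \<theta>" for x y :: "real^'k"
  proof -
    let ?m = "\<lfloor>2^Suc j * y $ i\<rfloor>"
    have "c * (\<theta> / 2)^(Suc j) \<le> \<bar>y $ i - of_int ?m / 2^Suc j\<bar>"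
      using y unfolding dyadic_gap_set_def by blast
    moreover have "of_int ?m / 2^Suc j \<le> y $ i"
      using of_int_floor_le[of "2^Suc j * y $ i"] by (simp add: field_simps del: of_int_floor_le)
    moreover have "x $ i < of_int ?m / 2^Suc j"
    proof -
      have "2^Suc j * x $ i < of_int ?m" using lt by (simp add: floor_less_iff)
      then show ?thesis by (simp add: field_simps)
    qed
    ultimately show ?thesis by linarith
  qed
  have "c * (\<theta> / 2)^(Suc j) \<le> \<bar>t $ i - s $ i\<bar>"
  proof (cases "\<lfloor>2^Suc j * s $ i\<rfloor> < \<lfloor>2^Suc j * t $ i\<rfloor>")
    case True
    from gap[OF this t] show ?thesis by linarith
  next
    case False
    with i have "\<lfloor>2^Suc j * t $ i\<rfloor> < \<lfloor>2^Suc j * s $ i\<rfloor>" by linarith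
    from gap[OF this s] show ?thesis by linarith
  qed
  also have "\<dots> \<le> norm (t - s)"
    using component_le_norm_cart[of "t - s" i] by simp
  finally show thesis
    using that[of j] j(1) by auto
qed


section \<open>An Euler scheme along the dyadic tree\<close>

lemma norm_le_card_cart:
  fixes x :: "real^'k"
  assumes "\<And>i. \<bar>x $ i\<bar> \<le> b"
  shows "norm x \<le> real CARD('k) * b"
proof -
  have "norm x \<le> (\<Sum>i\<in>UNIV. \<bar>x $ i\<bar>)"
    by (rule norm_le_l1_cart)
  also have "\<dots> \<le> (\<Sum>i\<in>(UNIV :: 'k set). b)"
    by (intro sum_mono assms)
  finally show ?thesis by simp
qed

text \<open>The lower corner of the dyadic cube of level \<open>j\<close> that contains \<open>s\<close>.\<close>
definition dyadic_floor :: "nat \<Rightarrow> real^'k \<Rightarrow> real^'k" where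
  "dyadic_floor j s = (\<chi> i. of_int \<lfloor>2^j * s $ i\<rfloor> / 2^j)"

lemma norm_diff_dyadic_floor: "norm (s - dyadic_floor j s) \<le> real CARD('k) / 2^j"
  for s :: "real^'k"
proof -
  have "\<bar>(s - dyadic_floor j s) $ i\<bar> \<le> 1 / 2^j" for i
  proof -
    have "(s - dyadic_floor j s) $ i = (2^j * s $ i - of_int \<lfloor>2^j * s $ i\<rfloor>) / 2^j"
      by (simp add: dyadic_floor_def field_simps)
    moreover have "\<bar>2^j * s $ i - of_int \<lfloor>2^j * s $ i\<rfloor>\<bar> \<le> 1"
      by linarith
    ultimately show ?thesis
      by (simp add: divide_right_mono)
  qed
  from norm_le_card_cart[OF this] show ?thesis by simp
qed

lemma norm_dyadic_floor_Suc: "norm (dyadic_floor (Suc j) s - dyadic_floor j s) \<le> real CARD('k) / 2^Suc j"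
  for s :: "real^'k"
proof -
  have "\<bar>(dyadic_floor (Suc j) s - dyadic_floor j s) $ i\<bar> \<le> 1 / 2^Suc j" for i
  proof -
    let ?x = "2^j * s $ i"
    have "(dyadic_floor (Suc j) s - dyadic_floor j s) $ i
        = (of_int \<lfloor>2 * ?x\<rfloor> - 2 * of_int \<lfloor>?x\<rfloor>) / 2^Suc j"
      by (simp add: dyadic_floor_def field_simps)
    moreover have "\<bar>of_int \<lfloor>2 * ?x\<rfloor> - 2 * of_int \<lfloor>?x\<rfloor>\<bar> \<le> (1::real)"
    proof -
      have "\<lfloor>2 * ?x\<rfloor> = 2 * \<lfloor>?x\<rfloor> \<or> \<lfloor>2 * ?x\<rfloor> = 2 * \<lfloor>?x\<rfloor> + 1"
        by linarith
      then show ?thesis by auto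
    qed
    ultimately show ?thesis
      by (simp add: divide_right_mono)
  qed
  from norm_le_card_cart[OF this] show ?thesis by simp
qed

lemma dyadic_floor_tendsto: "(\<lambda>j. dyadic_floor j s) \<longlonglongrightarrow> s"
  for s :: "real^'k"
proof -
  have "(\<lambda>j. real CARD('k) * (1/2)^j) \<longlonglongrightarrow> real CARD('k) * 0"
    by (intro tendsto_mult_left LIMSEQ_power_zero) simp
  then have "(\<lambda>j. real CARD('k) / 2^j) \<longlonglongrightarrow> 0"
    by (simp add: power_divide)
  then have "(\<lambda>j. s - dyadic_floor j s) \<longlonglongrightarrow> 0"
    by (rule Lim_null_comparison[rotated]) (simp add: norm_diff_dyadic_floor)
  from tendsto_diff[OF tendsto_const[of s] this] show ?thesis by simp
qed

lemma floor_eq_pred: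
  fixes x y :: real
  assumes "\<lfloor>2^Suc j * x\<rfloor> = \<lfloor>2^Suc j * y\<rfloor>"
  shows "\<lfloor>2^j * x\<rfloor> = \<lfloor>2^j * y\<rfloor>"
proof -
  have *: "\<lfloor>2 * z\<rfloor> div 2 = \<lfloor>z\<rfloor>" for z :: real
    using floor_divide_real_eq_div[of 2 "2 * z"] by simp
  show ?thesis
    using assms *[of "2^j * x"] *[of "2^j * y"] by (simp add: mult.assoc)
qed

primrec euler_path :: "(real^'n \<Rightarrow> real^'k \<Rightarrow> real^'n) \<Rightarrow> real^'k \<Rightarrow> nat \<Rightarrow> real^'n" where
  "euler_path Y s 0 = 0"
| "euler_path Y s (Suc j) =
     euler_path Y s j + Y (euler_path Y s j) (dyadic_floor (Suc j) s - dyadic_floor j s)"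

text \<open>The path up to level \<open>j\<close> depends only on the dyadic cube of level \<open>j\<close>.\<close>
lemma euler_path_cong:
  assumes "\<And>i. \<lfloor>2^j * s $ i\<rfloor> = \<lfloor>2^j * t $ i\<rfloor>"
  shows "euler_path Y s j = euler_path Y t j \<and> dyadic_floor j s = dyadic_floor j t"
  using assms
proof (induction j)
  case (Suc j)
  have "euler_path Y s j = euler_path Y t j \<and> dyadic_floor j s = dyadic_floor j t"
    by (rule Suc.IH) (rule floor_eq_pred, rule Suc.prems)
  moreover have "dyadic_floor (Suc j) s = dyadic_floor (Suc j) t"
    unfolding dyadic_floor_def Suc.prems ..
  ultimately show ?case by simp
qed (simp add: dyadic_floor_def)

text \<open>Relative to the field frozen at level \<open>j\<close>, the later steps have total length \<open>O(2\<^sup>-\<^sup>j)\<close> and use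
  fields that differ from the frozen one by \<open>O(2\<^sup>-\<^sup>j)\<close>. So within a cube of level \<open>j\<close> the limit is
  affine up to \<open>O(4\<^sup>-\<^sup>j)\<close>, and replacing the frozen field by that at \<open>f s\<close> costs as much again. The
  explicit dependence on \<open>L\<close> and \<open>M\<close> matters: if the field is multiplied by a small factor, the error
  decreases with the square of the factor.\<close>
lemma euler_scheme:
  fixes Y :: "real^'n \<Rightarrow> real^'k \<Rightarrow> real^'n"
  assumes lin: "\<And>x. linear (Y x)" and LM: "L \<ge> 0" "M \<ge> 0"
    and bd: "\<And>x t. x \<in> cball 0 R \<Longrightarrow> norm (Y x t) \<le> M * norm t"
    and lip: "\<And>x y t. x \<in> cball 0 R \<Longrightarrow> y \<in> cball 0 R \<Longrightarrow>
      norm (Y x t - Y y t) \<le> L * norm (x - y) * norm t"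
    and R: "M * real CARD('k) \<le> R"
  obtains f where "\<And>s. norm (f s) \<le> M * real CARD('k)"
    and "\<And>s t j. (\<And>i. \<lfloor>2^j * s $ i\<rfloor> = \<lfloor>2^j * t $ i\<rfloor>) \<Longrightarrow>
      norm (f t - f s - Y (f s) (t - s)) \<le> 4 * L * M * (real CARD('k))\<^sup>2 * (1/4)^j"
proof -
  let ?k = "real CARD('k)"
  let ?p = "euler_path Y"
  let ?h = "\<lambda>j::nat. (1/2::real)^j"
  have floorSuc: "norm (dyadic_floor (Suc j) s - dyadic_floor j s) \<le> ?k * (?h j - ?h (Suc j))" for s :: "real^'k" and j
    using norm_dyadic_floor_Suc[of j s] by (simp add: power_divide)
  (* The steps have lengths at most M k / 2^(j+1), so the path never leaves the ball where the bounds hold. *)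
  have in_ball: "norm (?p s j) \<le> M * ?k * (1 - ?h j)" for s j
  proof (induction j)
    case (Suc j)
    have "M * ?k * (1 - ?h j) \<le> M * ?k * 1"
      using LM by (intro mult_left_mono) auto
    then have "?p s j \<in> cball 0 R"
      using Suc R by simp
    then have "norm (Y (?p s j) (dyadic_floor (Suc j) s - dyadic_floor j s)) \<le> M * (?k * (?h j - ?h (Suc j)))"
      using bd floorSuc LM by (meson order_trans mult_left_mono)
    then have "norm (?p s (Suc j)) \<le> M * ?k * (1 - ?h j) + M * (?k * (?h j - ?h (Suc j)))"
      using Suc norm_triangle_mono by (simp del: power_Suc)
    then show ?case
      by (simp add: algebra_simps)
  qed simp
  have cb: "?p s j \<in> cball 0 R" for s j
  proof -
    have "M * ?k * (1 - ?h j) \<le> M * ?k * 1"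
      using LM by (intro mult_left_mono) auto
    then show ?thesis
      using in_ball[of s j] R by simp
  qed
  have step: "norm (?p s m - ?p s j) \<le> M * ?k * (?h j - ?h m)" if "j \<le> m" for s j m
    using that
  proof (induction m rule: dec_induct)
    case (step m)
    have "norm (Y (?p s m) (dyadic_floor (Suc m) s - dyadic_floor m s)) \<le> M * (?k * (?h m - ?h (Suc m)))"
      using bd[OF cb] floorSuc LM by (meson order_trans mult_left_mono)
    then have "norm ((?p s m - ?p s j) + Y (?p s m) (dyadic_floor (Suc m) s - dyadic_floor m s))
        \<le> M * ?k * (?h j - ?h m) + M * (?k * (?h m - ?h (Suc m)))"
      using step.IH by (rule norm_triangle_mono[rotated])
    then show ?case
      by (simp add: algebra_simps)
  qed simp
  have step': "norm (?p s m - ?p s j) \<le> M * ?k * ?h j" if "j \<le> m" for s j m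
  proof -
    have "M * ?k * (?h j - ?h m) \<le> M * ?k * ?h j"
      using LM by (intro mult_left_mono) auto
    then show ?thesis
      using step[OF that, of s] by linarith
  qed
  have hlim: "(\<lambda>j. M * ?k * ?h j) \<longlonglongrightarrow> 0"
    using tendsto_mult_left[OF LIMSEQ_power_zero[of "1/2::real"], of "M * ?k"] by simp
  have "convergent (?p s)" for s
  proof -
    have "Cauchy (?p s)"
    proof (rule metric_CauchyI)
      fix e :: real assume "e > 0"
      then have "\<forall>\<^sub>F j in sequentially. M * ?k * ?h j < e / 2"
        by (intro order_tendstoD[OF hlim]) auto
      then obtain N where N: "M * ?k * ?h N < e / 2"
        by (auto simp: eventually_sequentially)
      have "dist (?p s m) (?p s n) < e" if "m \<ge> N" "n \<ge> N" for m n
        using step'[OF that(1), of s] step'[OF that(2), of s] N norm_triangle_ineq4[of "?p s m - ?p s N" "?p s n - ?p s N"]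
        by (simp add: dist_norm)
      then show "\<exists>N. \<forall>m\<ge>N. \<forall>n\<ge>N. dist (?p s m) (?p s n) < e" by blast
    qed
    then show ?thesis by (rule Cauchy_convergent)
  qed
  then obtain f where f: "\<And>s. ?p s \<longlonglongrightarrow> f s"
    unfolding convergent_def by metis
  have f_near: "norm (f s - ?p s j) \<le> M * ?k * ?h j" for s j
  proof (rule Lim_bounded[of "\<lambda>m. norm (?p s m - ?p s j)" _ j])
    show "(\<lambda>m. norm (?p s m - ?p s j)) \<longlonglongrightarrow> norm (f s - ?p s j)"
      by (intro tendsto_intros f)
  qed (use step' in auto)
  have f_norm: "norm (f s) \<le> M * ?k" for s
    using f_near[of s 0] by simp
  have f_cb: "f s \<in> cball 0 R" for s
    using f_norm[of s] R by simp
  have quad: "norm (?p s m - ?p s j - Y (?p s j) (dyadic_floor m s - dyadic_floor j s))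
      \<le> L * (M * ?k * ?h j) * (?k * (?h j - ?h m))" if "j \<le> m" for s j m
    using that
  proof (induction m rule: dec_induct)
    case base
    show ?case by (simp add: linear_0[OF lin])
  next
    case (step m)
    let ?D = "dyadic_floor (Suc m) s - dyadic_floor m s"
    have "norm (Y (?p s m) ?D - Y (?p s j) ?D) \<le> L * norm (?p s m - ?p s j) * norm ?D"
      by (intro lip cb)
    also have "\<dots> \<le> L * (M * ?k * ?h j) * (?k * (?h m - ?h (Suc m)))"
      using step.hyps LM by (intro mult_mono step' floorSuc) auto
    finally have *: "norm (Y (?p s m) ?D - Y (?p s j) ?D) \<le> L * (M * ?k * ?h j) * (?k * (?h m - ?h (Suc m)))" .
    have "dyadic_floor (Suc m) s - dyadic_floor j s = (dyadic_floor m s - dyadic_floor j s) + ?D"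
      by simp
    then have eq: "?p s (Suc m) - ?p s j - Y (?p s j) (dyadic_floor (Suc m) s - dyadic_floor j s)
      = (?p s m - ?p s j - Y (?p s j) (dyadic_floor m s - dyadic_floor j s)) + (Y (?p s m) ?D - Y (?p s j) ?D)"
      by (simp only: linear_add[OF lin] euler_path.simps) simp
    have "norm (?p s (Suc m) - ?p s j - Y (?p s j) (dyadic_floor (Suc m) s - dyadic_floor j s))
      \<le> L * (M * ?k * ?h j) * (?k * (?h j - ?h m)) + L * (M * ?k * ?h j) * (?k * (?h m - ?h (Suc m)))"
      unfolding eq by (rule norm_triangle_mono[OF step.IH *])
    then show ?case
      by (simp add: algebra_simps)
  qed
  have f_quad: "norm (f s - ?p s j - Y (?p s j) (s - dyadic_floor j s)) \<le> L * M * ?k\<^sup>2 * (1/4)^j" for s j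
  proof (rule Lim_bounded[of "\<lambda>m. norm (?p s m - ?p s j - Y (?p s j) (dyadic_floor m s - dyadic_floor j s))" _ j])
    have "bounded_linear (Y (?p s j))"
      using lin linear_conv_bounded_linear by blast
    then have "(\<lambda>m. Y (?p s j) (dyadic_floor m s - dyadic_floor j s)) \<longlonglongrightarrow> Y (?p s j) (s - dyadic_floor j s)"
      by (rule bounded_linear.tendsto) (intro tendsto_intros dyadic_floor_tendsto)
    then show "(\<lambda>m. norm (?p s m - ?p s j - Y (?p s j) (dyadic_floor m s - dyadic_floor j s)))
        \<longlonglongrightarrow> norm (f s - ?p s j - Y (?p s j) (s - dyadic_floor j s))"
      by (intro tendsto_norm tendsto_diff f tendsto_const)
    show "\<forall>m\<ge>j. norm (?p s m - ?p s j - Y (?p s j) (dyadic_floor m s - dyadic_floor j s)) \<le> L * M * ?k\<^sup>2 * (1/4)^j"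
    proof safe
      fix m assume "j \<le> m"
      have "L * (M * ?k * ?h j) * (?k * (?h j - ?h m)) \<le> L * (M * ?k * ?h j) * (?k * ?h j)"
        using LM by (intro mult_left_mono) auto
      also have "\<dots> = L * M * ?k\<^sup>2 * (?h j * ?h j)"
        by (simp add: power2_eq_square)
      also have "?h j * ?h j = (1/4)^j"
        by (simp add: power_mult_distrib[symmetric])
      finally show "norm (?p s m - ?p s j - Y (?p s j) (dyadic_floor m s - dyadic_floor j s)) \<le> L * M * ?k\<^sup>2 * (1/4)^j"
        using quad[OF \<open>j \<le> m\<close>, of s] by linarith
    qed
  qed
  show thesis
  proof (rule that[OF f_norm])
    fix s t :: "real^'k" and j :: nat
    assume "\<And>i. \<lfloor>2^j * s $ i\<rfloor> = \<lfloor>2^j * t $ i\<rfloor>"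
    then have eq: "?p t j = ?p s j" "dyadic_floor j t = dyadic_floor j s"
      using euler_path_cong[of j s t Y] by auto
    let ?q = "L * M * ?k\<^sup>2 * (1/4)^j"
    let ?A = "f t - ?p s j - Y (?p s j) (t - dyadic_floor j s)"
    let ?B = "f s - ?p s j - Y (?p s j) (s - dyadic_floor j s)"
    let ?C = "Y (f s) (t - s) - Y (?p s j) (t - s)"
    have "norm (t - s) \<le> 2 * ?k * ?h j"
      using norm_diff_dyadic_floor[of t j] norm_diff_dyadic_floor[of s j]
        norm_triangle_ineq4[of "t - dyadic_floor j s" "s - dyadic_floor j s"] eq
      by (simp add: power_divide)
    then have "L * norm (f s - ?p s j) * norm (t - s) \<le> L * (M * ?k * ?h j) * (2 * ?k * ?h j)"
      using LM by (intro mult_mono f_near) auto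
    also have "\<dots> = 2 * (L * M * ?k\<^sup>2 * (?h j * ?h j))"
      by (simp add: power2_eq_square)
    also have "?h j * ?h j = (1/4)^j"
      by (simp add: power_mult_distrib[symmetric])
    finally have C: "norm ?C \<le> 2 * ?q"
      using lip[OF f_cb[of s] cb[of s j], of "t - s"] by linarith
    have "Y (?p s j) (t - s) = Y (?p s j) (t - dyadic_floor j s) - Y (?p s j) (s - dyadic_floor j s)"
      by (simp add: linear_diff[OF lin])
    then have eq3: "f t - f s - Y (f s) (t - s) = ?A - ?B - ?C"
      by simp
    have tri: "norm (a - b - c) \<le> norm a + norm b + norm c" for a b c :: "real^'n"
      using norm_triangle_ineq4[of "a - b" c] norm_triangle_ineq4[of a b] by linarith
    have "norm ?A \<le> ?q"
      using f_quad[of t j] eq by simp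
    then show "norm (f t - f s - Y (f s) (t - s)) \<le> 4 * L * M * ?k\<^sup>2 * (1/4)^j"
      unfolding eq3 using tri[of ?A ?B ?C] f_quad[of s j] C by linarith
  qed
qed

section \<open>Images of positive measure for exponents below two\<close>

text \<open>Identifies \<open>\<real>\<^sup>k\<close> with the tangential coefficient vectors.\<close>
definition embed_cut :: "('k \<Rightarrow> 'n) \<Rightarrow> 'n set \<Rightarrow> real^'k \<Rightarrow> real^'n" where
  "embed_cut g I t = (\<chi> i. if i \<in> I then t $ inv g i else 0)"

lemma embed_cut_props:
  assumes g: "bij_betw g (UNIV :: 'k::finite set) (I :: 'n::finite set)"
  shows "linear (embed_cut g I)" "inj (embed_cut g I)" "cut I (embed_cut g I t) = embed_cut g I t"
    "cut (-I) (embed_cut g I t) = 0"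
proof -
  show "linear (embed_cut g I)"
    by (rule linearI) (auto simp: embed_cut_def vec_eq_iff)
  show "inj (embed_cut g I)"
  proof (rule injI)
    fix s t assume eq: "embed_cut g I s = embed_cut g I t"
    have "s $ l = t $ l" for l
    proof -
      have "g l \<in> I" "inv g (g l) = l"
        using g by (auto simp: bij_betw_def inv_f_f)
      then show ?thesis
        using arg_cong[OF eq, of "\<lambda>x. x $ g l"] by (simp add: embed_cut_def)
    qed
    then show "s = t" by (simp add: vec_eq_iff)
  qed
qed (auto simp: embed_cut_def vec_eq_iff)

lemma powr_inverse_le:
  assumes "x \<ge> 0" "\<eta> > (0::real)" "C \<ge> 0" "y \<ge> 0" "y \<le> C * x powr \<eta>"
  shows "y powr (1/\<eta>) \<le> C powr (1/\<eta>) * x"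
proof -
  have "y powr (1/\<eta>) \<le> (C * x powr \<eta>) powr (1/\<eta>)"
    using assms by (intro powr_mono2) auto
  also have "\<dots> = C powr (1/\<eta>) * x"
    using assms by (simp add: powr_mult powr_powr)
  finally show ?thesis .
qed

text \<open>The Euler scheme is run on the fat Cantor set with the tangential frame fields, multiplied by a small
  factor \<open>\<mu>\<close>. Smallness of \<open>\<mu>\<close> keeps the image inside a \<open>d\<close>-ball where squeezing applies, which is
  the place where the topology of \<open>d\<close> enters, and it makes the linear tangential part dominate the
  error, which is quadratic in \<open>\<mu>\<close>.\<close>
lemma squeezed_not_purely_unrectifiable:
  fixes V W :: "real^'n::finite \<Rightarrow> (real^'n) set" and d :: "(real^'n) metric"
  assumes cd: "complementary_distributions CARD('k::finite) V W" and sp: "mspace d = UNIV"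
    and top: "mtopology_of d = euclidean" and \<eta>: "1 < \<eta>" "\<eta> < 2" and sq: "squeezed \<eta> V W d"
  obtains K :: "(real^'k) set" and f where "compact K"
    "Lipschitz_continuous_map (submetric euclidean_metric K) d f"
    "hausdorff_measure d CARD('k) (f ` K) > 0"
proof -
  obtain X and I :: "'n set" where fr: "adapted_frame X" and card: "card I = CARD('k)"
    and V: "\<And>x. V x = {adapted_frame.comb X x (cut I a) | a. True}"
    and W: "\<And>x. W x = {adapted_frame.comb X x (cut (-I) a) | a. True}"
    by (rule obtain_adapted_frame[OF cd]) (rule that)
  interpret adapted_frame X by fact
  obtain g :: "'k \<Rightarrow> 'n" where g: "bij_betw g UNIV I"
    using finite_same_card_bij[of "UNIV :: 'k set" I] card by auto
  note em = embed_cut_props[OF g]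
  let ?em = "embed_cut g I"
  obtain e1 where e1: "e1 > 0" "\<And>t. e1 * norm t \<le> norm (?em t)"
    using linear_inj_bounded_below_pos[OF em(1,2)] by blast
  obtain e2 where e2: "e2 > 0" "\<And>t. norm (?em t) \<le> e2 * norm t"
    using linear_bounded_pos[OF em(1)] by blast
  have "\<eta> > 0" using \<eta> by simp
  obtain C r where Cr: "C > 0" "r > 0"
    and lower: "\<And>x y. x \<in> cball 0 1 \<Longrightarrow> mdist d x y \<le> r \<Longrightarrow>
       norm (cut I (coords x (y - x))) + norm (cut (-I) (coords x (y - x))) powr (1/\<eta>) \<le> C * mdist d x y"
    and upper: "\<And>x y. x \<in> cball 0 1 \<Longrightarrow> mdist d x y \<le> r \<Longrightarrow>
       mdist d x y \<le> C * (norm (cut I (coords x (y - x))) + norm (cut (-I) (coords x (y - x))) powr (1/\<eta>))"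
    by (rule squeezed_coords[OF sq \<open>\<eta> > 0\<close> sp fr V W compact_cball]) (rule that)
  obtain L where L: "L > 0" "\<And>x y a. x \<in> cball 0 1 \<Longrightarrow> y \<in> cball 0 1 \<Longrightarrow>
      norm (comb x a - comb y a) \<le> L * norm (x - y) * norm a"
    using comb_lipschitz by blast
  obtain M where M: "M > 0" "\<And>x a. x \<in> cball 0 1 \<Longrightarrow> norm (comb x a) \<le> M * norm a"
    using comb_upper_bound[OF compact_cball] by blast
  obtain c0 where c0: "c0 > 0" "\<And>x a. x \<in> cball 0 1 \<Longrightarrow> c0 * norm a \<le> norm (comb x a)"
    using comb_lower_bound[OF compact_cball] by blast
  obtain \<rho> where \<rho>: "\<rho> > 0" "\<And>x. norm x \<le> \<rho> \<Longrightarrow> mdist d 0 x < r / 2"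
  proof -
    have "openin (mtopology_of d) (mball_of d 0 (r/2))"
      unfolding mtopology_of_def mball_of_def
      by (rule Metric_space.openin_mball[OF Metric_space_mspace_mdist])
    then have "open (mball_of d 0 (r/2))"
      by (simp only: top open_openin)
    moreover have "0 \<in> mball_of d 0 (r/2)"
    proof -
      have z: "mdist d 0 0 = 0"
        by (simp add: sp)
      show ?thesis
        unfolding in_mball_of sp z using Cr by simp
    qed
    ultimately obtain \<rho> where \<rho>: "\<rho> > 0" "cball 0 \<rho> \<subseteq> mball_of d 0 (r/2)"
      by (meson open_contains_cball_eq)
    have "mdist d 0 x < r / 2" if "norm x \<le> \<rho>" for x
      using subsetD[OF \<rho>(2), of x] that by simp
    then show thesis
      using that[of \<rho>] \<rho>(1) by blast
  qed
  let ?k = "real CARD('k)"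
  have k: "?k \<ge> 1" using zero_less_card_finite[where 'a='k] by linarith
  (* So that (theta/2)^eta = 1/4; theta < 1 amounts to eta < 2. *)
  define \<theta> where "\<theta> = 2 * (1/4::real) powr (1/\<eta>)"
  have \<theta>: "0 < \<theta>" "\<theta> < 1"
  proof -
    have "(1/4::real) powr (1/\<eta>) < (1/4) powr (1/2)"
      using \<eta> by (intro powr_less_mono') (auto simp: field_simps)
    also have "\<dots> = 1/2"
      by (simp add: powr_half_sqrt real_sqrt_divide)
    finally show "\<theta> < 1" by (simp add: \<theta>_def)
  qed (simp add: \<theta>_def)
  have \<theta>_pow: "((\<theta>/2)^j) powr \<eta> = (1/4)^j" for j
    using \<eta> by (simp add: \<theta>_def powr_power powr_powr mult.commute flip: powr_realpow)
  obtain c where c: "c > 0" and Kpos: "emeasure lborel (dyadic_gap_set c \<theta> :: (real^'k) set) > 0"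
    using emeasure_dyadic_gap_set_pos[OF \<theta>] by blast
  let ?K = "dyadic_gap_set c \<theta> :: (real^'k) set"
  define c2 where "c2 = c * (\<theta>/2)"
  have c2: "c2 > 0" using c \<theta> by (simp add: c2_def)
  define C4 where "C4 = 4 * (L * e2) * (M * e2) * ?k\<^sup>2 / c2 powr \<eta>"
  have C4: "C4 > 0" using L M e2 k c2 by (simp add: C4_def)
  define D where "D = ?k powr (\<eta> - 1)"
  have D: "D > 0" using k by (simp add: D_def)
  (* In turn: stay in the unit ball, stay in the d-ball, and dominate the error by the tangential part. *)
  define \<mu> where "\<mu> = Min {1 / (M * e2 * ?k), \<rho> / (M * e2 * ?k), e1 * c0 / (2 * C4 * D)}"
  have \<mu>: "\<mu> > 0" "\<mu> \<le> 1 / (M * e2 * ?k)" "\<mu> \<le> \<rho> / (M * e2 * ?k)" "\<mu> \<le> e1 * c0 / (2 * C4 * D)"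
    using M e2 k \<rho>(1) e1(1) c0(1) C4 D by (auto simp: \<mu>_def)
  have pMk: "M * e2 * ?k > 0" using M e2 k by simp
  have \<mu>1: "\<mu> * (M * e2 * ?k) \<le> 1" "\<mu> * (M * e2 * ?k) \<le> \<rho>"
    using \<mu>(2,3) pMk by (simp_all only: pos_le_divide_eq)
  have \<mu>2: "\<mu> * C4 * D / c0 \<le> e1 / 2"
    using \<mu>(4) C4 D c0(1) by (simp add: field_simps)
  define Y where "Y x t = comb x (\<mu> *\<^sub>R ?em t)" for x t
  have Y_lin: "linear (Y x)" for x
    unfolding Y_def by (rule linearI)
      (simp_all add: linear_add[OF em(1)] linear_scale[OF em(1)] scaleR_add_right comb_add comb_scaleR)
  have Y_bd: "norm (Y x t) \<le> (\<mu> * M * e2) * norm t" if "x \<in> cball 0 1" for x t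
  proof -
    have "norm (Y x t) \<le> M * norm (\<mu> *\<^sub>R ?em t)"
      unfolding Y_def by (rule M(2)[OF that])
    also have "\<dots> \<le> M * (\<mu> * (e2 * norm t))"
      using M \<mu>(1) e2(2)[of t] by (simp add: mult_left_mono)
    finally show ?thesis by (simp add: mult_ac)
  qed
  have Y_lip: "norm (Y x t - Y y t) \<le> (\<mu> * L * e2) * norm (x - y) * norm t"
    if "x \<in> cball 0 1" "y \<in> cball 0 1" for x y t
  proof -
    have "norm (Y x t - Y y t) \<le> L * norm (x - y) * norm (\<mu> *\<^sub>R ?em t)"
      unfolding Y_def by (rule L(2)[OF that])
    also have "\<dots> \<le> L * norm (x - y) * (\<mu> * (e2 * norm t))"
      using L \<mu>(1) e2(2)[of t] by (simp add: mult_left_mono)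
    finally show ?thesis by (simp add: mult_ac)
  qed
  have "\<mu> * L * e2 \<ge> 0" "\<mu> * M * e2 \<ge> 0" "\<mu> * M * e2 * ?k \<le> 1"
    using \<mu>(1) L(1) M(1) e2(1) \<mu>1 by (auto simp: mult_ac)
  from euler_scheme[OF Y_lin this(1,2) Y_bd Y_lip this(3)]
  obtain f where f_norm: "\<And>s. norm (f s) \<le> \<mu> * M * e2 * ?k"
    and f_err: "\<And>s t j. (\<And>i. \<lfloor>2^j * s $ i\<rfloor> = \<lfloor>2^j * t $ i\<rfloor>) \<Longrightarrow>
      norm (f t - f s - Y (f s) (t - s)) \<le> 4 * (\<mu> * L * e2) * (\<mu> * M * e2) * ?k\<^sup>2 * (1/4)^j"
    by blast
  have f_cb: "f s \<in> cball 0 1" for s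
    using f_norm[of s] \<mu>1 by (simp add: mult_ac)
  have close: "mdist d (f s) (f t) \<le> r" for s t
  proof -
    have "norm (f x) \<le> \<rho>" for x
      using f_norm[of x] \<mu>1 by (simp add: mult_ac)
    then have "mdist d 0 (f s) < r/2" "mdist d 0 (f t) < r/2"
      by (intro \<rho>(2); blast)+
    then show ?thesis
      using mdist_triangle[of "f s" d 0 "f t"] mdist_commute[of d "f s" 0] sp by simp
  qed
  have err: "norm (f t - f s - Y (f s) (t - s)) \<le> \<mu>\<^sup>2 * C4 * norm (t - s) powr \<eta>"
    if st: "s \<in> ?K" "t \<in> ?K" for s t
  proof (cases "s = t")
    case True
    then show ?thesis by (simp add: linear_0[OF Y_lin])
  next
    case False
    obtain j :: nat where j: "\<And>i. \<lfloor>2^j * s $ i\<rfloor> = \<lfloor>2^j * t $ i\<rfloor>" "c * (\<theta> / 2)^(Suc j) \<le> norm (t - s)"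
      using dyadic_gap_set_separated[OF st False c] by blast
    have "(c2 * (\<theta>/2)^j) powr \<eta> \<le> norm (t - s) powr \<eta>"
    proof (intro powr_mono2)
      show "0 \<le> c2 * (\<theta>/2)^j"
        using c2 \<theta> by simp
      show "c2 * (\<theta>/2)^j \<le> norm (t - s)"
        using j(2) by (simp add: c2_def mult_ac)
    qed (use \<eta> in auto)
    then have "c2 powr \<eta> * (1/4)^j \<le> norm (t - s) powr \<eta>"
      using c2 \<theta> by (simp add: powr_mult \<theta>_pow del: power_divide)
    then have "(1/4)^j \<le> norm (t - s) powr \<eta> / c2 powr \<eta>"
      using c2 by (simp add: field_simps)
    then have "4 * (\<mu> * L * e2) * (\<mu> * M * e2) * ?k\<^sup>2 * (1/4)^j
        \<le> 4 * (\<mu> * L * e2) * (\<mu> * M * e2) * ?k\<^sup>2 * (norm (t - s) powr \<eta> / c2 powr \<eta>)"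
      using \<mu>(1) L(1) M(1) e2(1) by (intro mult_left_mono) auto
    also have "\<dots> = \<mu>\<^sup>2 * C4 * norm (t - s) powr \<eta>"
      by (simp add: C4_def power2_eq_square)
    finally show ?thesis
      using f_err[OF j(1)] by linarith
  qed
  have small: "norm (t - s) powr \<eta> \<le> D * norm (t - s)" if st: "s \<in> ?K" "t \<in> ?K" for s t
  proof (cases "s = t")
    case False
    have "\<bar>(t - s) $ i\<bar> \<le> 1" for i
    proof -
      have "0 \<le> t $ i \<and> t $ i \<le> 1" "0 \<le> s $ i \<and> s $ i \<le> 1"
        using st by (auto simp: dyadic_gap_set_def)
      then show ?thesis by auto
    qed
    from norm_le_card_cart[OF this] have "norm (t - s) powr (\<eta> - 1) \<le> D"
      unfolding D_def using \<eta> by (intro powr_mono2) auto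
    moreover have "norm (t - s) powr \<eta> = norm (t - s) powr (\<eta> - 1) * norm (t - s)"
      using False powr_add[of "norm (t - s)" "\<eta> - 1" 1] by simp
    ultimately show ?thesis
      by (simp add: mult_right_mono)
  qed simp
  have main: "norm (cut I (coords (f s) (f t - f s))) \<ge> \<mu> * e1 / 2 * norm (t - s) \<and>
      norm (cut I (coords (f s) (f t - f s))) \<le> \<mu> * (e2 + e1/2) * norm (t - s) \<and>
      norm (cut (-I) (coords (f s) (f t - f s))) \<le> \<mu>\<^sup>2 * C4 / c0 * norm (t - s) powr \<eta>"
    if st: "s \<in> ?K" "t \<in> ?K" for s t
  proof -
    define E where "E = f t - f s - Y (f s) (t - s)"
    let ?e = "coords (f s) E"
    have "c0 * norm ?e \<le> \<mu>\<^sup>2 * C4 * norm (t - s) powr \<eta>"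
      using c0(2)[OF f_cb[of s], of ?e] err[OF st] by (simp add: E_def)
    then have e: "norm ?e \<le> \<mu>\<^sup>2 * C4 / c0 * norm (t - s) powr \<eta>"
      using c0(1) by (simp add: field_simps)
    also have "\<dots> \<le> \<mu>\<^sup>2 * C4 / c0 * (D * norm (t - s))"
      using C4 c0(1) by (intro mult_left_mono small st) auto
    also have "\<dots> = \<mu> * norm (t - s) * (\<mu> * C4 * D / c0)"
      by (simp add: power2_eq_square mult_ac)
    also have "\<dots> \<le> \<mu> * norm (t - s) * (e1 / 2)"
      using \<mu>(1) \<mu>2 by (intro mult_left_mono) auto
    finally have e': "norm ?e \<le> \<mu> * norm (t - s) * (e1 / 2)" .
    have "f t - f s = Y (f s) (t - s) + E" by (simp add: E_def)
    then have co: "coords (f s) (f t - f s) = \<mu> *\<^sub>R ?em (t - s) + ?e"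
      by (simp add: coords_add Y_def)
    have I1: "cut I (coords (f s) (f t - f s)) = \<mu> *\<^sub>R ?em (t - s) + cut I ?e"
      by (simp only: co cut_add cut_scaleR em(3))
    have I2: "cut (-I) (coords (f s) (f t - f s)) = cut (-I) ?e"
      by (simp only: co cut_add cut_scaleR em(4)) simp
    have n: "norm (cut I ?e) \<le> \<mu> * norm (t - s) * (e1 / 2)"
      using norm_cut_le[of I ?e] e' by linarith
    have n1: "\<mu> * (e1 * norm (t - s)) \<le> norm (\<mu> *\<^sub>R ?em (t - s))"
      using \<mu>(1) e1(2)[of "t - s"] by simp
    have n2: "norm (\<mu> *\<^sub>R ?em (t - s)) \<le> \<mu> * (e2 * norm (t - s))"
      using \<mu>(1) e2(2)[of "t - s"] by simp
    have "\<mu> * (e1 * norm (t - s)) - \<mu> * norm (t - s) * (e1 / 2) \<le> norm (\<mu> *\<^sub>R ?em (t - s) + cut I ?e)"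
      using norm_diff_ineq[of "\<mu> *\<^sub>R ?em (t - s)" "cut I ?e"] n n1 by linarith
    moreover have "norm (\<mu> *\<^sub>R ?em (t - s) + cut I ?e) \<le> \<mu> * (e2 * norm (t - s)) + \<mu> * norm (t - s) * (e1 / 2)"
      using norm_triangle_ineq[of "\<mu> *\<^sub>R ?em (t - s)" "cut I ?e"] n n2 by linarith
    moreover have "norm (cut (-I) ?e) \<le> \<mu>\<^sup>2 * C4 / c0 * norm (t - s) powr \<eta>"
      using norm_cut_le[of "-I" ?e] e by linarith
    ultimately show ?thesis
      unfolding I1 I2 by (simp add: algebra_simps)
  qed
  have up: "mdist d (f s) (f t) \<le> C * (\<mu> * (e2 + e1/2) + (\<mu>\<^sup>2 * C4 / c0) powr (1/\<eta>)) * norm (t - s)"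
    if st: "s \<in> ?K" "t \<in> ?K" for s t
  proof -
    have "norm (cut (-I) (coords (f s) (f t - f s))) powr (1/\<eta>) \<le> (\<mu>\<^sup>2 * C4 / c0) powr (1/\<eta>) * norm (t - s)"
      using main[OF st] \<eta> C4 c0(1) by (intro powr_inverse_le) auto
    moreover have "norm (cut I (coords (f s) (f t - f s))) \<le> \<mu> * (e2 + e1/2) * norm (t - s)"
      using main[OF st] by blast
    ultimately have "norm (cut I (coords (f s) (f t - f s))) + norm (cut (-I) (coords (f s) (f t - f s))) powr (1/\<eta>)
        \<le> (\<mu> * (e2 + e1/2) + (\<mu>\<^sup>2 * C4 / c0) powr (1/\<eta>)) * norm (t - s)"
      by (simp add: distrib_right)
    then have "C * (norm (cut I (coords (f s) (f t - f s))) + norm (cut (-I) (coords (f s) (f t - f s))) powr (1/\<eta>))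
        \<le> C * ((\<mu> * (e2 + e1/2) + (\<mu>\<^sup>2 * C4 / c0) powr (1/\<eta>)) * norm (t - s))"
      using Cr(1) by (intro mult_left_mono) auto
    then show ?thesis
      using upper[OF f_cb close, of s t] by (simp add: mult.assoc)
  qed
  have lo: "\<mu> * e1 / 2 / C * norm (t - s) \<le> mdist d (f s) (f t)"
    if st: "s \<in> ?K" "t \<in> ?K" for s t
  proof -
    have "\<mu> * e1 / 2 * norm (t - s) \<le> norm (cut I (coords (f s) (f t - f s)))"
      using main[OF st] by blast
    also have "\<dots> \<le> C * mdist d (f s) (f t)"
      using lower[OF f_cb close, of s t] by (smt (verit) powr_ge_zero)
    finally show ?thesis
      using Cr(1) by (simp add: field_simps)
  qed
  show thesis
  proof (rule that)
    show "compact ?K" by (rule compact_dyadic_gap_set)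
    show "Lipschitz_continuous_map (submetric euclidean_metric ?K) d f"
      unfolding Lipschitz_continuous_map_def
    proof (intro conjI exI ballI)
      fix s t assume "s \<in> mspace (submetric euclidean_metric ?K)" "t \<in> mspace (submetric euclidean_metric ?K)"
      then have st: "s \<in> ?K" "t \<in> ?K" by auto
      show "mdist d (f s) (f t) \<le> C * (\<mu> * (e2 + e1/2) + (\<mu>\<^sup>2 * C4 / c0) powr (1/\<eta>))
          * mdist (submetric euclidean_metric ?K) s t"
        using up[OF st] by (simp add: dist_norm norm_minus_commute[of s t])
    qed (simp add: sp)
    show "hausdorff_measure d CARD('k) (f ` ?K) > 0"
    proof (rule hausdorff_measure_pos_of_expanding[OF _ Kpos _ lo])
      show "?K \<in> sets lborel"
        using borel_compact[OF compact_dyadic_gap_set[of c \<theta>]] by simp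
    qed (use \<mu>(1) e1(1) Cr(1) in auto)
  qed
qed

section \<open>Second differences of Lipschitz functions\<close>

lemma integral_lborel_translate:
  fixes g :: "'a::euclidean_space \<Rightarrow> real"
  assumes "g \<in> borel_measurable borel"
  shows "(\<integral>x. g (v + x) \<partial>lborel) = (\<integral>x. g x \<partial>lborel)"
proof -
  have "(\<integral>x. g x \<partial>lborel) = (\<integral>x. g x \<partial>distr lborel borel ((+) v))"
    by (simp add: lborel_distr_plus)
  also have "\<dots> = (\<integral>x. g (v + x) \<partial>lborel)"
    using assms by (intro integral_distr) auto
  finally show ?thesis ..
qed

lemma integrable_continuous_compact_support:
  fixes g :: "'a::euclidean_space \<Rightarrow> real"
  assumes "continuous_on UNIV g" and "\<And>x. x \<notin> cball 0 R \<Longrightarrow> g x = 0"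
  shows "integrable lborel g"
proof -
  have "integrable lborel (\<lambda>x. indicator (cball 0 R) x *\<^sub>R g x)"
    using assms(1) continuous_on_subset by (intro borel_integrable_compact) auto
  moreover have "(\<lambda>x. indicator (cball 0 R) x *\<^sub>R g x) = g"
    using assms(2) by (auto simp: indicator_def fun_eq_iff)
  ultimately show ?thesis by simp
qed

definition second_diff :: "('a::real_vector \<Rightarrow> real) \<Rightarrow> 'a \<Rightarrow> real \<Rightarrow> 'a \<Rightarrow> real" where
  "second_diff g v h x = (g (x + (2 * h) *\<^sub>R v) - 2 * g (x + h *\<^sub>R v) + g x) / h"

text \<open>Let \<open>u\<^sub>j\<close> be the difference quotient of \<open>g\<close> with step \<open>2\<^sup>-\<^sup>j v\<close>. The quotient \<open>u\<^sub>j\<close> is the mean of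
  \<open>u\<^sub>j\<^sub>+\<^sub>1\<close> and its translate by \<open>2\<^sup>-\<^sup>j\<^sup>-\<^sup>1 v\<close>, and the second difference is the difference of these two
  functions. By the parallelogram law and translation invariance the integral of its square is four
  times the increment of \<open>\<integral> u\<^sub>j\<^sup>2\<close>. The increments telescope, and \<open>\<integral> u\<^sub>j\<^sup>2\<close> stays bounded because \<open>g\<close>
  is Lipschitz with compact support.\<close>
lemma integral_second_diff_le:
  fixes g :: "'a::euclidean_space \<Rightarrow> real"
  assumes lip: "\<And>x y. \<bar>g x - g y\<bar> \<le> L * norm (x - y)"
    and supp: "\<And>x. x \<notin> cball 0 R \<Longrightarrow> g x = 0"
  obtains B where "\<And>m. (\<Sum>j<m. \<integral>x. (second_diff g v ((1/2)^Suc j) x)\<^sup>2 \<partial>lborel) \<le> B"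
    "\<And>j. integrable lborel (\<lambda>x. (second_diff g v ((1/2)^Suc j) x)\<^sup>2)"
proof -
  have cont: "continuous_on UNIV g"
  proof (rule continuous_onI)
    fix x :: 'a and e :: real assume "e > 0"
    have "L * norm (y - x) \<le> (\<bar>L\<bar> + 1) * norm (y - x)" for y
      by (intro mult_right_mono) auto
    then have "\<bar>g y - g x\<bar> \<le> (\<bar>L\<bar> + 1) * norm (y - x)" for y
      using lip[of y x] order_trans by blast
    then have "dist (g y) (g x) \<le> e" if "dist y x < e / (\<bar>L\<bar> + 1)" for y
    proof -
      have "(\<bar>L\<bar> + 1) * norm (y - x) \<le> e"
        using that by (simp add: dist_norm field_simps)
      then show ?thesis
        using \<open>\<And>y. \<bar>g y - g x\<bar> \<le> (\<bar>L\<bar> + 1) * norm (y - x)\<close>[of y] by (simp add: dist_real_def)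
    qed
    then show "\<exists>d>0. \<forall>y\<in>UNIV. dist y x < d \<longrightarrow> dist (g y) (g x) \<le> e"
      using \<open>e > 0\<close> by (intro exI[of _ "e / (\<bar>L\<bar> + 1)"]) auto
  qed
  note cont' = continuous_on_compose2[OF cont]
  define h where "h j = (1/2::real)^j" for j
  have h: "h j > 0" "h j = 2 * h (Suc j)" "h j \<le> 1" for j
    by (auto simp: h_def power_le_one)
  define u where "u j x = (g (x + h j *\<^sub>R v) - g x) / h j" for j x
  define D where "D j x = second_diff g v (h (Suc j)) x" for j x
  let ?R = "R + 2 * norm v"
  have out: "g (x + t *\<^sub>R v) = 0" if "x \<notin> cball 0 ?R" "0 \<le> t" "t \<le> 2" for x t
  proof -
    have "norm x - norm (t *\<^sub>R v) \<le> norm (x + t *\<^sub>R v)"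
      by (rule norm_diff_ineq)
    moreover have "norm (t *\<^sub>R v) \<le> 2 * norm v"
      using that by (simp add: mult_right_mono)
    ultimately show ?thesis
      using that(1) by (intro supp) simp
  qed
  have cont_u: "continuous_on UNIV (u j)" for j
    unfolding u_def using h(1)[of j] by (intro continuous_intros cont') auto
  have u0: "u j x = 0" if "x \<notin> cball 0 ?R" for j x
    using out[OF that, of "h j"] out[OF that, of 0] h[of j] by (simp add: u_def)
  have cont_D: "continuous_on UNIV (D j)" for j
    unfolding D_def second_diff_def using h(1)[of "Suc j"] by (intro continuous_intros cont') auto
  have D0: "D j x = 0" if "x \<notin> cball 0 ?R" for j x
    using out[OF that, of "h (Suc j)"] out[OF that, of 0] out[OF that, of "2 * h (Suc j)"] h[of "Suc j"]
    by (simp add: D_def second_diff_def)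
  have int_u: "integrable lborel (\<lambda>x. (u j x)\<^sup>2)" for j
    using u0 by (intro integrable_continuous_compact_support[of _ ?R] continuous_intros cont_u) auto
  have int_D: "integrable lborel (\<lambda>x. (D j x)\<^sup>2)" for j
    using D0 by (intro integrable_continuous_compact_support[of _ ?R] continuous_intros cont_D) auto
  have u_shift: "u (Suc j) (h (Suc j) *\<^sub>R v + x) = u (Suc j) x + D j x"
    and u_mean: "2 * u j x = 2 * u (Suc j) x + D j x" for j x
  proof -
    let ?h = "h (Suc j)"
    have e: "?h *\<^sub>R v + x + ?h *\<^sub>R v = x + (2 * ?h) *\<^sub>R v"
      by (simp add: scaleR_2 mult.commute flip: scaleR_scaleR)
    show "u (Suc j) (?h *\<^sub>R v + x) = u (Suc j) x + D j x"
      unfolding u_def D_def second_diff_def e using h(1)[of "Suc j"]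
      by (simp add: field_simps)
    show "2 * u j x = 2 * u (Suc j) x + D j x"
      unfolding u_def D_def second_diff_def h(2)[of j] using h(1)[of "Suc j"]
      by (simp add: field_simps)
  qed
  have par: "(\<integral>x. (D j x)\<^sup>2 \<partial>lborel) = 4 * (\<integral>x. (u (Suc j) x)\<^sup>2 \<partial>lborel) - 4 * (\<integral>x. (u j x)\<^sup>2 \<partial>lborel)" for j
  proof -
    let ?v = "h (Suc j) *\<^sub>R v"
    have meas: "(\<lambda>x. (u (Suc j) x)\<^sup>2) \<in> borel_measurable borel"
      by (intro borel_measurable_continuous_onI continuous_intros cont_u)
    have sh: "(\<integral>x. (u (Suc j) (?v + x))\<^sup>2 \<partial>lborel) = (\<integral>x. (u (Suc j) x)\<^sup>2 \<partial>lborel)"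
      using integral_lborel_translate[OF meas] .
    have eq: "(u (Suc j) (?v + x))\<^sup>2 = ((D j x)\<^sup>2 + 4 * (u j x)\<^sup>2 - 2 * (u (Suc j) x)\<^sup>2) / 2" for x
    proof -
      have "u j x = u (Suc j) x + D j x / 2" using u_mean[of j x] by simp
      then show ?thesis
        unfolding u_shift by (simp add: power2_eq_square algebra_simps)
    qed
    have "(\<integral>x. (u (Suc j) (?v + x))\<^sup>2 \<partial>lborel)
        = ((\<integral>x. (D j x)\<^sup>2 \<partial>lborel) + 4 * (\<integral>x. (u j x)\<^sup>2 \<partial>lborel) - 2 * (\<integral>x. (u (Suc j) x)\<^sup>2 \<partial>lborel)) / 2"
      unfolding eq using int_u int_D by simp
    then show ?thesis
      unfolding sh by simp
  qed
  have bound: "(\<integral>x. (u j x)\<^sup>2 \<partial>lborel) \<le> (L * norm v)\<^sup>2 * measure lborel (cball (0::'a) ?R)" for j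
  proof -
    have "(\<integral>x. (u j x)\<^sup>2 \<partial>lborel) \<le> (\<integral>x. (L * norm v)\<^sup>2 * indicator (cball (0::'a) ?R) x \<partial>lborel)"
    proof (rule integral_mono[OF int_u])
      show "integrable lborel (\<lambda>x. (L * norm v)\<^sup>2 * indicator (cball (0::'a) ?R) x :: real)"
        using emeasure_compact_finite[OF compact_cball[of "0::'a" ?R]]
        by (intro integrable_mult_right integrable_real_indicator) auto
      fix x
      have "\<bar>u j x\<bar> \<le> L * norm v"
        using lip[of "x + h j *\<^sub>R v" x] h(1)[of j] by (simp add: u_def abs_divide field_simps)
      then have "(u j x)\<^sup>2 \<le> (L * norm v)\<^sup>2"
        by (rule abs_le_square_iff[THEN iffD1, OF order_trans]) simp
      then show "(u j x)\<^sup>2 \<le> (L * norm v)\<^sup>2 * indicator (cball (0::'a) ?R) x"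
        using u0[of x j] by (auto simp: indicator_def)
    qed
    then show ?thesis by simp
  qed
  show thesis
  proof (rule that)
    fix m
    have "(\<Sum>j<m. \<integral>x. (D j x)\<^sup>2 \<partial>lborel) = 4 * (\<integral>x. (u m x)\<^sup>2 \<partial>lborel) - 4 * (\<integral>x. (u 0 x)\<^sup>2 \<partial>lborel)"
      by (induction m) (simp_all add: par)
    also have "\<dots> \<le> 4 * ((L * norm v)\<^sup>2 * measure lborel (cball (0::'a) ?R))"
    proof -
      have "(\<integral>x. (u 0 x)\<^sup>2 \<partial>lborel) \<ge> 0" by simp
      then show ?thesis using bound[of m] by linarith
    qed
    finally show "(\<Sum>j<m. \<integral>x. (second_diff g v ((1/2)^Suc j) x)\<^sup>2 \<partial>lborel)
        \<le> 4 * ((L * norm v)\<^sup>2 * measure lborel (cball (0::'a) ?R))"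
      by (simp add: D_def h_def)
  qed (use int_D in \<open>simp add: D_def h_def\<close>)
qed

text \<open>The base point moves by \<open>2\<^sup>-\<^sup>j w\<close>, which does not change the integrals. A series of functions whose
  integrals are summable converges almost everywhere, so its terms tend to \<open>0\<close>.\<close>
lemma AE_second_diff_tendsto_0:
  fixes g :: "'a::euclidean_space \<Rightarrow> real"
  assumes lip: "\<And>x y. \<bar>g x - g y\<bar> \<le> L * norm (x - y)"
    and supp: "\<And>x. x \<notin> cball 0 R \<Longrightarrow> g x = 0"
  shows "AE x in lborel. (\<lambda>j. second_diff g v ((1/2)^j) (x + (1/2)^j *\<^sub>R w)) \<longlonglongrightarrow> 0"
proof -
  define D where "D j x = second_diff g v ((1/2)^Suc j) x" for j x
  obtain B where B: "\<And>m. (\<Sum>j<m. \<integral>x. (D j x)\<^sup>2 \<partial>lborel) \<le> B"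
    and int: "\<And>j. integrable lborel (\<lambda>x. (D j x)\<^sup>2)"
    unfolding D_def using integral_second_diff_le[OF lip supp, where v = v] by blast
  let ?w = "\<lambda>j. (1/2)^Suc j *\<^sub>R w"
  have meas: "(\<lambda>x. (D j x)\<^sup>2) \<in> borel_measurable borel" for j
    using int[of j] by simp
  have meas': "(\<lambda>x. ennreal ((D j (?w j + x))\<^sup>2)) \<in> borel_measurable lborel" for j
    using meas[of j] by measurable
  have "(\<integral>\<^sup>+x. ennreal ((D j (?w j + x))\<^sup>2) \<partial>lborel) = ennreal (\<integral>x. (D j x)\<^sup>2 \<partial>lborel)" for j
  proof -
    have "(\<integral>\<^sup>+x. ennreal ((D j (?w j + x))\<^sup>2) \<partial>lborel)
        = (\<integral>\<^sup>+x. ennreal ((D j x)\<^sup>2) \<partial>distr lborel borel ((+) (?w j)))"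
      using meas[of j] by (subst nn_integral_distr) auto
    also have "\<dots> = (\<integral>\<^sup>+x. ennreal ((D j x)\<^sup>2) \<partial>lborel)"
      by (simp only: lborel_distr_plus)
    also have "\<dots> = ennreal (\<integral>x. (D j x)\<^sup>2 \<partial>lborel)"
      by (intro nn_integral_eq_integral int) auto
    finally show ?thesis .
  qed
  then have "(\<integral>\<^sup>+x. (\<Sum>j. ennreal ((D j (?w j + x))\<^sup>2)) \<partial>lborel) = (\<Sum>j. ennreal (\<integral>x. (D j x)\<^sup>2 \<partial>lborel))"
    by (subst nn_integral_suminf[OF meas']) simp
  also have "\<dots> \<le> ennreal B"
    using B by (intro suminf_le_const summableI) (simp add: sum_ennreal ennreal_leI)
  finally have "(\<integral>\<^sup>+x. (\<Sum>j. ennreal ((D j (?w j + x))\<^sup>2)) \<partial>lborel) \<noteq> \<infinity>"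
    by (auto simp: top_unique)
  then have "AE x in lborel. (\<Sum>j. ennreal ((D j (?w j + x))\<^sup>2)) \<noteq> \<infinity>"
    using meas' by (intro nn_integral_PInf_AE) auto
  then show ?thesis
  proof eventually_elim
    case (elim x)
    then have "summable (\<lambda>j. (D j (?w j + x))\<^sup>2)"
      by (intro summable_suminf_not_top) auto
    then have "(\<lambda>j. sqrt ((D j (?w j + x))\<^sup>2)) \<longlonglongrightarrow> sqrt 0"
      by (intro tendsto_real_sqrt summable_LIMSEQ_zero)
    then have "(\<lambda>j. D j (?w j + x)) \<longlonglongrightarrow> 0"
      by (simp add: tendsto_rabs_zero_iff)
    then have "(\<lambda>j. second_diff g v ((1/2)^Suc j) (x + (1/2)^Suc j *\<^sub>R w)) \<longlonglongrightarrow> 0"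
      by (simp add: D_def add.commute)
    then show ?case
      by (rule LIMSEQ_imp_Suc)
  qed
qed

text \<open>The McShane extension: the largest function with the given Lipschitz constant that does not exceed
  \<open>f\<close> on \<open>S\<close>.\<close>
lemma lipschitz_extension_real:
  fixes f :: "'a::metric_space \<Rightarrow> real"
  assumes L: "L \<ge> 0" and lip: "\<And>x y. x \<in> S \<Longrightarrow> y \<in> S \<Longrightarrow> \<bar>f x - f y\<bar> \<le> L * dist x y"
  obtains F where "\<And>x. x \<in> S \<Longrightarrow> F x = f x" "\<And>x y. \<bar>F x - F y\<bar> \<le> L * dist x y"
proof (cases "S = {}")
  case True
  then show thesis using that[of "\<lambda>_. 0"] L by auto
next
  case False
  then obtain z where z: "z \<in> S" by auto
  define F where "F x = (INF y\<in>S. f y + L * dist x y)" for x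
  have bdd: "bdd_below ((\<lambda>y. f y + L * dist x y) ` S)" for x
  proof (rule bdd_belowI2)
    fix y assume "y \<in> S"
    then have "\<bar>f z - f y\<bar> \<le> L * dist z y" using lip z by blast
    also have "\<dots> \<le> L * (dist x z + dist x y)"
      using L by (intro mult_left_mono dist_triangle3)
    finally show "f z - L * dist x z \<le> f y + L * dist x y"
      by (simp add: distrib_left)
  qed
  have half: "F x \<le> F y + L * dist x y" for x y
  proof -
    have "F x - L * dist x y \<le> f z + L * dist y z" if "z \<in> S" for z
    proof -
      have "F x \<le> f z + L * dist x z"
        unfolding F_def by (rule cINF_lower[OF bdd that])
      also have "\<dots> \<le> f z + L * (dist x y + dist y z)"
        using L by (intro add_left_mono mult_left_mono dist_triangle)
      finally show ?thesis by (simp add: distrib_left)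
    qed
    then have "F x - L * dist x y \<le> F y"
      unfolding F_def[of y] using False by (intro cINF_greatest)
    then show ?thesis by simp
  qed
  have "F x = f x" if "x \<in> S" for x
  proof (rule antisym)
    show "F x \<le> f x"
      unfolding F_def using cINF_lower[OF bdd that, of x] by simp
    show "f x \<le> F x"
      unfolding F_def
    proof (rule cINF_greatest[OF False])
      fix y assume "y \<in> S"
      with lip[OF that this] show "f x \<le> f y + L * dist x y" by linarith
    qed
  qed
  moreover have "\<bar>F x - F y\<bar> \<le> L * dist x y" for x y
    using half[of x y] half[of y x] by (simp add: dist_commute abs_le_iff)
  ultimately show thesis using that by blast
qed

text \<open>Prescribe the value \<open>0\<close> outside a ball that contains the \<open>1\<close>-neighbourhood of \<open>K\<close>, and extend
  from the union.\<close>
lemma lipschitz_extension_compact_support: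
  fixes f :: "'a::euclidean_space \<Rightarrow> real"
  assumes K: "compact K" and L: "L \<ge> 0"
    and lip: "\<And>x y. x \<in> K \<Longrightarrow> y \<in> K \<Longrightarrow> \<bar>f x - f y\<bar> \<le> L * norm (x - y)"
  obtains F L' R where "L' \<ge> 0" "\<And>x. x \<in> K \<Longrightarrow> F x = f x" "\<And>x y. \<bar>F x - F y\<bar> \<le> L' * norm (x - y)"
    "\<And>x. x \<notin> cball 0 R \<Longrightarrow> F x = 0"
proof -
  obtain b where b: "b > 0" "\<And>x. x \<in> K \<Longrightarrow> norm x \<le> b"
    using compact_imp_bounded[OF K] by (auto simp: bounded_pos)
  have "\<exists>M\<ge>0. \<forall>x\<in>K. \<bar>f x\<bar> \<le> M"
  proof (cases "K = {}")
    case False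
    then obtain z where z: "z \<in> K" by auto
    have "\<bar>f x\<bar> \<le> \<bar>f z\<bar> + L * (2 * b)" if "x \<in> K" for x
    proof -
      have "norm (x - z) \<le> 2 * b"
        using norm_triangle_ineq4[of x z] b(2)[OF that] b(2)[OF z] by linarith
      then have "\<bar>f x - f z\<bar> \<le> L * (2 * b)"
        using lip[OF that z] L by (meson mult_left_mono order_trans)
      then show ?thesis by linarith
    qed
    moreover have "\<bar>f z\<bar> + L * (2 * b) \<ge> 0" using L b by simp
    ultimately show ?thesis by blast
  qed auto
  then obtain M where M: "M \<ge> 0" "\<And>x. x \<in> K \<Longrightarrow> \<bar>f x\<bar> \<le> M" by blast
  let ?S = "K \<union> - cball 0 (b + 1)" and ?L = "max L M" and ?f = "\<lambda>x. if x \<in> K then f x else 0"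
  have far: "\<bar>f x\<bar> \<le> ?L * dist x y" "1 \<le> dist x y" if "x \<in> K" "y \<notin> cball 0 (b + 1)" for x y
  proof -
    show "1 \<le> dist x y"
      using norm_triangle_ineq2[of y x] that b(2)[of x] by (simp add: dist_norm norm_minus_commute)
    then have "M * 1 \<le> ?L * dist x y"
      using M by (intro mult_mono) auto
    then show "\<bar>f x\<bar> \<le> ?L * dist x y" using M(2)[OF that(1)] by linarith
  qed
  have "\<bar>?f x - ?f y\<bar> \<le> ?L * dist x y" if "x \<in> ?S" "y \<in> ?S" for x y
  proof (cases "x \<in> K")
    case True
    note x = this
    show ?thesis
    proof (cases "y \<in> K")
      case True
      have "L * norm (x - y) \<le> ?L * dist x y"
        by (simp add: dist_norm mult_right_mono)
      then show ?thesis using lip[OF x True] x True by simp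
    next
      case False
      then show ?thesis using far[OF x, of y] that x by simp
    qed
  next
    case False
    show ?thesis
    proof (cases "y \<in> K")
      case True
      then show ?thesis using far[OF True, of x] that False by (simp add: dist_commute)
    next
      case F2: False
      then show ?thesis using False M(1) by simp
    qed
  qed
  moreover have "?L \<ge> 0" using L by simp
  ultimately obtain F where F: "\<And>x. x \<in> ?S \<Longrightarrow> F x = ?f x" "\<And>x y. \<bar>F x - F y\<bar> \<le> ?L * dist x y"
    using lipschitz_extension_real[of ?L ?S ?f] by blast
  show thesis
  proof (rule that[of ?L F "b + 1"])
    show "F x = f x" if "x \<in> K" for x using F(1)[of x] that by simp
    show "F x = 0" if "x \<notin> cball 0 (b + 1)" for x
    proof -
      have "x \<notin> K" using b(2)[of x] that by auto
      then show ?thesis using F(1)[of x] that by simp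
    qed
    show "\<bar>F x - F y\<bar> \<le> ?L * norm (x - y)" for x y
      using F(2)[of x y] by (simp add: dist_norm)
  qed (use L in auto)
qed

section \<open>Affine blow-ups almost everywhere\<close>

lemma closed_tendsto_set:
  fixes f :: "nat \<Rightarrow> 'a::real_normed_vector \<Rightarrow> 'b::real_normed_vector"
  assumes lip: "\<And>j u v. norm (f j u - f j v) \<le> L * norm (u - v)"
    and A: "\<And>u v. norm (A u - A v) \<le> L * norm (u - v)"
  shows "closed {u. (\<lambda>j. f j u) \<longlonglongrightarrow> A u}"
proof -
  have "(\<lambda>j. f j u) \<longlonglongrightarrow> A u" if u: "u \<in> closure {u. (\<lambda>j. f j u) \<longlonglongrightarrow> A u}" for u
  proof (rule LIMSEQ_I)
    fix e :: real assume e: "e > 0"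
    let ?L = "\<bar>L\<bar> + 1"
    obtain v where v: "(\<lambda>j. f j v) \<longlonglongrightarrow> A v" "dist v u < e / (3 * ?L)"
      using u e by (auto simp: closure_approachable dest: spec[of _ "e / (3 * ?L)"])
    have small: "L * norm (u - v) \<le> e / 3" "L * norm (v - u) \<le> e / 3"
    proof -
      have "L * norm (u - v) \<le> ?L * norm (u - v)"
        by (intro mult_right_mono) auto
      also have "\<dots> \<le> ?L * (e / (3 * ?L))"
        using v(2) by (intro mult_left_mono) (auto simp: dist_norm norm_minus_commute)
      also have "\<dots> = e / 3"
        by (simp add: field_simps)
      finally show "L * norm (u - v) \<le> e / 3" .
      then show "L * norm (v - u) \<le> e / 3"
        by (simp add: norm_minus_commute)
    qed
    obtain N where N: "\<And>j. j \<ge> N \<Longrightarrow> norm (f j v - A v) < e / 3"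
      using LIMSEQ_D[OF v(1), of "e / 3"] e by auto
    have "norm (f j u - A u) < e" if "j \<ge> N" for j
    proof -
      have "f j u - A u = (f j u - f j v) + (f j v - A v) + (A v - A u)" by simp
      then have "norm (f j u - A u) \<le> norm (f j u - f j v) + norm (f j v - A v) + norm (A v - A u)"
        using norm_triangle_ineq[of "(f j u - f j v) + (f j v - A v)" "A v - A u"]
          norm_triangle_ineq[of "f j u - f j v" "f j v - A v"] by simp
      then show ?thesis
        using lip[of j u v] A[of v u] N[OF that] small by linarith
    qed
    then show "\<exists>N. \<forall>j\<ge>N. norm (f j u - A u) < e" by blast
  qed
  then show ?thesis
    using closure_subset_eq by blast
qed

text \<open>The assumption \<open>jensen\<close> says that the maps are asymptotically midpoint affine at rational points.
  Along a subsequence the values at the unit vectors converge. The rational points at which the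
  subsequence converges to the linear map with these values form a group closed under halving, so they
  include the dyadic points, which are dense; the common Lipschitz constant does the rest.\<close>
lemma affine_blow_up:
  fixes f :: "nat \<Rightarrow> real^'k \<Rightarrow> real^'n"
  assumes lip: "\<And>j u v. norm (f j u - f j v) \<le> L * norm (u - v)"
    and f0: "\<And>j. f j 0 = 0"
    and jensen: "\<And>v w. (\<forall>i. v $ i \<in> \<rat>) \<Longrightarrow> (\<forall>i. w $ i \<in> \<rat>) \<Longrightarrow>
      (\<lambda>j. f j (w + 2 *\<^sub>R v) - 2 *\<^sub>R f j (w + v) + f j w) \<longlonglongrightarrow> 0"
  obtains r A where "strict_mono r" "linear A" "\<And>u. (\<lambda>j. f (r j) u) \<longlonglongrightarrow> A u"
proof -
  have bd: "norm (f j u) \<le> L * norm u" for j u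
    using lip[of j u 0] f0 by simp
  define T :: "nat \<Rightarrow> real^'n^'k" where "T j = (\<chi> i. f j (axis i 1))" for j
  have "norm (T j) \<le> real CARD('k) * L" for j
  proof -
    have "norm (T j) \<le> (\<Sum>i\<in>UNIV. norm (T j $ i))"
      by (simp add: norm_vec_def L2_set_le_sum)
    also have "\<dots> \<le> (\<Sum>i\<in>(UNIV :: 'k set). L)"
    proof (rule sum_mono)
      fix i
      have "norm (axis i 1 :: real^'k) = 1"
        by (simp add: norm_Basis axis_in_Basis_iff)
      then show "norm (T j $ i) \<le> L"
        using bd[of j "axis i 1"] by (simp add: T_def)
    qed
    finally show ?thesis by simp
  qed
  then have "bounded (range T)"
    by (auto simp: bounded_iff)
  then obtain l r where r: "strict_mono r" and l: "(T \<circ> r) \<longlonglongrightarrow> l"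
    using bounded_imp_convergent_subsequence by blast
  define A where "A u = (\<Sum>i\<in>UNIV. u $ i *\<^sub>R l $ i)" for u :: "real^'k"
  have linA: "linear A"
    unfolding A_def by (rule linearI) (simp_all add: scaleR_add_left sum.distrib scaleR_sum_right)
  define P where "P u \<longleftrightarrow> (\<forall>i. u $ i \<in> \<rat>) \<and> (\<lambda>j. f (r j) u) \<longlonglongrightarrow> A u" for u
  have jen: "(\<lambda>j. f (r j) (w + 2 *\<^sub>R v) - 2 *\<^sub>R f (r j) (w + v) + f (r j) w) \<longlonglongrightarrow> 0"
    if "\<forall>i. v $ i \<in> \<rat>" "\<forall>i. w $ i \<in> \<rat>" for v w
    using LIMSEQ_subseq_LIMSEQ[OF jensen[OF that] r] by (simp add: o_def)
  have half_rat: "x / 2 \<in> \<rat>" if "x \<in> \<rat>" for x :: real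
    using that by (intro Rats_divide) auto
  have P_axis: "P (axis i 1)" for i
  proof -
    have "(\<lambda>j. (T \<circ> r) j $ i) \<longlonglongrightarrow> l $ i"
      by (intro tendsto_vec_nth l)
    moreover have "A (axis i 1) = (\<Sum>m\<in>UNIV. if m = i then l $ i else 0)"
      unfolding A_def by (rule sum.cong) (auto simp: axis_def)
    ultimately show ?thesis
      by (auto simp: P_def T_def axis_def)
  qed
  have P_0: "P 0"
    by (simp add: P_def f0 linear_0[OF linA])
  have P_add: "P (u + v)" if "P u" "P v" for u v
  proof -
    have rat: "\<forall>i. u $ i \<in> \<rat>" "\<forall>i. v $ i \<in> \<rat>" using that by (auto simp: P_def)
    have *: "\<forall>i. ((1/2) *\<^sub>R (u + v)) $ i \<in> \<rat>" "\<forall>i. ((1/2) *\<^sub>R (v - u)) $ i \<in> \<rat>"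
      using rat half_rat by (auto simp: Rats_add Rats_diff)
    (* Combine the midpoint relations for the segments from u to v and from 0 to u + v. *)
    have "u + (1/2) *\<^sub>R (v - u) = (1/2) *\<^sub>R (u + v)"
      by (simp add: vec_eq_iff field_simps)
    then have "(\<lambda>j. f (r j) v - 2 *\<^sub>R f (r j) ((1/2) *\<^sub>R (u + v)) + f (r j) u) \<longlonglongrightarrow> 0"
      using jen[OF *(2) rat(1)] by simp
    moreover have "(\<lambda>j. f (r j) (u + v) - 2 *\<^sub>R f (r j) ((1/2) *\<^sub>R (u + v))) \<longlonglongrightarrow> 0"
      using jen[OF *(1), of 0] by (simp add: f0)
    ultimately have "(\<lambda>j. (f (r j) (u + v) - 2 *\<^sub>R f (r j) ((1/2) *\<^sub>R (u + v)))
        - (f (r j) v - 2 *\<^sub>R f (r j) ((1/2) *\<^sub>R (u + v)) + f (r j) u) + f (r j) u + f (r j) v) \<longlonglongrightarrow> 0 - 0 + A u + A v"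
      using that by (intro tendsto_intros) (auto simp: P_def)
    then show ?thesis
      using rat by (simp add: P_def linear_add[OF linA])
  qed
  have P_neg: "P (- u)" if "P u" for u
  proof -
    have rat: "\<forall>i. u $ i \<in> \<rat>" "\<forall>i. (- u) $ i \<in> \<rat>" using that by (auto simp: P_def)
    have "- u + 2 *\<^sub>R u = u"
      by (simp add: scaleR_2)
    then have "(\<lambda>j. f (r j) u + f (r j) (- u)) \<longlonglongrightarrow> 0"
      using jen[OF rat] by (simp add: f0)
    then have "(\<lambda>j. (f (r j) u + f (r j) (- u)) - f (r j) u) \<longlonglongrightarrow> 0 - A u"
      using that by (intro tendsto_intros) (auto simp: P_def)
    then show ?thesis
      using rat by (simp add: P_def linear_neg[OF linA])
  qed
  have P_half: "P ((1/2) *\<^sub>R u)" if "P u" for u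
  proof -
    have rat: "\<forall>i. ((1/2) *\<^sub>R u) $ i \<in> \<rat>" using that half_rat by (auto simp: P_def)
    have "(\<lambda>j. f (r j) u - 2 *\<^sub>R f (r j) ((1/2) *\<^sub>R u)) \<longlonglongrightarrow> 0"
      using jen[OF rat, of 0] by (simp add: f0)
    then have "(\<lambda>j. (1/2) *\<^sub>R (f (r j) u - (f (r j) u - 2 *\<^sub>R f (r j) ((1/2) *\<^sub>R u)))) \<longlonglongrightarrow> (1/2) *\<^sub>R (A u - 0)"
      using that by (intro tendsto_intros) (auto simp: P_def)
    then show ?thesis
      using rat by (simp add: P_def linear_scale[OF linA])
  qed
  have P_nat: "P (real m *\<^sub>R u)" if "P u" for m u
    by (induction m) (auto simp: P_0 scaleR_add_left that intro: P_add)
  have P_int: "P (of_int m *\<^sub>R u)" if "P u" for m u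
    by (cases m rule: int_cases2) (use P_nat[OF that] P_neg[OF P_nat[OF that]] in auto)
  have P_dyadic: "P ((of_int m / 2^n) *\<^sub>R u)" if "P u" for m n u
  proof (induction n)
    case (Suc n)
    then show ?case using P_half[of "(of_int m / 2^n) *\<^sub>R u"] by simp
  qed (simp add: P_int that)
  have P_sum: "P (\<Sum>i\<in>B. g i)" if "\<And>i. i \<in> B \<Longrightarrow> P (g i)" for B and g :: "real^'k \<Rightarrow> real^'k"
    using that by (induction B rule: infinite_finite_induct) (auto simp: P_0 intro: P_add)
  obtain B where B: "\<And>u. norm (A u) \<le> B * norm u"
    using linear_bounded[OF linA] by blast
  have "closed {u. (\<lambda>j. f (r j) u) \<longlonglongrightarrow> A u}"
  proof (rule closed_tendsto_set)
    show "norm (f (r j) u - f (r j) v) \<le> max L B * norm (u - v)" for j u v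
      using lip[of "r j" u v] by (meson max.cobounded1 mult_right_mono norm_ge_zero order_trans)
    show "norm (A u - A v) \<le> max L B * norm (u - v)" for u v
      using B[of "u - v"] unfolding linear_diff[OF linA]
      by (meson max.cobounded2 mult_right_mono norm_ge_zero order_trans)
  qed
  moreover have "(\<Union>k. \<Union>g \<in> Basis \<rightarrow> \<int>. { \<Sum>i :: real^'k \<in> Basis. (g i / 2^k) *\<^sub>R i }) \<subseteq> {u. (\<lambda>j. f (r j) u) \<longlonglongrightarrow> A u}"
  proof clarify
    fix k and g :: "real^'k \<Rightarrow> real" assume g: "g \<in> Basis \<rightarrow> \<int>"
    have "P (\<Sum>i\<in>Basis. (g i / 2^k) *\<^sub>R i)"
    proof (rule P_sum)
      fix i :: "real^'k" assume "i \<in> Basis"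
      then obtain c where "i = axis c 1"
        by (auto simp: Basis_vec_def)
      moreover obtain m where "g i = of_int m"
        using g \<open>i \<in> Basis\<close> by (auto simp: Pi_iff elim!: Ints_cases)
      ultimately show "P ((g i / 2^k) *\<^sub>R i)"
        using P_dyadic[OF P_axis] by simp
    qed
    then show "(\<lambda>j. f (r j) (\<Sum>i\<in>Basis. (g i / 2^k) *\<^sub>R i)) \<longlonglongrightarrow> A (\<Sum>i\<in>Basis. (g i / 2^k) *\<^sub>R i)"
      by (simp add: P_def)
  qed
  ultimately have "UNIV \<subseteq> {u. (\<lambda>j. f (r j) u) \<longlonglongrightarrow> A u}"
    unfolding closure_dyadic_rationals[symmetric] by (intro closure_minimal)
  then show thesis
    by (intro that[OF r linA]) blast
qed

text \<open>Points of \<open>K\<close> that, after rescaling around \<open>s\<close> by the factors \<open>1 / h j\<close>, converge to \<open>u\<close>. Since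
  \<open>K\<close> need not contain \<open>s + h j u\<close>, such sequences take the place of that point.\<close>
definition tangent_seq ::
    "(nat \<Rightarrow> real) \<Rightarrow> 'a::real_normed_vector set \<Rightarrow> 'a \<Rightarrow> (nat \<Rightarrow> 'a) \<Rightarrow> 'a \<Rightarrow> bool" where
  "tangent_seq h K s \<sigma> u \<longleftrightarrow> (\<forall>j. \<sigma> j \<in> K) \<and> (\<lambda>j. (\<sigma> j - s) /\<^sub>R h j) \<longlonglongrightarrow> u"

text \<open>The second differences at dyadic scales vanish in the limit for the components of an extension of
  \<open>f\<close>, so its rescalings are asymptotically affine. For the distance \<open>\<rho>\<close> from \<open>K\<close>, which is
  nonnegative and vanishes at \<open>s\<close>, a vanishing symmetric second difference at \<open>s\<close> says that
  \<open>\<rho>(s + 2\<^sup>-\<^sup>j u)\<close> is \<open>o(2\<^sup>-\<^sup>j)\<close>; so tangent sequences exist for every \<open>u\<close>.\<close>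
lemma AE_blow_up:
  fixes f :: "real^'k \<Rightarrow> real^'n"
  assumes K: "compact K" and L: "L \<ge> 0"
    and lip: "\<And>x y. x \<in> K \<Longrightarrow> y \<in> K \<Longrightarrow> norm (f x - f y) \<le> L * norm (x - y)"
  shows "AE s in lborel. s \<in> K \<longrightarrow> (\<exists>h A. (\<forall>j. h j > 0) \<and> h \<longlonglongrightarrow> 0 \<and> linear A \<and>
     (\<forall>u. \<exists>\<sigma>. tangent_seq h K s \<sigma> u) \<and>
     (\<forall>\<sigma> u. tangent_seq h K s \<sigma> u \<longrightarrow> (\<lambda>j. (f (\<sigma> j) - f s) /\<^sub>R h j) \<longlonglongrightarrow> A u))"
proof -
  have "\<exists>F L' R. L' \<ge> 0 \<and> (\<forall>x\<in>K. F x = f x $ i) \<and> (\<forall>x y. \<bar>F x - F y\<bar> \<le> L' * norm (x - y)) \<and>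
      (\<forall>x. x \<notin> cball 0 R \<longrightarrow> F x = 0)" for i
  proof -
    have "\<bar>f x $ i - f y $ i\<bar> \<le> L * norm (x - y)" if "x \<in> K" "y \<in> K" for x y
      using component_le_norm_cart[of "f x - f y" i] lip[OF that] by simp
    from lipschitz_extension_compact_support[OF K L this] show ?thesis
      by metis
  qed
  then obtain F LL R where LL: "\<And>i. LL i \<ge> 0" and F: "\<And>i x. x \<in> K \<Longrightarrow> F i x = f x $ i"
    "\<And>i x y. \<bar>F i x - F i y\<bar> \<le> LL i * norm (x - y)" "\<And>i x. x \<notin> cball 0 (R i) \<Longrightarrow> F i x = 0"
    by metis
  define L' where "L' = (\<Sum>i\<in>UNIV. LL i)"
  have L': "L' \<ge> 0" unfolding L'_def by (intro sum_nonneg LL)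
  define G where "G x = (\<chi> i. F i x)" for x
  have G_eq: "G x = f x" if "x \<in> K" for x
    using F(1)[OF that] by (simp add: G_def vec_eq_iff)
  have G_lip: "norm (G x - G y) \<le> L' * norm (x - y)" for x y
  proof -
    have "norm (G x - G y) \<le> (\<Sum>i\<in>UNIV. \<bar>(G x - G y) $ i\<bar>)"
      by (rule norm_le_l1_cart)
    also have "\<dots> \<le> (\<Sum>i\<in>UNIV. LL i * norm (x - y))"
      by (intro sum_mono) (simp add: G_def F(2))
    finally show ?thesis by (simp add: L'_def sum_distrib_right)
  qed
  obtain b where b: "b > 0" "\<And>x. x \<in> K \<Longrightarrow> norm x < b"
    using compact_imp_bounded[OF K] by (auto simp: bounded_pos_less)
  (* Adding the complement of a large ball gives the distance function compact support. *)
  define T where "T = K \<union> {x. b \<le> norm x}"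
  have T: "closed T"
    unfolding T_def by (intro closed_Un compact_imp_closed K closed_Collect_le continuous_intros)
  have T_ne: "T \<noteq> {}"
  proof -
    obtain x :: "real^'k" where "norm x = b" using vector_choose_size[of b] b(1) by auto
    then show ?thesis by (auto simp: T_def)
  qed
  define \<rho> where "\<rho> x = infdist x T" for x
  have \<rho>_lip: "\<bar>\<rho> x - \<rho> y\<bar> \<le> 1 * norm (x - y)" for x y
    unfolding \<rho>_def using infdist_triangle_abs[of x T y] by (simp add: dist_norm)
  have \<rho>_supp: "\<rho> x = 0" if "x \<notin> cball 0 b" for x
    unfolding \<rho>_def using that by (intro infdist_zero) (simp add: T_def)
  let ?Q = "{v :: real^'k. \<forall>i. v $ i \<in> \<rat>}"
  have Q: "countable ?Q"
    using countable_vector[of "\<lambda>_. \<rat>"] countable_rat by blast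
  have AE_F: "AE s in lborel. \<forall>i\<in>UNIV. \<forall>v\<in>?Q. \<forall>w\<in>?Q.
     (\<lambda>j. second_diff (F i) v ((1/2)^j) (s + (1/2)^j *\<^sub>R w)) \<longlonglongrightarrow> 0"
    by (intro AE_ball_countable[THEN iffD2] ballI Q countable_finite finite AE_second_diff_tendsto_0[OF F(2,3)])
  have AE_\<rho>: "AE s in lborel. \<forall>v\<in>?Q. \<forall>w\<in>?Q.
     (\<lambda>j. second_diff \<rho> v ((1/2)^j) (s + (1/2)^j *\<^sub>R w)) \<longlonglongrightarrow> 0"
    by (intro AE_ball_countable[THEN iffD2] ballI Q AE_second_diff_tendsto_0[OF \<rho>_lip \<rho>_supp])
  from AE_F AE_\<rho> show ?thesis
  proof eventually_elim
    case (elim s)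
    show ?case
    proof
      assume s: "s \<in> K"
      define f' where "f' j u = (2::real)^j *\<^sub>R (G (s + (1/2)^j *\<^sub>R u) - G s)" for j u
      have f'_lip: "norm (f' j u - f' j v) \<le> L' * norm (u - v)" for j u v
      proof -
        have "f' j u - f' j v = (2::real)^j *\<^sub>R (G (s + (1/2)^j *\<^sub>R u) - G (s + (1/2)^j *\<^sub>R v))"
          by (simp add: f'_def algebra_simps)
        also have "norm \<dots> \<le> 2^j * (L' * norm ((s + (1/2)^j *\<^sub>R u) - (s + (1/2)^j *\<^sub>R v)))"
          using G_lip[of "s + (1/2)^j *\<^sub>R u" "s + (1/2)^j *\<^sub>R v"] by (simp add: mult_left_mono)
        also have "(s + (1/2)^j *\<^sub>R u) - (s + (1/2)^j *\<^sub>R v) = (1/2)^j *\<^sub>R (u - v)"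
          by (simp add: algebra_simps)
        finally show ?thesis
          by (simp add: power_one_over)
      qed
      have f'_0: "f' j 0 = 0" for j by (simp add: f'_def)
      have jensen: "(\<lambda>j. f' j (w + 2 *\<^sub>R v) - 2 *\<^sub>R f' j (w + v) + f' j w) \<longlonglongrightarrow> 0"
        if v: "\<forall>i. v $ i \<in> \<rat>" and w: "\<forall>i. w $ i \<in> \<rat>" for v w
      proof (rule vec_tendstoI)
        fix i
        have "(\<lambda>j. second_diff (F i) v ((1/2)^j) (s + (1/2)^j *\<^sub>R w)) \<longlonglongrightarrow> 0"
          using elim(1) v w by blast
        moreover have "second_diff (F i) v ((1/2)^j) (s + (1/2)^j *\<^sub>R w)
            = (f' j (w + 2 *\<^sub>R v) - 2 *\<^sub>R f' j (w + v) + f' j w) $ i" for j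
          by (simp add: second_diff_def f'_def G_def power_one_over algebra_simps)
        ultimately show "(\<lambda>j. (f' j (w + 2 *\<^sub>R v) - 2 *\<^sub>R f' j (w + v) + f' j w) $ i) \<longlonglongrightarrow> 0 $ i"
          by simp
      qed
      obtain r A where r: "strict_mono r" and A: "linear A" "\<And>u. (\<lambda>j. f' (r j) u) \<longlonglongrightarrow> A u"
        using affine_blow_up[OF f'_lip f'_0 jensen] by blast
      have \<rho>s: "\<rho> s = 0"
        unfolding \<rho>_def using s by (intro infdist_zero) (simp add: T_def)
      have \<rho>0: "\<rho> x \<ge> 0" for x by (simp add: \<rho>_def infdist_nonneg)
      define d where "d j u = (2::real)^j * \<rho> (s + (1/2)^j *\<^sub>R u)" for j u
      have "(\<lambda>j. d j v) \<longlonglongrightarrow> 0" if v: "\<forall>i. v $ i \<in> \<rat>" for v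
      proof -
        (* The second difference centred at s, that is, from s - 2^-j v to s + 2^-j v. *)
        have "\<forall>i. (- v) $ i \<in> \<rat>" using v by auto
        then have "(\<lambda>j. second_diff \<rho> v ((1/2)^j) (s + (1/2)^j *\<^sub>R (- v))) \<longlonglongrightarrow> 0"
          using elim(2) v by blast
        moreover have "norm (d j v) \<le> second_diff \<rho> v ((1/2)^j) (s + (1/2)^j *\<^sub>R (- v))" for j
        proof -
          have e: "s + (1/2)^j *\<^sub>R (- v) + (2 * (1/2)^j) *\<^sub>R v = s + (1/2)^j *\<^sub>R v"
            "s + (1/2)^j *\<^sub>R (- v) + (1/2)^j *\<^sub>R v = s"
            by (simp_all add: scaleR_2 flip: scaleR_scaleR)
          show ?thesis
            unfolding second_diff_def e \<rho>s using \<rho>0 by (simp add: d_def power_one_over)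
        qed
        ultimately show ?thesis
          by (rule Lim_null_comparison[OF eventuallyI, rotated])
      qed
      then have "?Q \<subseteq> {u. (\<lambda>j. d j u) \<longlonglongrightarrow> 0}" by blast
      moreover have "closed {u. (\<lambda>j. d j u) \<longlonglongrightarrow> 0}"
      proof (rule closed_tendsto_set[where L = 1])
        fix j u v
        have "d j u - d j v = 2^j * (\<rho> (s + (1/2)^j *\<^sub>R u) - \<rho> (s + (1/2)^j *\<^sub>R v))"
          by (simp add: d_def algebra_simps)
        then have "norm (d j u - d j v) \<le> 2^j * norm ((s + (1/2)^j *\<^sub>R u) - (s + (1/2)^j *\<^sub>R v))"
          using \<rho>_lip[of "s + (1/2)^j *\<^sub>R u" "s + (1/2)^j *\<^sub>R v"] by (simp add: abs_mult)
        also have "(s + (1/2)^j *\<^sub>R u) - (s + (1/2)^j *\<^sub>R v) = (1/2)^j *\<^sub>R (u - v)"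
          by (simp add: algebra_simps)
        finally show "norm (d j u - d j v) \<le> 1 * norm (u - v)"
          by (simp add: power_one_over)
      qed simp
      moreover have "closure ?Q = UNIV"
      proof -
        have "(\<Union>f \<in> Basis \<rightarrow> \<rat>. { \<Sum>i :: real^'k \<in> Basis. f i *\<^sub>R i }) \<subseteq> ?Q"
        proof clarify
          fix f :: "real^'k \<Rightarrow> real" and c assume f: "f \<in> Basis \<rightarrow> \<rat>"
          have "axis c 1 \<in> (Basis :: (real^'k) set)"
            by (simp add: axis_in_Basis_iff)
          moreover from this have "(\<Sum>i\<in>Basis. f i *\<^sub>R i) $ c = f (axis c 1)"
            unfolding cart_eq_inner_axis by (rule inner_sum_left_Basis)
          ultimately show "(\<Sum>i\<in>Basis. f i *\<^sub>R i) $ c \<in> \<rat>"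
            using f by (auto simp del: sum_component)
        qed
        from closure_mono[OF this] show ?thesis
          unfolding closure_rational_coordinates by blast
      qed
      ultimately have d_lim: "(\<lambda>j. d j u) \<longlonglongrightarrow> 0" for u
        using closure_minimal[of ?Q "{u. (\<lambda>j. d j u) \<longlonglongrightarrow> 0}"] by blast
      define h where "h j = (1/2::real)^r j" for j
      have h_inv: "x /\<^sub>R h j = 2^r j *\<^sub>R x" for j and x :: "'a::real_vector"
        by (simp add: h_def power_one_over)
      have h_lim: "h \<longlonglongrightarrow> 0"
      proof -
        have "(\<lambda>j. (1/2)^j :: real) \<longlonglongrightarrow> 0"
          by (intro LIMSEQ_power_zero) simp
        then show ?thesis
          using LIMSEQ_subseq_LIMSEQ[OF _ r, of "\<lambda>j. (1/2)^j :: real" 0] by (simp add: o_def h_def[abs_def])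
      qed
      have h: "\<forall>j. h j > 0" "h \<longlonglongrightarrow> 0"
        using h_lim by (auto simp: h_def)
      have ex: "\<exists>\<sigma>. tangent_seq h K s \<sigma> u" for u
      proof -
        have "\<exists>y\<in>T. \<rho> (s + (1/2)^r j *\<^sub>R u) = dist (s + (1/2)^r j *\<^sub>R u) y" for j
          unfolding \<rho>_def using infdist_attains_inf[OF T T_ne] by metis
        then obtain y where y: "\<And>j. y j \<in> T" "\<And>j. \<rho> (s + (1/2)^r j *\<^sub>R u) = dist (s + (1/2)^r j *\<^sub>R u) (y j)"
          by metis
        have lim: "(\<lambda>j. 2^r j *\<^sub>R (y j - s) - u) \<longlonglongrightarrow> 0"
        proof (rule Lim_null_comparison[OF eventuallyI])
          fix j
          have "2^r j *\<^sub>R (y j - s) - u = 2^r j *\<^sub>R (y j - (s + (1/2)^r j *\<^sub>R u))"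
            by (simp add: power_one_over algebra_simps)
          then show "norm (2^r j *\<^sub>R (y j - s) - u) \<le> d (r j) u"
            by (simp add: d_def y(2) dist_norm norm_minus_commute)
          show "(\<lambda>j. d (r j) u) \<longlonglongrightarrow> 0"
            using LIMSEQ_subseq_LIMSEQ[OF d_lim r] by (simp add: o_def)
        qed
        from tendsto_scaleR[OF h_lim LIM_zero_cancel[OF lim]]
        have "(\<lambda>j. y j - s) \<longlonglongrightarrow> 0"
          by (simp add: h_def power_one_over)
        then have "(\<lambda>j. norm (y j)) \<longlonglongrightarrow> norm s"
          by (rule tendsto_norm[OF LIM_zero_cancel])
        then have "\<forall>\<^sub>F j in sequentially. norm (y j) < b"
          using b(2)[OF s] by (rule order_tendstoD)
        then have ev: "\<forall>\<^sub>F j in sequentially. y j \<in> K"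
        proof (rule eventually_mono)
          show "y j \<in> K" if "norm (y j) < b" for j
            using y(1)[of j] that by (auto simp: T_def)
        qed
        define \<sigma> where "\<sigma> j = (if y j \<in> K then y j else s)" for j
        have "(\<lambda>j. 2^r j *\<^sub>R (\<sigma> j - s)) \<longlonglongrightarrow> u"
          using LIM_zero_cancel[OF lim]
          by (rule Lim_transform_eventually) (use ev in \<open>eventually_elim; simp add: \<sigma>_def\<close>)
        then show ?thesis
          using s by (auto simp: tangent_seq_def h_inv \<sigma>_def intro!: exI[of _ \<sigma>])
      qed
      have "(\<lambda>j. (f (\<sigma> j) - f s) /\<^sub>R h j) \<longlonglongrightarrow> A u" if "tangent_seq h K s \<sigma> u" for \<sigma> u
      proof -
        have \<sigma>: "\<And>j. \<sigma> j \<in> K" "(\<lambda>j. 2^(r j) *\<^sub>R (\<sigma> j - s)) \<longlonglongrightarrow> u"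
          using that by (auto simp: tangent_seq_def h_inv)
        have "(\<lambda>j. 2^(r j) *\<^sub>R (f (\<sigma> j) - f s) - f' (r j) u) \<longlonglongrightarrow> 0"
        proof (rule Lim_null_comparison[OF eventuallyI])
          fix j
          have "2^(r j) *\<^sub>R (f (\<sigma> j) - f s) = f' (r j) (2^(r j) *\<^sub>R (\<sigma> j - s))"
            using G_eq[OF \<sigma>(1)] G_eq[OF s] by (simp add: f'_def power_one_over)
          then show "norm (2^(r j) *\<^sub>R (f (\<sigma> j) - f s) - f' (r j) u) \<le> L' * norm (2^(r j) *\<^sub>R (\<sigma> j - s) - u)"
            by (simp add: f'_lip)
          show "(\<lambda>j. L' * norm (2^(r j) *\<^sub>R (\<sigma> j - s) - u)) \<longlonglongrightarrow> 0"
            using tendsto_mult_left[OF tendsto_norm[OF LIM_zero[OF \<sigma>(2)]], of L'] by simp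
        qed
        from tendsto_add[OF this A(2)[of u]] show ?thesis by (simp add: h_inv)
      qed
      then show "\<exists>h A. (\<forall>j. h j > 0) \<and> h \<longlonglongrightarrow> 0 \<and> linear A \<and>
         (\<forall>u. \<exists>\<sigma>. tangent_seq h K s \<sigma> u) \<and>
         (\<forall>\<sigma> u. tangent_seq h K s \<sigma> u \<longrightarrow> (\<lambda>j. (f (\<sigma> j) - f s) /\<^sub>R h j) \<longlonglongrightarrow> A u)"
        using h A(1) ex by blast
    qed
  qed
qed

section \<open>First-order variation of an adapted frame\<close>

lemma difference_quotient_tendsto:
  fixes Z :: "'a::real_normed_vector \<Rightarrow> 'b::real_normed_vector"
  assumes der: "(Z has_derivative D) (at x0)" and h: "\<And>j. h j > 0" "h \<longlonglongrightarrow> 0" and x: "(\<lambda>j. (x j - x0) /\<^sub>R h j) \<longlonglongrightarrow> w"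
  shows "(\<lambda>j. (Z (x j) - Z x0) /\<^sub>R h j) \<longlonglongrightarrow> D w"
proof -
  have lin: "bounded_linear D"
    using der by (rule has_derivative_bounded_linear)
  have x0: "x \<longlonglongrightarrow> x0"
  proof -
    have "(\<lambda>j. h j *\<^sub>R ((x j - x0) /\<^sub>R h j)) \<longlonglongrightarrow> 0 *\<^sub>R w"
      by (intro tendsto_intros h x)
    then show ?thesis
      using h(1) by (simp add: less_imp_neq[symmetric] LIM_zero_iff)
  qed
  have "(\<lambda>j. (Z (x j) - Z x0 - D (x j - x0)) /\<^sub>R h j) \<longlonglongrightarrow> 0"
  proof (rule LIMSEQ_I)
    fix e :: real assume e: "e > 0"
    define e' where "e' = e / (norm w + 1)"
    have e': "e' > 0" using e by (simp add: e'_def add_nonneg_pos)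
    obtain d where d: "d > 0" "\<And>y. norm (y - x0) < d \<Longrightarrow> norm (Z y - Z x0 - D (y - x0)) \<le> e' * norm (y - x0)"
      using der[unfolded has_derivative_at_alt] e' by blast
    have "\<forall>\<^sub>F j in sequentially. norm (x j - x0) < d"
      using x0 d(1) by (simp add: tendsto_iff dist_norm)
    moreover have "\<forall>\<^sub>F j in sequentially. norm ((x j - x0) /\<^sub>R h j) < norm w + 1"
      by (rule order_tendstoD(2)[OF tendsto_norm[OF x]]) simp
    ultimately have "\<forall>\<^sub>F j in sequentially. norm ((Z (x j) - Z x0 - D (x j - x0)) /\<^sub>R h j - 0) < e"
    proof eventually_elim
      case (elim j)
      have "norm ((Z (x j) - Z x0 - D (x j - x0)) /\<^sub>R h j) \<le> inverse (h j) * (e' * norm (x j - x0))"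
        using d(2)[OF elim(1)] h(1)[of j] by (simp add: mult_left_mono)
      also have "\<dots> = e' * norm ((x j - x0) /\<^sub>R h j)"
        using h(1)[of j] by simp
      also have "\<dots> < e' * (norm w + 1)"
        using e' elim(2) by (intro mult_strict_left_mono)
      also have "\<dots> = e"
        by (simp add: e'_def add_nonneg_eq_0_iff)
      finally show ?case by simp
    qed
    then show "\<exists>N. \<forall>j\<ge>N. norm ((Z (x j) - Z x0 - D (x j - x0)) /\<^sub>R h j - 0) < e"
      by (simp add: eventually_sequentially)
  qed
  moreover have "(\<lambda>j. D ((x j - x0) /\<^sub>R h j)) \<longlonglongrightarrow> D w"
    by (intro bounded_linear.tendsto[OF lin] x)
  ultimately have "(\<lambda>j. (Z (x j) - Z x0 - D (x j - x0)) /\<^sub>R h j + D ((x j - x0) /\<^sub>R h j)) \<longlonglongrightarrow> 0 + D w"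
    by (rule tendsto_add)
  moreover have "D ((x j - x0) /\<^sub>R h j) = D (x j - x0) /\<^sub>R h j" for j
    by (rule linear_scale[OF bounded_linear.linear[OF lin]])
  ultimately show ?thesis
    by (simp add: scaleR_diff_right)
qed

context adapted_frame
begin

lemma norm_comb_diff_tendsto_0:
  assumes x: "x \<longlonglongrightarrow> x0" and b: "\<And>j. norm (b j) \<le> B"
  shows "(\<lambda>j. comb (x j) (b j) - comb x0 (b j)) \<longlonglongrightarrow> 0"
proof -
  have "bounded (range x)"
    using x convergent_imp_bounded by blast
  then obtain R where R: "\<And>j. norm (x j) \<le> R"
    by (auto simp: bounded_iff)
  have "norm x0 \<le> R"
    by (rule Lim_bounded[OF tendsto_norm[OF x]]) (use R in auto)
  obtain L where L: "L > 0" "\<And>x y a. x \<in> cball 0 R \<Longrightarrow> y \<in> cball 0 R \<Longrightarrow>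
    norm (comb x a - comb y a) \<le> L * norm (x - y) * norm a"
    using comb_lipschitz by blast
  show ?thesis
  proof (rule Lim_null_comparison[OF eventuallyI])
    fix j
    have "norm (comb (x j) (b j) - comb x0 (b j)) \<le> L * norm (x j - x0) * norm (b j)"
      using R \<open>norm x0 \<le> R\<close> by (intro L) auto
    also have "\<dots> \<le> L * norm (x j - x0) * B"
      using L b by (intro mult_left_mono) auto
    finally show "norm (comb (x j) (b j) - comb x0 (b j)) \<le> L * norm (x j - x0) * B" .
    have "(\<lambda>j. L * norm (x j - x0) * B) \<longlonglongrightarrow> L * norm (x0 - x0) * B"
      by (intro tendsto_intros x)
    then show "(\<lambda>j. L * norm (x j - x0) * B) \<longlonglongrightarrow> 0" by simp
  qed
qed

text \<open>The rate at which the tangential vector with coefficients \<open>a\<close> acquires normal coordinates, measured in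
  the frame at \<open>x\<close>, when the base point leaves \<open>x\<close> with velocity \<open>v\<close>. On tangential arguments its
  antisymmetric part is the normal part of the Lie bracket.\<close>
definition twist :: "real^'n \<Rightarrow> real^'n \<Rightarrow> real^'n \<Rightarrow> real^'n" where
  "twist x v a = (\<Sum>i\<in>I. a $ i *\<^sub>R cut (-I) (coords x (frechet_derivative (X i) (at x) v)))"

lemma linear_frechet_X: "linear (frechet_derivative (X i) (at x))"
  using X_differentiable linear_frechet_derivative by blast

lemma linear_twist: "linear (\<lambda>v. twist x v a)"
  unfolding twist_def
  by (rule linearI)
    (simp_all add: linear_add[OF linear_frechet_X] linear_scale[OF linear_frechet_X] coords_add coords_scaleR
      cut_add cut_scaleR scaleR_add_right sum.distrib scaleR_sum_right mult.commute)

lemma linear_twist_right: "linear (twist x v)"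
  unfolding twist_def
  by (rule linearI) (simp_all add: scaleR_add_left sum.distrib scaleR_sum_right)

lemmas twist_add = linear_add[OF linear_twist] linear_add[OF linear_twist_right]
  and twist_diff = linear_diff[OF linear_twist] linear_diff[OF linear_twist_right]
  and twist_scale = linear_scale[OF linear_twist] linear_scale[OF linear_twist_right]

lemma twist_bound:
  obtains B where "B \<ge> 0" "\<And>v a. norm (twist x v a) \<le> B * norm v * norm a"
proof -
  have "\<exists>b\<ge>0. \<forall>v. norm (cut (-I) (coords x (frechet_derivative (X i) (at x) v))) \<le> b * norm v" for i
  proof -
    have "linear (\<lambda>v. cut (-I) (coords x (frechet_derivative (X i) (at x) v)))"
      using linear_compose[OF linear_frechet_X linear_compose[OF linear_coords linear_cut]] by (simp add: o_def)
    from linear_bounded_pos[OF this] show ?thesis by (metis less_imp_le)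
  qed
  then obtain b where b: "\<And>i. b i \<ge> 0"
    "\<And>i v. norm (cut (-I) (coords x (frechet_derivative (X i) (at x) v))) \<le> b i * norm v"
    by metis
  show thesis
  proof (rule that)
    show "(\<Sum>i\<in>I. b i) \<ge> 0" by (intro sum_nonneg b)
    fix v a
    have "norm (twist x v a) \<le> (\<Sum>i\<in>I. norm a * (b i * norm v))"
      unfolding twist_def using b
      by (intro order_trans[OF norm_sum] sum_mono) (auto intro!: mult_mono simp: component_le_norm_cart)
    then show "norm (twist x v a) \<le> (\<Sum>i\<in>I. b i) * norm v * norm a"
      by (simp add: sum_distrib_left sum_distrib_right mult_ac)
  qed
qed

text \<open>At \<open>x0\<close> itself the frame vectors with index in \<open>I\<close> have no normal part, so only their difference
  quotients contribute.\<close>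
lemma normal_part_of_tangent_tendsto:
  assumes h: "\<And>j. h j > 0" "h \<longlonglongrightarrow> 0" and x: "(\<lambda>j. (x j - x0) /\<^sub>R h j) \<longlonglongrightarrow> w"
    and a: "a \<longlonglongrightarrow> a0"
  shows "(\<lambda>j. cut (-I) (coords x0 (comb (x j) (cut I (a j)))) /\<^sub>R h j) \<longlonglongrightarrow> twist x0 w a0"
proof -
  have eq: "cut (-I) (coords x0 (comb (x j) (cut I (a j)))) /\<^sub>R h j
      = (\<Sum>i\<in>I. a j $ i *\<^sub>R cut (-I) (coords x0 ((X i (x j) - X i x0) /\<^sub>R h j)))" for j
  proof -
    have "comb (x j) (cut I (a j)) = (\<Sum>i\<in>I. a j $ i *\<^sub>R X i (x j))"
      unfolding comb_def by (intro sum.mono_neutral_cong_right) auto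
    then have "cut (-I) (coords x0 (comb (x j) (cut I (a j)))) = (\<Sum>i\<in>I. a j $ i *\<^sub>R cut (-I) (coords x0 (X i (x j))))"
      by (simp add: coords_sum coords_scaleR linear_sum[OF linear_cut] cut_scaleR)
    also have "\<dots> = (\<Sum>i\<in>I. a j $ i *\<^sub>R cut (-I) (coords x0 (X i (x j) - X i x0)))"
    proof (rule sum.cong[OF refl])
      fix i assume "i \<in> I"
      then have "cut (-I) (axis i 1 :: real^'n) = 0"
        by (auto simp: vec_eq_iff axis_def)
      then show "a j $ i *\<^sub>R cut (-I) (coords x0 (X i (x j))) = a j $ i *\<^sub>R cut (-I) (coords x0 (X i (x j) - X i x0))"
        by (simp add: coords_diff cut_diff)
    qed
    finally show ?thesis
      by (simp add: coords_scaleR cut_scaleR scaleR_sum_right mult.commute)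
  qed
  show ?thesis
    unfolding eq twist_def
    by (intro tendsto_sum tendsto_scaleR tendsto_vec_nth a tendsto_cut
        bounded_linear.tendsto[OF bounded_linear_coords] difference_quotient_tendsto[OF _ h x])
       (use X_differentiable frechet_derivative_works in blast)
qed

text \<open>The field is a tangential combination of the frame at every point, so the derivatives of its
  coefficients do not contribute to the normal part and only those of the frame do.\<close>
lemma derivative_of_tangent_field:
  assumes Z: "Z differentiable (at x0)" and tang: "\<And>y. cut (-I) (coords y (Z y)) = 0"
  shows "cut (-I) (coords x0 (frechet_derivative Z (at x0) v)) = twist x0 v (coords x0 (Z x0))"
proof -
  let ?D = "frechet_derivative Z (at x0)"
  define h where "h j = inverse (real (Suc j))" for j
  have h: "\<And>j. h j > 0" "h \<longlonglongrightarrow> 0"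
    unfolding h_def by simp (rule LIMSEQ_inverse_real_of_nat)
  define x where "x j = x0 + h j *\<^sub>R v" for j
  have x: "(\<lambda>j. (x j - x0) /\<^sub>R h j) \<longlonglongrightarrow> v"
    using h(1) by (simp add: x_def less_imp_neq[symmetric])
  have x0: "x \<longlonglongrightarrow> x0"
    unfolding x_def using tendsto_add[OF tendsto_const tendsto_scaleR[OF h(2) tendsto_const], of x0 v] by simp
  have der: "(Z has_derivative ?D) (at x0)"
    using Z frechet_derivative_works by blast
  then have contZ: "isCont Z x0"
    using has_derivative_continuous by blast
  have lim1: "(\<lambda>j. (Z (x j) - Z x0) /\<^sub>R h j) \<longlonglongrightarrow> ?D v"
    by (rule difference_quotient_tendsto[OF der h x])
  have coord: "(\<lambda>j. coords (x j) (Z (x j))) \<longlonglongrightarrow> coords x0 (Z x0)"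
    by (intro coords_tendsto x0 isCont_tendsto_compose[OF contZ x0])
  have "cut (-I) (coords x0 ((Z (x j) - Z x0) /\<^sub>R h j))
      = cut (-I) (coords x0 (comb (x j) (cut I (coords (x j) (Z (x j)))))) /\<^sub>R h j" for j
  proof -
    have "cut I (coords (x j) (Z (x j))) = coords (x j) (Z (x j))"
      using cut_split[of I "coords (x j) (Z (x j))"] tang[of "x j"] by simp
    then show ?thesis
      using tang[of x0] by (simp add: coords_scaleR coords_diff cut_scaleR cut_diff)
  qed
  then have "(\<lambda>j. cut (-I) (coords x0 ((Z (x j) - Z x0) /\<^sub>R h j))) \<longlonglongrightarrow> twist x0 v (coords x0 (Z x0))"
    using normal_part_of_tangent_tendsto[OF h x coord] by simp
  moreover have "(\<lambda>j. cut (-I) (coords x0 ((Z (x j) - Z x0) /\<^sub>R h j))) \<longlonglongrightarrow> cut (-I) (coords x0 (?D v))"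
    by (intro tendsto_cut bounded_linear.tendsto[OF bounded_linear_coords] lim1)
  ultimately show ?thesis
    using LIMSEQ_unique by blast
qed

end

context adapted_frame
begin

text \<open>Split \<open>y - x\<close> in the frame at \<open>x\<close>. The tangential part has size \<open>h\<close> and acquires a normal part of
  size \<open>h\<^sup>2\<close>, given by the twist, when it is viewed from \<open>x0\<close>; the normal part has size \<open>h\<^sup>2\<close> already,
  so changing the frame affects it by \<open>o(h\<^sup>2)\<close> only.\<close>
lemma normal_displacement_tendsto:
  assumes h: "\<And>j. h j > 0" "h \<longlonglongrightarrow> 0"
    and x: "(\<lambda>j. (x j - x0) /\<^sub>R h j) \<longlonglongrightarrow> p" and y: "(\<lambda>j. (y j - x0) /\<^sub>R h j) \<longlonglongrightarrow> q"
    and bd: "\<And>j. norm (cut (-I) (coords (x j) (y j - x j)) /\<^sub>R (h j)\<^sup>2) \<le> B"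
  shows "(\<lambda>j. coords (x j) (y j - x j) /\<^sub>R h j) \<longlonglongrightarrow> coords x0 (q - p)" (is ?th1)
    and "(\<lambda>j. cut (-I) (coords x0 (y j - x j)) /\<^sub>R (h j)\<^sup>2 - cut (-I) (coords (x j) (y j - x j)) /\<^sub>R (h j)\<^sup>2)
      \<longlonglongrightarrow> twist x0 p (coords x0 (q - p))"
proof -
  define b where "b j = cut (-I) (coords (x j) (y j - x j)) /\<^sub>R (h j)\<^sup>2" for j
  define a where "a j = coords (x j) (y j - x j) /\<^sub>R h j" for j
  have hn: "h j \<noteq> 0" for j using h(1)[of j] by simp
  have x0: "x \<longlonglongrightarrow> x0"
  proof -
    have "(\<lambda>j. h j *\<^sub>R ((x j - x0) /\<^sub>R h j)) \<longlonglongrightarrow> 0 *\<^sub>R p"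
      by (intro tendsto_intros h x)
    then show ?thesis
      using hn by (simp add: LIM_zero_iff)
  qed
  have "(\<lambda>j. (y j - x0) /\<^sub>R h j - (x j - x0) /\<^sub>R h j) \<longlonglongrightarrow> q - p"
    by (intro tendsto_diff x y)
  then have "(\<lambda>j. (y j - x j) /\<^sub>R h j) \<longlonglongrightarrow> q - p"
    by (simp add: scaleR_diff_right)
  from coords_tendsto[OF x0 this] have a: "a \<longlonglongrightarrow> coords x0 (q - p)"
    by (simp add: a_def[abs_def] coords_scaleR)
  then show ?th1 by (simp add: a_def[abs_def])
  have eq: "cut (-I) (coords x0 (y j - x j)) /\<^sub>R (h j)\<^sup>2 - b j
     = cut (-I) (coords x0 (comb (x j) (cut I (a j)))) /\<^sub>R h j
       + cut (-I) (coords x0 (comb (x j) (b j) - comb x0 (b j)))" for j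
  proof -
    have ab: "coords (x j) (y j - x j) = h j *\<^sub>R cut I (a j) + (h j)\<^sup>2 *\<^sub>R b j"
      using cut_split[of I "coords (x j) (y j - x j)"] hn[of j] by (simp add: a_def b_def cut_scaleR)
    have yx: "y j - x j = h j *\<^sub>R comb (x j) (cut I (a j)) + (h j)\<^sup>2 *\<^sub>R comb (x j) (b j)"
      using arg_cong[OF ab, of "comb (x j)"] by (simp add: comb_add comb_scaleR)
    have "cut (-I) (coords x0 (y j - x j)) /\<^sub>R (h j)\<^sup>2
        = cut (-I) (coords x0 (comb (x j) (cut I (a j)))) /\<^sub>R h j + cut (-I) (coords x0 (comb (x j) (b j)))"
    proof -
      have "inverse (h j) * inverse (h j) * h j = inverse (h j)" "inverse (h j) * inverse (h j) * (h j * h j) = 1"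
        using hn[of j] by (simp_all add: field_simps)
      with yx show ?thesis
        by (simp add: coords_add coords_scaleR cut_add cut_scaleR scaleR_add_right power2_eq_square)
    qed
    moreover have "cut (-I) (b j) = b j"
      by (simp add: b_def cut_scaleR)
    ultimately show ?thesis
      by (simp add: coords_diff cut_diff)
  qed
  have "(\<lambda>j. comb (x j) (b j) - comb x0 (b j)) \<longlonglongrightarrow> 0"
    using bd by (intro norm_comb_diff_tendsto_0[OF x0, of _ B]) (simp add: b_def)
  then have "(\<lambda>j. cut (-I) (coords x0 (comb (x j) (b j) - comb x0 (b j)))) \<longlonglongrightarrow> cut (-I) (coords x0 0)"
    by (intro tendsto_cut bounded_linear.tendsto[OF bounded_linear_coords])
  from tendsto_add[OF normal_part_of_tangent_tendsto[OF h x a] this]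
  show "(\<lambda>j. cut (-I) (coords x0 (y j - x j)) /\<^sub>R (h j)\<^sup>2 - cut (-I) (coords (x j) (y j - x j)) /\<^sub>R (h j)\<^sup>2)
      \<longlonglongrightarrow> twist x0 p (coords x0 (q - p))"
    unfolding b_def[symmetric] eq by simp
qed

end

section \<open>Blow-ups of horizontal maps\<close>

text \<open>A point \<open>s\<close> at which the rescalings of \<open>f\<close> along the scales \<open>h\<close> converge to \<open>A\<close>, for a map whose
  displacements have normal coordinates of second order. The limit is required along all tangent
  sequences, since \<open>f\<close> matters on \<open>K\<close> only.\<close>
locale horizontal_blow_up = adapted_frame X I for X :: "'n::finite \<Rightarrow> real^'n \<Rightarrow> real^'n" and I +
  fixes K :: "(real^'k) set" and f :: "real^'k \<Rightarrow> real^'n" and s :: "real^'k" and h :: "nat \<Rightarrow> real"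
    and A :: "real^'k \<Rightarrow> real^'n" and C :: real
  assumes h: "\<And>j. h j > 0" "h \<longlonglongrightarrow> 0"
    and A: "linear A" and s: "s \<in> K" and C: "C \<ge> 0"
    and ex_tangent: "\<And>u. \<exists>\<sigma>. tangent_seq h K s \<sigma> u"
    and blow_up: "\<And>\<sigma> u. tangent_seq h K s \<sigma> u \<Longrightarrow> (\<lambda>j. (f (\<sigma> j) - f s) /\<^sub>R h j) \<longlonglongrightarrow> A u"
    and horizontal: "\<And>\<sigma> \<tau>. \<sigma> \<in> K \<Longrightarrow> \<tau> \<in> K \<Longrightarrow>
      norm (cut (-I) (coords (f \<sigma>) (f \<tau> - f \<sigma>))) \<le> C * (norm (\<tau> - \<sigma>))\<^sup>2"
begin

definition \<omega> :: "real^'k \<Rightarrow> real^'n" where "\<omega> u = coords (f s) (A u)"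

definition normal_diff :: "(nat \<Rightarrow> real^'k) \<Rightarrow> (nat \<Rightarrow> real^'k) \<Rightarrow> nat \<Rightarrow> real^'n" where
  "normal_diff \<sigma> \<tau> j = cut (-I) (coords (f s) (f (\<tau> j) - f (\<sigma> j))) /\<^sub>R (h j)\<^sup>2"

text \<open>The integral of the twist along the segment from \<open>A a\<close> to \<open>A b\<close>, whose integrand is affine.\<close>
definition limit_diff :: "real^'k \<Rightarrow> real^'k \<Rightarrow> real^'n" where
  "limit_diff a b = (1/2) *\<^sub>R twist (f s) (A (a + b)) (\<omega> (b - a))"

lemmas A_simps = linear_add[OF A] linear_diff[OF A] linear_scale[OF A] linear_0[OF A]

lemma \<omega>_simps: "\<omega> (a + b) = \<omega> a + \<omega> b" "\<omega> (a - b) = \<omega> a - \<omega> b" "\<omega> (t *\<^sub>R a) = t *\<^sub>R \<omega> a" "\<omega> 0 = 0"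
  by (simp_all add: \<omega>_def A_simps coords_add coords_diff coords_scaleR)

lemma tangent_const: "tangent_seq h K s (\<lambda>_. s) 0"
  using s by (simp add: tangent_seq_def)

lemma local_normal_bound:
  assumes "tangent_seq h K s \<sigma> a" "tangent_seq h K s \<tau> b"
  shows "norm (cut (-I) (coords (f (\<sigma> j)) (f (\<tau> j) - f (\<sigma> j))) /\<^sub>R (h j)\<^sup>2)
       \<le> C * (norm ((\<tau> j - s) /\<^sub>R h j - (\<sigma> j - s) /\<^sub>R h j))\<^sup>2" (is ?th1)
    and "(\<lambda>j. C * (norm ((\<tau> j - s) /\<^sub>R h j - (\<sigma> j - s) /\<^sub>R h j))\<^sup>2) \<longlonglongrightarrow> C * (norm (b - a))\<^sup>2" (is ?th2)
    and "\<exists>B. \<forall>j. norm (cut (-I) (coords (f (\<sigma> j)) (f (\<tau> j) - f (\<sigma> j))) /\<^sub>R (h j)\<^sup>2) \<le> B" (is ?th3)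
proof -
  have *: "norm (cut (-I) (coords (f (\<sigma> j)) (f (\<tau> j) - f (\<sigma> j))) /\<^sub>R (h j)\<^sup>2)
       \<le> C * (norm ((\<tau> j - s) /\<^sub>R h j - (\<sigma> j - s) /\<^sub>R h j))\<^sup>2" for j
  proof -
    have "(\<tau> j - s) /\<^sub>R h j - (\<sigma> j - s) /\<^sub>R h j = (\<tau> j - \<sigma> j) /\<^sub>R h j"
      by (simp add: scaleR_diff_right)
    moreover have "norm (cut (-I) (coords (f (\<sigma> j)) (f (\<tau> j) - f (\<sigma> j)))) \<le> C * (norm (\<tau> j - \<sigma> j))\<^sup>2"
      using assms by (intro horizontal) (auto simp: tangent_seq_def)
    then have "inverse ((h j)\<^sup>2) * norm (cut (-I) (coords (f (\<sigma> j)) (f (\<tau> j) - f (\<sigma> j))))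
        \<le> inverse ((h j)\<^sup>2) * (C * (norm (\<tau> j - \<sigma> j))\<^sup>2)"
      by (rule mult_left_mono) simp
    ultimately show ?thesis
      by (simp add: power_mult_distrib power_inverse mult_ac)
  qed
  then show ?th1 .
  show lim: ?th2
    using assms by (intro tendsto_intros) (auto simp: tangent_seq_def)
  then obtain B where "\<And>j. norm (C * (norm ((\<tau> j - s) /\<^sub>R h j - (\<sigma> j - s) /\<^sub>R h j))\<^sup>2) \<le> B"
    using convergent_imp_bounded by (force simp: bounded_iff)
  then have "norm (cut (-I) (coords (f (\<sigma> j)) (f (\<tau> j) - f (\<sigma> j))) /\<^sub>R (h j)\<^sup>2) \<le> B" for j
    using *[of j] by (smt (verit) real_norm_def)
  then show ?th3 by blast
qed

lemma coords_tangent_tendsto: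
  assumes st: "tangent_seq h K s \<sigma> a" "tangent_seq h K s \<tau> b"
  shows "(\<lambda>j. coords (f (\<sigma> j)) (f (\<tau> j) - f (\<sigma> j)) /\<^sub>R h j) \<longlonglongrightarrow> \<omega> (b - a)"
    and "(\<lambda>j. normal_diff \<sigma> \<tau> j - cut (-I) (coords (f (\<sigma> j)) (f (\<tau> j) - f (\<sigma> j))) /\<^sub>R (h j)\<^sup>2)
      \<longlonglongrightarrow> twist (f s) (A a) (\<omega> (b - a))"
proof -
  obtain B where B: "\<And>j. norm (cut (-I) (coords (f (\<sigma> j)) (f (\<tau> j) - f (\<sigma> j))) /\<^sub>R (h j)\<^sup>2) \<le> B"
    using local_normal_bound(3)[OF st] by blast
  show "(\<lambda>j. coords (f (\<sigma> j)) (f (\<tau> j) - f (\<sigma> j)) /\<^sub>R h j) \<longlonglongrightarrow> \<omega> (b - a)"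
    using normal_displacement_tendsto(1)[OF h blow_up[OF st(1)] blow_up[OF st(2)] B]
    by (simp add: \<omega>_def A_simps)
  show "(\<lambda>j. normal_diff \<sigma> \<tau> j - cut (-I) (coords (f (\<sigma> j)) (f (\<tau> j) - f (\<sigma> j))) /\<^sub>R (h j)\<^sup>2)
      \<longlonglongrightarrow> twist (f s) (A a) (\<omega> (b - a))"
    using normal_displacement_tendsto(2)[OF h blow_up[OF st(1)] blow_up[OF st(2)] B]
    by (simp add: normal_diff_def \<omega>_def A_simps)
qed

lemma twist_quadratic_bound:
  obtains B where "B \<ge> 0" "\<And>u. norm ((1/2) *\<^sub>R twist (f s) (A u) (\<omega> u)) \<le> B * (norm u)\<^sup>2"
proof -
  obtain B where B: "B \<ge> 0" "\<And>v a. norm (twist (f s) v a) \<le> B * norm v * norm a"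
    using twist_bound by blast
  obtain M where M: "M > 0" "\<And>u. norm (A u) \<le> M * norm u"
    using linear_bounded_pos[OF A] by blast
  have lin: "linear \<omega>"
    by (rule linearI) (simp_all add: \<omega>_simps)
  obtain N where N: "N > 0" "\<And>u. norm (\<omega> u) \<le> N * norm u"
    using linear_bounded_pos[OF lin] by blast
  show thesis
  proof (rule that)
    show "B * M * N \<ge> 0" using B M N by simp
    fix u
    have "norm ((1/2) *\<^sub>R twist (f s) (A u) (\<omega> u)) \<le> norm (twist (f s) (A u) (\<omega> u))"
      by simp
    also have "\<dots> \<le> B * norm (A u) * norm (\<omega> u)" by (rule B(2))
    also have "\<dots> \<le> B * (M * norm u) * (N * norm u)"
      using B M N by (intro mult_mono) auto
    finally show "norm ((1/2) *\<^sub>R twist (f s) (A u) (\<omega> u)) \<le> B * M * N * (norm u)\<^sup>2"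
      by (simp add: power2_eq_square mult_ac)
  qed
qed

text \<open>Comparing with the twist at the initial point gives an error quadratic in \<open>b - a\<close>, which is the case
  \<open>n = 0\<close>. Both \<open>normal_diff\<close> and \<open>limit_diff\<close> are additive when the segment is bisected, and two errors
  for half the length amount to half the original error.\<close>
lemma normal_diff_eventually:
  obtains D where "D \<ge> 0"
    "\<And>n a b \<sigma> \<tau> e. tangent_seq h K s \<sigma> a \<Longrightarrow> tangent_seq h K s \<tau> b \<Longrightarrow> e > 0 \<Longrightarrow>
       \<forall>\<^sub>F j in sequentially. norm (normal_diff \<sigma> \<tau> j - limit_diff a b) < D * (norm (b - a))\<^sup>2 / 2^n + e"
proof -
  obtain B where B: "B \<ge> 0" "\<And>u. norm ((1/2) *\<^sub>R twist (f s) (A u) (\<omega> u)) \<le> B * (norm u)\<^sup>2"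
    using twist_quadratic_bound by blast
  have main: "\<forall>\<^sub>F j in sequentially. norm (normal_diff \<sigma> \<tau> j - limit_diff a b) < (C + B) * (norm (b - a))\<^sup>2 / 2^n + e"
    if "tangent_seq h K s \<sigma> a" "tangent_seq h K s \<tau> b" "e > 0" for n a b \<sigma> \<tau> e
    using that
  proof (induction n arbitrary: a b \<sigma> \<tau> e)
    case 0
    note st = 0(1,2)
    let ?\<beta> = "\<lambda>j. cut (-I) (coords (f (\<sigma> j)) (f (\<tau> j) - f (\<sigma> j))) /\<^sub>R (h j)\<^sup>2"
    let ?tw = "twist (f s) (A a) (\<omega> (b - a))"
    have "\<forall>\<^sub>F j in sequentially. norm ((normal_diff \<sigma> \<tau> j - ?\<beta> j) - ?tw) < e / 2"
      using tendstoD[OF coords_tangent_tendsto(2)[OF st], of "e / 2"] 0(3) by (simp only: dist_norm half_gt_zero)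
    moreover have "\<forall>\<^sub>F j in sequentially. C * (norm ((\<tau> j - s) /\<^sub>R h j - (\<sigma> j - s) /\<^sub>R h j))\<^sup>2 < C * (norm (b - a))\<^sup>2 + e / 2"
      by (rule order_tendstoD(2)[OF local_normal_bound(2)[OF st]]) (use 0(3) in simp)
    ultimately show ?case
    proof eventually_elim
      case (elim j)
      have "?tw - limit_diff a b = - ((1/2) *\<^sub>R twist (f s) (A (b - a)) (\<omega> (b - a)))"
      proof -
        have "A a = (1/2) *\<^sub>R A (a + b) - (1/2) *\<^sub>R A (b - a)"
          by (simp add: A_simps scaleR_add_right scaleR_diff_right flip: scaleR_add_left)
        then have "?tw = (1/2) *\<^sub>R twist (f s) (A (a + b)) (\<omega> (b - a)) - (1/2) *\<^sub>R twist (f s) (A (b - a)) (\<omega> (b - a))"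
          by (simp only: twist_diff(1) twist_scale(1))
        then show ?thesis
          unfolding limit_diff_def by simp
      qed
      then have "norm (?tw - limit_diff a b) \<le> B * (norm (b - a))\<^sup>2"
        using B(2)[of "b - a"] by simp
      moreover have "normal_diff \<sigma> \<tau> j - limit_diff a b = ((normal_diff \<sigma> \<tau> j - ?\<beta> j) - ?tw) + ?\<beta> j + (?tw - limit_diff a b)"
        by simp
      then have "norm (normal_diff \<sigma> \<tau> j - limit_diff a b)
          \<le> norm ((normal_diff \<sigma> \<tau> j - ?\<beta> j) - ?tw) + norm (?\<beta> j) + norm (?tw - limit_diff a b)"
        by (metis norm_triangle_mono norm_triangle_ineq order_refl)
      moreover have "norm (?\<beta> j) < C * (norm (b - a))\<^sup>2 + e / 2"
        using local_normal_bound(1)[OF st, of j] elim(2) by linarith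
      ultimately have "norm (normal_diff \<sigma> \<tau> j - limit_diff a b) < C * (norm (b - a))\<^sup>2 + B * (norm (b - a))\<^sup>2 + e"
        using elim(1) by linarith
      then show ?case by (simp add: distrib_right)
    qed
  next
    case (Suc n)
    (* A tangent sequence for the midpoint exists, although K need not contain midpoints. *)
    let ?m = "(1/2) *\<^sub>R (a + b)"
    obtain \<mu> where \<mu>: "tangent_seq h K s \<mu> ?m" using ex_tangent by blast
    have half: "?m - a = (1/2) *\<^sub>R (b - a)" "b - ?m = (1/2) *\<^sub>R (b - a)"
      by (simp_all add: vec_eq_iff field_simps)
    have nrm: "(norm (?m - a))\<^sup>2 = (norm (b - a))\<^sup>2 / 4" "(norm (b - ?m))\<^sup>2 = (norm (b - a))\<^sup>2 / 4"
      unfolding half by (simp_all add: power_mult_distrib power2_eq_square)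
    have lim: "limit_diff a b = limit_diff a ?m + limit_diff ?m b"
    proof -
      have "limit_diff a ?m + limit_diff ?m b
          = (1/4) *\<^sub>R (twist (f s) (A (a + ?m)) (\<omega> (b - a)) + twist (f s) (A (?m + b)) (\<omega> (b - a)))"
        unfolding limit_diff_def half \<omega>_simps(3) twist_scale(2) by (simp add: scaleR_add_right)
      also have "\<dots> = (1/4) *\<^sub>R twist (f s) (A ((a + ?m) + (?m + b))) (\<omega> (b - a))"
        by (simp only: twist_add(1) A_simps(1))
      also have "(a + ?m) + (?m + b) = 2 *\<^sub>R (a + b)"
        by (simp add: vec_eq_iff field_simps)
      finally show ?thesis
        unfolding A_simps(3) twist_scale(1) limit_diff_def by simp
    qed
    have add: "normal_diff \<sigma> \<tau> j = normal_diff \<sigma> \<mu> j + normal_diff \<mu> \<tau> j" for j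
    proof -
      have "f (\<tau> j) - f (\<sigma> j) = (f (\<mu> j) - f (\<sigma> j)) + (f (\<tau> j) - f (\<mu> j))" by simp
      then show ?thesis
        unfolding normal_diff_def by (simp only: coords_add cut_add scaleR_add_right)
    qed
    have "e / 2 > 0" using Suc.prems(3) by simp
    from Suc.IH[OF Suc.prems(1) \<mu> this] Suc.IH[OF \<mu> Suc.prems(2) this]
    show ?case
    proof eventually_elim
      case (elim j)
      have "norm (normal_diff \<sigma> \<tau> j - limit_diff a b)
          \<le> norm (normal_diff \<sigma> \<mu> j - limit_diff a ?m) + norm (normal_diff \<mu> \<tau> j - limit_diff ?m b)"
        unfolding add lim by (rule norm_diff_triangle_ineq)
      also have "\<dots> < ((C + B) * ((norm (b - a))\<^sup>2 / 4) / 2^n + e / 2) + ((C + B) * ((norm (b - a))\<^sup>2 / 4) / 2^n + e / 2)"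
        using elim unfolding nrm by (rule add_strict_mono)
      also have "\<dots> = (C + B) * (norm (b - a))\<^sup>2 / 2^Suc n + e"
        by (simp add: field_simps)
      finally show ?case .
    qed
  qed
  show thesis
    by (rule that[of "C + B"]) (use B C main in auto)
qed

lemma normal_diff_tendsto:
  assumes "tangent_seq h K s \<sigma> a" "tangent_seq h K s \<tau> b"
  shows "normal_diff \<sigma> \<tau> \<longlonglongrightarrow> limit_diff a b"
proof (rule tendstoI)
  fix e :: real assume e: "e > 0"
  obtain D where D: "D \<ge> 0"
    "\<And>n a b \<sigma> \<tau> e. tangent_seq h K s \<sigma> a \<Longrightarrow> tangent_seq h K s \<tau> b \<Longrightarrow> e > 0 \<Longrightarrow>
       \<forall>\<^sub>F j in sequentially. norm (normal_diff \<sigma> \<tau> j - limit_diff a b) < D * (norm (b - a))\<^sup>2 / 2^n + e"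
    using normal_diff_eventually by blast
  have "(\<lambda>n. D * (norm (b - a))\<^sup>2 * (1/2)^n) \<longlonglongrightarrow> D * (norm (b - a))\<^sup>2 * 0"
    by (intro tendsto_mult_left LIMSEQ_power_zero) simp
  then have "\<forall>\<^sub>F n in sequentially. D * (norm (b - a))\<^sup>2 * (1/2)^n < e / 2"
    using e by (intro order_tendstoD) auto
  then obtain n where "D * (norm (b - a))\<^sup>2 * (1/2)^n < e / 2"
    by (auto simp: eventually_sequentially)
  then have n: "D * (norm (b - a))\<^sup>2 / 2^n < e / 2"
    by (simp add: power_one_over)
  have "e / 2 > 0" using e by simp
  from D(2)[OF assms this, of n] show "\<forall>\<^sub>F j in sequentially. dist (normal_diff \<sigma> \<tau> j) (limit_diff a b) < e"
    by eventually_elim (use n in \<open>unfold dist_norm, linarith\<close>)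
qed

text \<open>The limits of the normal displacements along the sides of the triangle \<open>0, a, b\<close> add up.\<close>
lemma twist_symmetric: "twist (f s) (A a) (\<omega> b) = twist (f s) (A b) (\<omega> a)"
proof -
  obtain \<sigma> \<tau> where st: "tangent_seq h K s \<sigma> a" "tangent_seq h K s \<tau> b"
    using ex_tangent by metis
  have "normal_diff (\<lambda>_. s) \<tau> j = normal_diff (\<lambda>_. s) \<sigma> j + normal_diff \<sigma> \<tau> j" for j
  proof -
    have "f (\<tau> j) - f s = (f (\<sigma> j) - f s) + (f (\<tau> j) - f (\<sigma> j))" by simp
    then show ?thesis
      unfolding normal_diff_def by (simp only: coords_add cut_add scaleR_add_right)
  qed
  then have "(\<lambda>j. normal_diff (\<lambda>_. s) \<sigma> j + normal_diff \<sigma> \<tau> j) \<longlonglongrightarrow> limit_diff 0 b"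
    using normal_diff_tendsto[OF tangent_const st(2)] by presburger
  moreover have "(\<lambda>j. normal_diff (\<lambda>_. s) \<sigma> j + normal_diff \<sigma> \<tau> j) \<longlonglongrightarrow> limit_diff 0 a + limit_diff a b"
    by (intro tendsto_add normal_diff_tendsto tangent_const st)
  ultimately have "limit_diff 0 b = limit_diff 0 a + limit_diff a b"
    by (rule LIMSEQ_unique)
  then have "2 *\<^sub>R limit_diff 0 b = 2 *\<^sub>R limit_diff 0 a + 2 *\<^sub>R limit_diff a b"
    by (simp add: scaleR_add_right)
  then have "twist (f s) (A b) (\<omega> b) = twist (f s) (A a) (\<omega> a) + twist (f s) (A (a + b)) (\<omega> (b - a))"
    by (simp add: limit_diff_def)
  then show ?thesis
    unfolding A_simps(1) \<omega>_simps(2) twist_add(1) twist_diff(2) by (simp add: algebra_simps)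
qed

lemma tangent_distance_tendsto:
  assumes st: "tangent_seq h K s \<sigma> a" "tangent_seq h K s \<tau> b"
  shows "(\<lambda>j. cut I (coords (f (\<sigma> j)) (f (\<tau> j) - f (\<sigma> j))) /\<^sub>R h j) \<longlonglongrightarrow> cut I (\<omega> (b - a))"
    and "(\<lambda>j. cut (-I) (coords (f (\<sigma> j)) (f (\<tau> j) - f (\<sigma> j))) /\<^sub>R (h j)\<^sup>2)
       \<longlonglongrightarrow> (1/2) *\<^sub>R twist (f s) (A (b - a)) (\<omega> (b - a))"
proof -
  show "(\<lambda>j. cut I (coords (f (\<sigma> j)) (f (\<tau> j) - f (\<sigma> j))) /\<^sub>R h j) \<longlonglongrightarrow> cut I (\<omega> (b - a))"
    using tendsto_cut[OF coords_tangent_tendsto(1)[OF st], of I] by (simp add: cut_scaleR)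
  have "(\<lambda>j. normal_diff \<sigma> \<tau> j - (normal_diff \<sigma> \<tau> j - cut (-I) (coords (f (\<sigma> j)) (f (\<tau> j) - f (\<sigma> j))) /\<^sub>R (h j)\<^sup>2))
      \<longlonglongrightarrow> limit_diff a b - twist (f s) (A a) (\<omega> (b - a))"
    by (intro tendsto_diff[OF normal_diff_tendsto[OF st] coords_tangent_tendsto(2)[OF st]])
  moreover have "limit_diff a b - twist (f s) (A a) (\<omega> (b - a)) = (1/2) *\<^sub>R twist (f s) (A (b - a)) (\<omega> (b - a))"
  proof -
    have "A (b - a) = A (a + b) - 2 *\<^sub>R A a"
      by (simp add: A_simps scaleR_2)
    then show ?thesis
      by (simp add: limit_diff_def twist_diff(1) twist_scale(1) scaleR_diff_right)
  qed
  ultimately show "(\<lambda>j. cut (-I) (coords (f (\<sigma> j)) (f (\<tau> j) - f (\<sigma> j))) /\<^sub>R (h j)\<^sup>2)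
       \<longlonglongrightarrow> (1/2) *\<^sub>R twist (f s) (A (b - a)) (\<omega> (b - a))"
    by simp
qed

text \<open>The normal coordinates of the displacement are of second order in \<open>h\<close>.\<close>
lemma blow_up_tangent: "cut (-I) (\<omega> u) = 0"
proof -
  obtain \<sigma> where st: "tangent_seq h K s \<sigma> u" using ex_tangent by blast
  let ?\<alpha> = "\<lambda>j. coords (f s) (f (\<sigma> j) - f s)"
  have "(\<lambda>j. h j *\<^sub>R (cut (-I) (?\<alpha> j) /\<^sub>R (h j)\<^sup>2)) \<longlonglongrightarrow> 0 *\<^sub>R ((1/2) *\<^sub>R twist (f s) (A (u - 0)) (\<omega> (u - 0)))"
    by (intro tendsto_scaleR h tangent_distance_tendsto(2)[OF tangent_const st])
  moreover have "h j *\<^sub>R (cut (-I) (?\<alpha> j) /\<^sub>R (h j)\<^sup>2) = cut (-I) (?\<alpha> j /\<^sub>R h j)" for j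
    using h(1)[of j] by (simp add: cut_scaleR power2_eq_square)
  ultimately have "(\<lambda>j. cut (-I) (?\<alpha> j /\<^sub>R h j)) \<longlonglongrightarrow> 0"
    by simp
  moreover have "(\<lambda>j. cut (-I) (?\<alpha> j /\<^sub>R h j)) \<longlonglongrightarrow> cut (-I) (\<omega> (u - 0))"
    by (intro tendsto_cut coords_tangent_tendsto(1)[OF tangent_const st])
  ultimately show ?thesis
    using LIMSEQ_unique by fastforce
qed

end

section \<open>Estimates of the Hausdorff premeasure\<close>

lemma hausdorff_premeasure_le:
  assumes "A \<subseteq> (\<Union>i. C i)" "\<And>i :: nat. C i \<subseteq> mspace m" "\<And>i. mdiam m (C i) \<le> ennreal \<delta>"
  shows "hausdorff_premeasure m k \<delta> A
    \<le> ennreal (unit_ball_vol (real k) / 2 ^ k) * (\<Sum>i. if C i = {} then 0 else mdiam m (C i) ^ k)"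
  unfolding hausdorff_premeasure_def using assms by (intro INF_lower) auto

lemma hausdorff_premeasure_mono:
  assumes "A \<subseteq> B"
  shows "hausdorff_premeasure m k \<delta> A \<le> hausdorff_premeasure m k \<delta> B"
  unfolding hausdorff_premeasure_def using assms by (intro INF_superset_mono) auto

lemma mdiam_empty [simp]: "mdiam m {} = 0"
  by (simp add: mdiam_def bot_ennreal)

lemma mdiam_le: "(\<And>x y. x \<in> A \<Longrightarrow> y \<in> A \<Longrightarrow> mdist m x y \<le> r) \<Longrightarrow> mdiam m A \<le> ennreal r"
  unfolding mdiam_def by (intro SUP_least ennreal_leI)

lemma hausdorff_premeasure_finite_cover:
  assumes J: "finite J" and cov: "A \<subseteq> (\<Union>c\<in>J. S c)" and S: "\<And>c. c \<in> J \<Longrightarrow> S c \<subseteq> mspace m"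
    and diam: "\<And>c. c \<in> J \<Longrightarrow> mdiam m (S c) \<le> ennreal r" and r: "0 \<le> r" "r \<le> \<delta>"
  shows "hausdorff_premeasure m k \<delta> A \<le> ennreal (unit_ball_vol (real k) / 2 ^ k * (real (card J) * r ^ k))"
proof -
  obtain g where g: "bij_betw g {..<card J} J"
    using ex_bij_betw_nat_finite[OF J] by (auto simp: atLeast0LessThan)
  define C where "C i = (if i < card J then S (g i) else {})" for i
  have gJ: "g i \<in> J" if "i < card J" for i
    using bij_betw_apply[OF g] that by simp
  have "A \<subseteq> (\<Union>i. C i)"
  proof
    fix x assume "x \<in> A"
    then obtain c where c: "c \<in> J" "x \<in> S c" using cov by auto
    moreover from c(1) have "c \<in> g ` {..<card J}"
      using g by (simp add: bij_betw_def)
    ultimately obtain i where "i < card J" "g i = c"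
      by blast
    then show "x \<in> (\<Union>i. C i)" using c by (auto simp: C_def)
  qed
  moreover have "C i \<subseteq> mspace m" "mdiam m (C i) \<le> ennreal \<delta>" for i
    using S[OF gJ] diam[OF gJ, of i] r by (auto simp: C_def intro: order_trans ennreal_leI)
  ultimately have "hausdorff_premeasure m k \<delta> A
    \<le> ennreal (unit_ball_vol (real k) / 2 ^ k) * (\<Sum>i. if C i = {} then 0 else mdiam m (C i) ^ k)"
    by (rule hausdorff_premeasure_le)
  also have "(\<Sum>i. if C i = {} then 0 else mdiam m (C i) ^ k) = (\<Sum>i<card J. if C i = {} then 0 else mdiam m (C i) ^ k)"
    by (rule suminf_finite) (auto simp: C_def)
  also have "\<dots> \<le> (\<Sum>i<card J. ennreal (r ^ k))"
  proof (rule sum_mono)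
    fix i assume "i \<in> {..<card J}"
    then have "mdiam m (C i) \<le> ennreal r"
      using diam[OF gJ, of i] by (simp add: C_def)
    then have "mdiam m (C i) ^ k \<le> ennreal r ^ k"
      by (rule power_mono) simp
    then show "(if C i = {} then 0 else mdiam m (C i) ^ k) \<le> ennreal (r ^ k)"
      using r by (simp add: ennreal_power)
  qed
  also have "(\<Sum>i<card J. ennreal (r ^ k)) = ennreal (real (card J) * r ^ k)"
    using r by (subst sum_ennreal) auto
  finally have "hausdorff_premeasure m k \<delta> A
      \<le> ennreal (unit_ball_vol (real k) / 2 ^ k) * ennreal (real (card J) * r ^ k)"
    by (simp add: mult_left_mono)
  also have "\<dots> = ennreal (unit_ball_vol (real k) / 2 ^ k * (real (card J) * r ^ k))"
    using r by (intro ennreal_mult[symmetric]) auto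
  finally show ?thesis .
qed

text \<open>Covers that are optimal up to \<open>e / 2\<^sup>i\<^sup>+\<^sup>1\<close> are merged by means of a pairing of the natural numbers.\<close>
lemma hausdorff_premeasure_Union:
  fixes A :: "nat \<Rightarrow> 'a set"
  shows "hausdorff_premeasure m k \<delta> (\<Union>i. A i) \<le> (\<Sum>i. hausdorff_premeasure m k \<delta> (A i))"
proof (cases "\<exists>i. hausdorff_premeasure m k \<delta> (A i) = \<infinity>")
  case True
  then obtain i where "hausdorff_premeasure m k \<delta> (A i) = \<infinity>" by blast
  then have "(\<Sum>i. hausdorff_premeasure m k \<delta> (A i)) = \<infinity>"
    using sum_le_suminf[OF summableI, of "{i}" "\<lambda>i. hausdorff_premeasure m k \<delta> (A i)"] by (auto simp: top_unique)
  then show ?thesis by simp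
next
  case False
  let ?H = "hausdorff_premeasure m k \<delta>"
  let ?v = "ennreal (unit_ball_vol (real k) / 2 ^ k)"
  let ?s = "\<lambda>S. if S = {} then 0 else mdiam m S ^ k"
  show ?thesis
  proof (rule ennreal_le_epsilon)
    fix e :: real assume e: "e > 0"
    define good where "good i C \<longleftrightarrow> A i \<subseteq> (\<Union>j. C j) \<and> (\<forall>j::nat. C j \<subseteq> mspace m \<and> mdiam m (C j) \<le> ennreal \<delta>) \<and>
        ?v * (\<Sum>j. ?s (C j)) < ?H (A i) + ennreal (e * (1/2)^Suc i)" for i C
    have "\<exists>C. good i C" for i
    proof -
      have "?H (A i) < ?H (A i) + ennreal (e * (1/2)^Suc i)"
        using False e by (simp add: ennreal_add_left_cancel_less[of _ 0, simplified] less_top[symmetric])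
      from this[unfolded hausdorff_premeasure_def INF_less_iff] show ?thesis
        by (auto simp: good_def hausdorff_premeasure_def)
    qed
    then obtain C where good: "\<And>i. good i (C i)"
      by metis
    have C: "A i \<subseteq> (\<Union>j. C i j)" "C i j \<subseteq> mspace m" "mdiam m (C i j) \<le> ennreal \<delta>"
      "?v * (\<Sum>j. ?s (C i j)) < ?H (A i) + ennreal (e * (1/2)^Suc i)" for i j
      using good[of i] unfolding good_def by blast+
    define D where "D n = (case prod_decode n of (i, j) \<Rightarrow> C i j)" for n
    have "(\<Union>i. A i) \<subseteq> (\<Union>n. D n)"
    proof
      fix x assume "x \<in> (\<Union>i. A i)"
      then obtain i j where "x \<in> C i j" using C(1) by blast
      then have "x \<in> D (prod_encode (i, j))" by (simp add: D_def)
      then show "x \<in> (\<Union>n. D n)" by blast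
    qed
    then have "?H (\<Union>i. A i) \<le> ?v * (\<Sum>n. ?s (D n))"
      by (rule hausdorff_premeasure_le) (auto simp: D_def C(3) split: prod.split intro: subsetD[OF C(2)])
    also have "(\<Sum>n. ?s (D n)) = (\<Sum>i. \<Sum>j. ?s (C i j))"
    proof -
      have "(\<Sum>n. (\<lambda>(i, j). ?s (C i j)) (prod_decode n)) = (\<Sum>i. \<Sum>j. ?s (C i j))"
        by (rule suminf_ennreal_2dimen) simp
      then show ?thesis
        by (simp add: D_def case_prod_unfold cong: if_cong)
    qed
    also have "?v * \<dots> = (\<Sum>i. ?v * (\<Sum>j. ?s (C i j)))"
      by (rule ennreal_suminf_cmult[symmetric])
    also have "\<dots> \<le> (\<Sum>i. ?H (A i) + ennreal (e * (1/2)^Suc i))"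
      by (intro suminf_le summableI less_imp_le C(4))
    also have "\<dots> = (\<Sum>i. ?H (A i)) + (\<Sum>i. ennreal (e * (1/2)^Suc i))"
      by (intro suminf_add[symmetric] summableI)
    also have "(\<Sum>i. ennreal (e * (1/2)^Suc i)) = ennreal e"
      using sums_mult[OF power_half_series, of e] e by (intro suminf_ennreal_eq) auto
    finally show "?H (\<Union>i. A i) \<le> (\<Sum>i. ?H (A i)) + ennreal e" .
  qed
qed

lemma hausdorff_premeasure_empty: "hausdorff_premeasure m k \<delta> {} = 0"
  using hausdorff_premeasure_le[of "{}" "\<lambda>_. {}" m \<delta> k] by simp

lemma hausdorff_premeasure_Un:
  "hausdorff_premeasure m k \<delta> (A \<union> B) \<le> hausdorff_premeasure m k \<delta> A + hausdorff_premeasure m k \<delta> B"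
proof -
  let ?H = "hausdorff_premeasure m k \<delta>"
  define D where "D n = (if n = 0 then A else if n = 1 then B else {})" for n :: nat
  have "A \<union> B = (\<Union>n. D n)"
    by (auto simp: D_def split: if_splits)
  then have "?H (A \<union> B) \<le> (\<Sum>n. ?H (D n))"
    using hausdorff_premeasure_Union by metis
  also have "\<dots> = (\<Sum>n<2. ?H (D n))"
    by (rule suminf_finite) (auto simp: D_def hausdorff_premeasure_empty)
  also have "\<dots> = ?H A + ?H B"
    by (simp add: D_def numeral_2_eq_2)
  finally show ?thesis .
qed

text \<open>The Vitali covering lemma selects disjoint balls in \<open>U\<close> whose fivefold enlargements cover \<open>S\<close>. The
  enlarged balls have images of small premeasure, while the volumes of the disjoint balls have sum at
  most that of \<open>U\<close>.\<close>
lemma hausdorff_premeasure_Vitali: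
  fixes f :: "'a::euclidean_space \<Rightarrow> 'b"
  assumes U: "open U" "S \<subseteq> U" and SK: "S \<subseteq> K" and M: "M \<ge> 0"
    and small: "\<And>s e. s \<in> S \<Longrightarrow> e > 0 \<Longrightarrow> \<exists>h. 0 < h \<and> h < e \<and>
       hausdorff_premeasure m k \<delta> (f ` (K \<inter> cball s (5 * h))) \<le> ennreal (M * h ^ DIM('a))"
  shows "hausdorff_premeasure m k \<delta> (f ` S) \<le> ennreal (M / unit_ball_vol (real DIM('a))) * emeasure lborel U"
proof -
  let ?H = "hausdorff_premeasure m k \<delta>"
  let ?u = "unit_ball_vol (real DIM('a))"
  have u: "?u \<noteq> 0"
    using unit_ball_vol_pos[of "real DIM('a)"] by linarith
  have "\<exists>h. 0 < h \<and> h \<le> 1 \<and> cball s h \<subseteq> U \<and> ?H (f ` (K \<inter> cball s (5 * h))) \<le> ennreal (M * h ^ DIM('a))"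
    if s: "s \<in> S" for s
  proof -
    obtain e where e: "e > 0" "cball s e \<subseteq> U"
      using open_contains_cball_eq[OF U(1)] U(2) s by (meson subsetD)
    obtain h where h: "0 < h" "h < min 1 e" "?H (f ` (K \<inter> cball s (5 * h))) \<le> ennreal (M * h ^ DIM('a))"
      using small[OF s, of "min 1 e"] e by auto
    have "cball s h \<subseteq> U"
      using subset_cball[of h e s] h e by auto
    then show ?thesis using h by auto
  qed
  then obtain h where h: "\<And>s. s \<in> S \<Longrightarrow> 0 < h s \<and> h s \<le> 1" "\<And>s. s \<in> S \<Longrightarrow> cball s (h s) \<subseteq> U"
    "\<And>s. s \<in> S \<Longrightarrow> ?H (f ` (K \<inter> cball s (5 * h s))) \<le> ennreal (M * h s ^ DIM('a))"
    by metis
  have cov: "S \<subseteq> (\<Union>i\<in>S. cball i (h i))"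
    using h(1) by force
  obtain C where C: "countable C" "C \<subseteq> S" "pairwise (\<lambda>i j. disjnt (cball i (h i)) (cball j (h j))) C"
    "S \<subseteq> (\<Union>i\<in>C. cball i (5 * h i))"
    by (rule Vitali_covering_lemma_cballs[where S = S and K = S and a = "\<lambda>i. i" and r = h and B = 1, OF cov h(1)])
      (assumption, rule that)
  let ?n = "to_nat_on C"
  define A where "A n = (if n \<in> ?n ` C then f ` (K \<inter> cball (from_nat_into C n) (5 * h (from_nat_into C n))) else {})" for n
  define B where "B n = (if n \<in> ?n ` C then cball (from_nat_into C n) (h (from_nat_into C n)) else {})" for n
  have fn: "from_nat_into C (?n c) = c" if "c \<in> C" for c
    using C(1) that by simp
  have "f ` S \<subseteq> (\<Union>n. A n)"
  proof (rule image_subsetI)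
    fix x assume x: "x \<in> S"
    then obtain c where c: "c \<in> C" "x \<in> cball c (5 * h c)" using C(4) by auto
    then have "f x \<in> A (?n c)"
      using x SK fn[OF c(1)] by (auto simp: A_def)
    then show "f x \<in> (\<Union>n. A n)" by blast
  qed
  then have "?H (f ` S) \<le> ?H (\<Union>n. A n)" by (rule hausdorff_premeasure_mono)
  also have "\<dots> \<le> (\<Sum>n. ?H (A n))" by (rule hausdorff_premeasure_Union)
  also have "\<dots> \<le> (\<Sum>n. ennreal (M / ?u) * emeasure lborel (B n))"
  proof (intro suminf_le summableI)
    fix n
    show "?H (A n) \<le> ennreal (M / ?u) * emeasure lborel (B n)"
    proof (cases "n \<in> ?n ` C")
      case True
      then obtain c where c: "c \<in> C" "n = ?n c" by auto
      then have cS: "c \<in> S" using C(2) by auto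
      have "emeasure lborel (B n) = ennreal (?u * h c ^ DIM('a))"
        using True c fn[OF c(1)] h(1)[OF cS] by (simp add: B_def emeasure_cball)
      then have "ennreal (M / ?u) * emeasure lborel (B n) = ennreal (M * h c ^ DIM('a))"
        using M h(1)[OF cS] u by (simp add: ennreal_mult[symmetric])
      then show ?thesis
        using True c fn[OF c(1)] h(3)[OF cS] by (simp add: A_def)
    qed (simp add: A_def hausdorff_premeasure_empty)
  qed
  also have "\<dots> = ennreal (M / ?u) * (\<Sum>n. emeasure lborel (B n))"
    by (rule ennreal_suminf_cmult)
  also have "(\<Sum>n. emeasure lborel (B n)) = emeasure lborel (\<Union>n. B n)"
  proof (rule suminf_emeasure)
    show "disjoint_family B"
      unfolding disjoint_family_on_def
    proof (intro ballI impI)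
      fix i j :: nat assume "i \<noteq> j"
      show "B i \<inter> B j = {}"
      proof (cases "i \<in> ?n ` C \<and> j \<in> ?n ` C")
        case True
        then obtain c c' where c: "c \<in> C" "i = ?n c" "c' \<in> C" "j = ?n c'" by auto
        then have "c \<noteq> c'" using \<open>i \<noteq> j\<close> by auto
        then have "disjnt (cball c (h c)) (cball c' (h c'))"
          using C(3) c by (auto simp: pairwise_def)
        then show ?thesis
          using c fn by (auto simp: B_def disjnt_def)
      qed (auto simp: B_def)
    qed
  qed (auto simp: B_def)
  also have "\<dots> \<le> emeasure lborel U"
  proof (rule emeasure_mono)
    show "(\<Union>n. B n) \<subseteq> U"
      using h(2) C(2) fn by (fastforce simp: B_def split: if_splits)
  qed (use U in simp)
  finally show ?thesis
    by (simp add: mult_left_mono)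
qed

section \<open>Lipschitz maps into a squeezed space with exponent two\<close>

text \<open>Squeezing is first used at the single point \<open>f s\<close>, which shows that \<open>f\<close> is continuous for the
  Euclidean topology. Then \<open>f ` K\<close> is compact and
  the constants can be chosen uniformly. Pairs of points at a distance above \<open>\<rho>\<close> satisfy the first
  two estimates because \<open>f\<close> is bounded.\<close>
lemma lipschitz_into_squeezed_2:
  fixes d :: "(real^'n::finite) metric" and f :: "'a::euclidean_space \<Rightarrow> real^'n"
  assumes sq: "squeezed 2 V W d" and sp: "mspace d = UNIV" and fr: "adapted_frame X"
    and V: "\<And>x. V x = {adapted_frame.comb X x (cut I a) | a. True}"
    and W: "\<And>x. W x = {adapted_frame.comb X x (cut (-I) a) | a. True}"
    and K: "compact K" and B: "B > 0"
    and lip: "\<And>s t. s \<in> K \<Longrightarrow> t \<in> K \<Longrightarrow> mdist d (f s) (f t) \<le> B * norm (t - s)"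
  obtains C L \<rho> where "C \<ge> 0" "L \<ge> 0" "\<rho> > 0"
    "\<And>s t. s \<in> K \<Longrightarrow> t \<in> K \<Longrightarrow> norm (f s - f t) \<le> L * norm (s - t)"
    "\<And>s t. s \<in> K \<Longrightarrow> t \<in> K \<Longrightarrow>
      norm (cut (-I) (adapted_frame.coords X (f s) (f t - f s))) \<le> C * (norm (t - s))\<^sup>2"
    "\<And>s t. s \<in> K \<Longrightarrow> t \<in> K \<Longrightarrow> norm (t - s) \<le> \<rho> \<Longrightarrow> mdist d (f s) (f t)
      \<le> C * (norm (cut I (adapted_frame.coords X (f s) (f t - f s)))
          + sqrt (norm (cut (-I) (adapted_frame.coords X (f s) (f t - f s)))))"
proof -
  interpret adapted_frame X by fact
  let ?\<alpha> = "\<lambda>s t. coords (f s) (f t - f s)"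
  have local: "\<exists>C \<rho> M. C > 0 \<and> \<rho> > 0 \<and> M > 0 \<and> (\<forall>s\<in>K. f s \<in> S \<longrightarrow> (\<forall>t\<in>K. norm (t - s) \<le> \<rho> \<longrightarrow>
      norm (cut I (?\<alpha> s t)) \<le> C * norm (t - s) \<and> norm (cut (-I) (?\<alpha> s t)) \<le> (C * norm (t - s))\<^sup>2 \<and>
      mdist d (f s) (f t) \<le> C * (norm (cut I (?\<alpha> s t)) + sqrt (norm (cut (-I) (?\<alpha> s t)))) \<and>
      norm (f t - f s) \<le> M * (norm (cut I (?\<alpha> s t)) + norm (cut (-I) (?\<alpha> s t)))))"
    if S: "compact S" for S
  proof -
    have two: "(2::real) > 0" by simp
    obtain C r where Cr: "C > 0" "r > 0"
      and lower: "\<And>x y. x \<in> S \<Longrightarrow> mdist d x y \<le> r \<Longrightarrow>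
         norm (cut I (coords x (y - x))) + norm (cut (-I) (coords x (y - x))) powr (1/2) \<le> C * mdist d x y"
      and upper: "\<And>x y. x \<in> S \<Longrightarrow> mdist d x y \<le> r \<Longrightarrow>
         mdist d x y \<le> C * (norm (cut I (coords x (y - x))) + norm (cut (-I) (coords x (y - x))) powr (1/2))"
      by (rule squeezed_coords[OF sq two sp fr V W S]) (rule that)
    obtain M where M: "M > 0" "\<And>x a. x \<in> S \<Longrightarrow> norm (comb x a) \<le> M * norm a"
      using comb_upper_bound[OF S] by blast
    define C' where "C' = max C (C * B)"
    have C': "C' \<ge> C" "C' \<ge> C * B" "C' > 0" using Cr B by (auto simp: C'_def)
    have "norm (cut I (?\<alpha> s t)) \<le> C' * norm (t - s) \<and> norm (cut (-I) (?\<alpha> s t)) \<le> (C' * norm (t - s))\<^sup>2 \<and>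
      mdist d (f s) (f t) \<le> C' * (norm (cut I (?\<alpha> s t)) + sqrt (norm (cut (-I) (?\<alpha> s t)))) \<and>
      norm (f t - f s) \<le> M * (norm (cut I (?\<alpha> s t)) + norm (cut (-I) (?\<alpha> s t)))"
      if st: "s \<in> K" "t \<in> K" "f s \<in> S" "norm (t - s) \<le> r / B" for s t
    proof -
      have md: "mdist d (f s) (f t) \<le> B * norm (t - s)" by (rule lip[OF st(1,2)])
      also have "\<dots> \<le> r" using st(4) B by (simp add: field_simps)
      finally have mr: "mdist d (f s) (f t) \<le> r" .
      have "C * mdist d (f s) (f t) \<le> C * (B * norm (t - s))"
        using md Cr by (intro mult_left_mono) auto
      also have "\<dots> \<le> C' * norm (t - s)"
        using C'(2) by (simp add: mult.assoc[symmetric] mult_right_mono)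
      finally have up: "C * mdist d (f s) (f t) \<le> C' * norm (t - s)" .
      have lo: "norm (cut I (?\<alpha> s t)) + sqrt (norm (cut (-I) (?\<alpha> s t))) \<le> C' * norm (t - s)"
        using lower[OF st(3) mr] up by (simp add: powr_half_sqrt)
      have sq0: "sqrt (norm (cut (-I) (?\<alpha> s t))) \<ge> 0" by simp
      have 1: "norm (cut I (?\<alpha> s t)) \<le> C' * norm (t - s)" and 2: "sqrt (norm (cut (-I) (?\<alpha> s t))) \<le> C' * norm (t - s)"
        using lo sq0 norm_ge_zero[of "cut I (?\<alpha> s t)"] by linarith+
      have 3: "norm (cut (-I) (?\<alpha> s t)) \<le> (C' * norm (t - s))\<^sup>2"
        using power_mono[OF 2 sq0, of 2] by simp
      have "mdist d (f s) (f t) \<le> C * (norm (cut I (?\<alpha> s t)) + sqrt (norm (cut (-I) (?\<alpha> s t))))"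
        using upper[OF st(3) mr] by (simp add: powr_half_sqrt)
      also have "\<dots> \<le> C' * (norm (cut I (?\<alpha> s t)) + sqrt (norm (cut (-I) (?\<alpha> s t))))"
        using C'(1) by (intro mult_right_mono) auto
      finally have 4: "mdist d (f s) (f t) \<le> C' * (norm (cut I (?\<alpha> s t)) + sqrt (norm (cut (-I) (?\<alpha> s t))))" .
      have "norm (f t - f s) \<le> M * norm (?\<alpha> s t)"
        using M(2)[OF st(3), of "?\<alpha> s t"] by simp
      also have "\<dots> \<le> M * (norm (cut I (?\<alpha> s t)) + norm (cut (-I) (?\<alpha> s t)))"
        using M(1) norm_le_cut[of "?\<alpha> s t" I] by (intro mult_left_mono) auto
      finally show ?thesis using 1 3 4 by blast
    qed
    then show ?thesis
      using C'(3) M(1) Cr(2) B by (intro exI[of _ C'] exI[of _ "r / B"] exI[of _ M]) auto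
  qed
  have cont: "continuous_on K f"
    unfolding continuous_on_def
  proof
    fix s assume s: "s \<in> K"
    obtain C \<rho> M where C: "C > 0" "\<rho> > 0" "M > 0"
      and est: "\<And>t. t \<in> K \<Longrightarrow> norm (t - s) \<le> \<rho> \<Longrightarrow>
      norm (cut I (?\<alpha> s t)) \<le> C * norm (t - s) \<and> norm (cut (-I) (?\<alpha> s t)) \<le> (C * norm (t - s))\<^sup>2 \<and>
      norm (f t - f s) \<le> M * (norm (cut I (?\<alpha> s t)) + norm (cut (-I) (?\<alpha> s t)))"
      using local[of "{f s}"] s by auto
    have "((\<lambda>t. f t - f s) \<longlongrightarrow> 0) (at s within K)"
    proof (rule Lim_null_comparison)
      have "\<forall>\<^sub>F t in at s within K. dist t s < \<rho>"
        using C(2) by (auto simp: eventually_at)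
      moreover have "\<forall>\<^sub>F t in at s within K. t \<in> K"
        by (simp add: eventually_at_filter)
      ultimately show "\<forall>\<^sub>F t in at s within K. norm (f t - f s) \<le> M * (C * norm (t - s) + (C * norm (t - s))\<^sup>2)"
      proof eventually_elim
        case (elim t)
        then have e: "norm (cut I (?\<alpha> s t)) + norm (cut (-I) (?\<alpha> s t)) \<le> C * norm (t - s) + (C * norm (t - s))\<^sup>2"
          and e': "norm (f t - f s) \<le> M * (norm (cut I (?\<alpha> s t)) + norm (cut (-I) (?\<alpha> s t)))"
          using est[of t] by (auto simp: dist_norm intro!: add_mono)
        show ?case
          using mult_left_mono[OF e, of M] e' C(3) by linarith
      qed
      have "((\<lambda>t. M * (C * norm (t - s) + (C * norm (t - s))\<^sup>2)) \<longlongrightarrow> M * (C * norm (s - s) + (C * norm (s - s))\<^sup>2)) (at s within K)"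
        by (intro tendsto_intros)
      then show "((\<lambda>t. M * (C * norm (t - s) + (C * norm (t - s))\<^sup>2)) \<longlongrightarrow> 0) (at s within K)" by simp
    qed
    then show "(f \<longlongrightarrow> f s) (at s within K)"
      by (rule LIM_zero_cancel)
  qed
  have cfK: "compact (f ` K)"
    by (rule compact_continuous_image[OF cont K])
  obtain C \<rho> M where C: "C > 0" "\<rho> > 0" "M > 0"
      and est: "\<And>s t. s \<in> K \<Longrightarrow> t \<in> K \<Longrightarrow> norm (t - s) \<le> \<rho> \<Longrightarrow>
      norm (cut I (?\<alpha> s t)) \<le> C * norm (t - s) \<and> norm (cut (-I) (?\<alpha> s t)) \<le> (C * norm (t - s))\<^sup>2 \<and>
      mdist d (f s) (f t) \<le> C * (norm (cut I (?\<alpha> s t)) + sqrt (norm (cut (-I) (?\<alpha> s t)))) \<and>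
      norm (f t - f s) \<le> M * (norm (cut I (?\<alpha> s t)) + norm (cut (-I) (?\<alpha> s t)))"
    using local[OF cfK] by (metis imageI)
  obtain b where b: "b > 0" "\<And>s. s \<in> K \<Longrightarrow> norm (f s) \<le> b"
    using compact_imp_bounded[OF cfK] by (auto simp: bounded_pos)
  obtain c0 where c0: "c0 > 0" "\<And>x a. x \<in> f ` K \<Longrightarrow> c0 * norm a \<le> norm (comb x a)"
    using comb_lower_bound[OF cfK] by blast
  have far: "norm (f t - f s) \<le> 2 * b" if "s \<in> K" "t \<in> K" for s t
    using norm_triangle_ineq4[of "f t" "f s"] b(2)[OF that(1)] b(2)[OF that(2)] by linarith
  define L where "L = max (M * (C + C\<^sup>2 * \<rho>)) (2 * b / \<rho>)"
  define C' where "C' = max C (max (C\<^sup>2) (2 * b / c0 / \<rho>\<^sup>2))"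
  show thesis
  proof (rule that[of C' L \<rho>])
    show "C' \<ge> 0" "L \<ge> 0" "\<rho> > 0"
      using C b by (auto simp: C'_def L_def le_max_iff_disj)
  next
    fix s t assume st: "s \<in> K" "t \<in> K"
    show "norm (f s - f t) \<le> L * norm (s - t)"
    proof (cases "norm (t - s) \<le> \<rho>")
      case True
      have "(C * norm (t - s))\<^sup>2 \<le> C\<^sup>2 * \<rho> * norm (t - s)"
      proof -
        have "(C * norm (t - s))\<^sup>2 = C\<^sup>2 * norm (t - s) * norm (t - s)"
          by (simp add: power2_eq_square mult_ac)
        also have "\<dots> \<le> C\<^sup>2 * \<rho> * norm (t - s)"
          using True by (intro mult_right_mono mult_left_mono) auto
        finally show ?thesis .
      qed
      then have "norm (cut I (?\<alpha> s t)) + norm (cut (-I) (?\<alpha> s t)) \<le> (C + C\<^sup>2 * \<rho>) * norm (t - s)"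
        using est[OF st True] by (simp add: distrib_right)
      then have "M * (norm (cut I (?\<alpha> s t)) + norm (cut (-I) (?\<alpha> s t))) \<le> M * ((C + C\<^sup>2 * \<rho>) * norm (t - s))"
        using C(3) by (intro mult_left_mono) auto
      also have "\<dots> \<le> L * norm (t - s)"
        unfolding mult.assoc[symmetric] by (intro mult_right_mono) (auto simp: L_def)
      finally show ?thesis
        using est[OF st True] by (simp add: norm_minus_commute)
    next
      case False
      then have "2 * b \<le> 2 * b / \<rho> * norm (t - s)"
        using C(2) b(1) by (simp add: field_simps)
      also have "\<dots> \<le> L * norm (t - s)"
        by (intro mult_right_mono) (auto simp: L_def)
      finally show ?thesis
        using far[OF st] by (simp add: norm_minus_commute)
    qed
    show "norm (cut (-I) (?\<alpha> s t)) \<le> C' * (norm (t - s))\<^sup>2"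
    proof (cases "norm (t - s) \<le> \<rho>")
      case True
      then have "norm (cut (-I) (?\<alpha> s t)) \<le> C\<^sup>2 * (norm (t - s))\<^sup>2"
        using est[OF st] by (simp add: power_mult_distrib)
      also have "\<dots> \<le> C' * (norm (t - s))\<^sup>2"
        by (intro mult_right_mono) (auto simp: C'_def)
      finally show ?thesis .
    next
      case False
      have "c0 * norm (?\<alpha> s t) \<le> 2 * b"
        using c0(2)[of "f s" "?\<alpha> s t"] far[OF st] st by simp
      then have "norm (?\<alpha> s t) \<le> 2 * b / c0"
        using c0(1) by (simp add: field_simps)
      also have "\<dots> \<le> 2 * b / c0 / \<rho>\<^sup>2 * (norm (t - s))\<^sup>2"
      proof -
        have "\<rho>\<^sup>2 \<le> (norm (t - s))\<^sup>2"
          using False C(2) by (intro power_mono) auto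
        then have "2 * b / c0 / \<rho>\<^sup>2 * \<rho>\<^sup>2 \<le> 2 * b / c0 / \<rho>\<^sup>2 * (norm (t - s))\<^sup>2"
          using b(1) c0(1) by (intro mult_left_mono) auto
        then show ?thesis using C(2) by simp
      qed
      also have "\<dots> \<le> C' * (norm (t - s))\<^sup>2"
        by (intro mult_right_mono) (auto simp: C'_def)
      finally show ?thesis
        using norm_cut_le[of "-I" "?\<alpha> s t"] by linarith
    qed
    assume "norm (t - s) \<le> \<rho>"
    then have "mdist d (f s) (f t) \<le> C * (norm (cut I (?\<alpha> s t)) + sqrt (norm (cut (-I) (?\<alpha> s t))))"
      using est[OF st] by blast
    also have "\<dots> \<le> C' * (norm (cut I (?\<alpha> s t)) + sqrt (norm (cut (-I) (?\<alpha> s t))))"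
      by (intro mult_right_mono) (auto simp: C'_def)
    finally show "mdist d (f s) (f t) \<le> C' * (norm (cut I (?\<alpha> s t)) + sqrt (norm (cut (-I) (?\<alpha> s t))))" .
  qed
qed

text \<open>Statements about tangent sequences for the whole sequence of scales apply to subsequences, because a
  sequence given along a subsequence can be completed.\<close>
lemma tangent_seq_interleave:
  assumes \<sigma>0: "tangent_seq h K s \<sigma>0 a" and \<phi>: "strict_mono \<phi>"
    and P: "\<And>n. P n \<in> K" "(\<lambda>n. (P n - s) /\<^sub>R h (\<phi> n)) \<longlonglongrightarrow> a"
  obtains \<sigma> where "tangent_seq h K s \<sigma> a" "\<And>n. \<sigma> (\<phi> n) = P n"
proof -
  define \<sigma> where "\<sigma> m = (if m \<in> range \<phi> then P (inv \<phi> m) else \<sigma>0 m)" for m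
  have inj: "inj \<phi>" using \<phi> by (rule strict_mono_imp_inj_on)
  have \<sigma>\<phi>: "\<sigma> (\<phi> n) = P n" for n
    using inj by (simp add: \<sigma>_def)
  have "(\<lambda>j. (\<sigma> j - s) /\<^sub>R h j) \<longlonglongrightarrow> a"
  proof (rule LIMSEQ_I)
    fix e :: real assume e: "e > 0"
    obtain N1 where N1: "\<And>n. n \<ge> N1 \<Longrightarrow> norm ((P n - s) /\<^sub>R h (\<phi> n) - a) < e"
      using LIMSEQ_D[OF P(2) e] by blast
    obtain N2 where N2: "\<And>m. m \<ge> N2 \<Longrightarrow> norm ((\<sigma>0 m - s) /\<^sub>R h m - a) < e"
      using \<sigma>0 LIMSEQ_D[of "\<lambda>j. (\<sigma>0 j - s) /\<^sub>R h j" a e] e by (auto simp: tangent_seq_def)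
    have "norm ((\<sigma> m - s) /\<^sub>R h m - a) < e" if m: "m \<ge> max N2 (\<phi> N1)" for m
    proof (cases "m \<in> range \<phi>")
      case True
      then obtain n where n: "m = \<phi> n" by auto
      then have "n \<ge> N1"
        using m strict_mono_less_eq[OF \<phi>, of N1 n] by simp
      then show ?thesis
        using N1 by (simp add: n \<sigma>\<phi>)
    next
      case False
      then show ?thesis using N2 m by (simp add: \<sigma>_def)
    qed
    then show "\<exists>N. \<forall>m\<ge>N. norm ((\<sigma> m - s) /\<^sub>R h m - a) < e" by blast
  qed
  moreover have "\<sigma> m \<in> K" for m
    using \<sigma>0 P(1) by (simp add: \<sigma>_def tangent_seq_def)
  ultimately have "tangent_seq h K s \<sigma> a"
    by (simp add: tangent_seq_def)
  then show thesis
    using \<sigma>\<phi> by (rule that)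
qed

context horizontal_blow_up
begin

text \<open>If \<open>A\<close> were injective, its image would have the dimension of \<open>V(f(s))\<close> and so contain the values at
  \<open>f s\<close> of both fields. The normal part of their bracket is the antisymmetric part of the twist at these
  values, which vanishes by \<open>twist_symmetric\<close>.\<close>
lemma blow_up_not_inj:
  assumes dim: "dim {v. cut (-I) (coords (f s) v) = 0} = CARD('k)"
    and Z: "Z differentiable (at (f s))" "\<And>y. cut (-I) (coords y (Z y)) = 0"
    and Z': "Z' differentiable (at (f s))" "\<And>y. cut (-I) (coords y (Z' y)) = 0"
    and bracket: "cut (-I) (coords (f s) (lie_bracket Z Z' (f s))) \<noteq> 0"
  shows "\<not> inj A"
proof
  assume inj: "inj A"
  let ?V = "{v. cut (-I) (coords (f s) v) = 0}"
  have sub: "subspace ?V"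
    by (auto simp: subspace_def coords_add coords_scaleR cut_add cut_scaleR)
  have "dim (range A) = CARD('k)"
    using dim_image_eq[OF A, of UNIV] inj by (simp add: dim_UNIV)
  moreover have "range A \<subseteq> ?V"
    using blow_up_tangent by (auto simp: \<omega>_def)
  moreover have "subspace (range A)"
    by (intro linear_subspace_image A subspace_UNIV)
  ultimately have range: "range A = ?V"
    using sub dim by (intro subspace_dim_equal) auto
  have "Z (f s) \<in> range A" "Z' (f s) \<in> range A"
    unfolding range using Z(2) Z'(2) by auto
  then obtain a b where ab: "Z (f s) = A a" "Z' (f s) = A b" by auto
  have "cut (-I) (coords (f s) (lie_bracket Z Z' (f s)))
      = twist (f s) (Z (f s)) (coords (f s) (Z' (f s))) - twist (f s) (Z' (f s)) (coords (f s) (Z (f s)))"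
    unfolding lie_bracket_def coords_diff cut_diff derivative_of_tangent_field[OF Z] derivative_of_tangent_field[OF Z'] ..
  also have "\<dots> = 0"
    unfolding ab using twist_symmetric[of a b] by (simp add: \<omega>_def)
  finally show False using bracket by simp
qed

text \<open>Along tangent sequences for \<open>a\<close> and \<open>b\<close> the normal part of the displacement, divided by \<open>h\<^sup>2\<close>, tends
  to half the twist of \<open>A (b - a)\<close> with itself (\<open>tangent_distance_tendsto\<close>), so its root is bounded by
  a multiple of \<open>\<bar>A (b - a)\<bar>\<close>. Uniformity follows by compactness: points that violate the
  estimate at infinitely many scales have rescalings that converge along a subsequence.\<close>
lemma blow_up_distance:
  fixes d :: "(real^'n) metric"
  assumes "\<rho> > 0" "C' \<ge> 0"
    and upper: "\<And>s t. s \<in> K \<Longrightarrow> t \<in> K \<Longrightarrow> norm (t - s) \<le> \<rho> \<Longrightarrow> mdist d (f s) (f t)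
      \<le> C' * (norm (cut I (coords (f s) (f t - f s))) + sqrt (norm (cut (-I) (coords (f s) (f t - f s)))))"
  obtains c where "c \<ge> 0"
    "\<And>R e. e > 0 \<Longrightarrow> \<forall>\<^sub>F j in sequentially. \<forall>\<sigma>\<in>K \<inter> cball s (R * h j). \<forall>\<tau>\<in>K \<inter> cball s (R * h j).
      mdist d (f \<sigma>) (f \<tau>) \<le> c * norm (A (\<tau> - \<sigma>)) + e * h j"
proof -
  define Q where "Q w = C' * (norm (cut I (coords (f s) w)) + sqrt (norm ((1/2) *\<^sub>R twist (f s) w (coords (f s) w))))" for w
  obtain B where B: "B \<ge> 0" "\<And>v a. norm (twist (f s) v a) \<le> B * norm v * norm a"
    using twist_bound by blast
  obtain M where M: "M > 0" "\<And>v. norm (coords (f s) v) \<le> M * norm v"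
    using linear_bounded_pos[OF linear_coords] by blast
  define c where "c = C' * (M + sqrt (B * M))"
  have c: "c \<ge> 0" using assms(2) B M by (simp add: c_def)
  have Q: "Q w \<le> c * norm w" for w
  proof -
    have "norm ((1/2) *\<^sub>R twist (f s) w (coords (f s) w)) \<le> norm (twist (f s) w (coords (f s) w))"
      by simp
    also have "\<dots> \<le> B * norm w * norm (coords (f s) w)"
      by (rule B(2))
    also have "\<dots> \<le> B * norm w * (M * norm w)"
      using B M by (intro mult_left_mono) auto
    also have "\<dots> = B * M * (norm w)\<^sup>2" by (simp add: power2_eq_square)
    finally have "sqrt (norm ((1/2) *\<^sub>R twist (f s) w (coords (f s) w))) \<le> sqrt (B * M * (norm w)\<^sup>2)"
      by (rule real_sqrt_le_mono)
    also have "\<dots> = sqrt (B * M) * norm w"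
      by (simp add: real_sqrt_mult)
    finally have 1: "sqrt (norm ((1/2) *\<^sub>R twist (f s) w (coords (f s) w))) \<le> sqrt (B * M) * norm w" .
    have 2: "norm (cut I (coords (f s) w)) \<le> M * norm w"
      using M(2)[of w] norm_cut_le[of I "coords (f s) w"] by linarith
    show ?thesis
      unfolding Q_def c_def using 1 2 assms(2) by (simp add: mult.assoc distrib_right mult_left_mono)
  qed
  have seq: "\<forall>\<^sub>F j in sequentially. mdist d (f (\<sigma> j)) (f (\<tau> j)) \<le> c * norm (A (\<tau> j - \<sigma> j)) + e * h j"
    if st: "tangent_seq h K s \<sigma> a" "tangent_seq h K s \<tau> b" and e: "e > 0" for \<sigma> \<tau> a b e
  proof -
    let ?\<alpha> = "\<lambda>j. coords (f (\<sigma> j)) (f (\<tau> j) - f (\<sigma> j))"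
    have diff: "(\<lambda>j. (\<tau> j - \<sigma> j) /\<^sub>R h j) \<longlonglongrightarrow> b - a"
    proof -
      have "(\<lambda>j. (\<tau> j - s) /\<^sub>R h j - (\<sigma> j - s) /\<^sub>R h j) \<longlonglongrightarrow> b - a"
        using st by (intro tendsto_diff) (auto simp: tangent_seq_def)
      then show ?thesis by (simp add: scaleR_diff_right)
    qed
    have "(\<lambda>j. h j *\<^sub>R ((\<tau> j - \<sigma> j) /\<^sub>R h j)) \<longlonglongrightarrow> 0 *\<^sub>R (b - a)"
      by (intro tendsto_scaleR h diff)
    moreover have "h j *\<^sub>R ((\<tau> j - \<sigma> j) /\<^sub>R h j) = \<tau> j - \<sigma> j" for j
      using h(1)[of j] by simp
    ultimately have "(\<lambda>j. norm (\<tau> j - \<sigma> j)) \<longlonglongrightarrow> 0"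
      by (simp add: tendsto_norm_zero)
    then have ev1: "\<forall>\<^sub>F j in sequentially. norm (\<tau> j - \<sigma> j) < \<rho>"
      using assms(1) by (rule order_tendstoD)
    have lim: "(\<lambda>j. C' * (norm (cut I (?\<alpha> j) /\<^sub>R h j) + sqrt (norm (cut (-I) (?\<alpha> j) /\<^sub>R (h j)\<^sup>2)))) \<longlonglongrightarrow> Q (A (b - a))"
    proof -
      have "cut I (\<omega> (b - a)) = cut I (coords (f s) (A (b - a)))" by (simp add: \<omega>_def)
      then show ?thesis
        unfolding Q_def \<omega>_def[symmetric]
        by (intro tendsto_intros tangent_distance_tendsto[OF st])
    qed
    have linA: "bounded_linear A" using A linear_conv_bounded_linear by blast
    have lim2: "(\<lambda>j. c * norm (A ((\<tau> j - \<sigma> j) /\<^sub>R h j)) + e) \<longlonglongrightarrow> c * norm (A (b - a)) + e"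
      by (intro tendsto_intros bounded_linear.tendsto[OF linA] diff)
    have "Q (A (b - a)) < c * norm (A (b - a)) + e"
      using Q[of "A (b - a)"] e by linarith
    then obtain m where m: "Q (A (b - a)) < m" "m < c * norm (A (b - a)) + e"
      using dense by blast
    from order_tendstoD(2)[OF lim m(1)] order_tendstoD(1)[OF lim2 m(2)] ev1
    show ?thesis
    proof eventually_elim
      case (elim j)
      have "mdist d (f (\<sigma> j)) (f (\<tau> j)) \<le> C' * (norm (cut I (?\<alpha> j)) + sqrt (norm (cut (-I) (?\<alpha> j))))"
        using st elim(3) by (intro upper) (auto simp: tangent_seq_def)
      also have "\<dots> = h j * (C' * (norm (cut I (?\<alpha> j) /\<^sub>R h j) + sqrt (norm (cut (-I) (?\<alpha> j) /\<^sub>R (h j)\<^sup>2))))"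
      proof -
        have "sqrt (norm (cut (-I) (?\<alpha> j) /\<^sub>R (h j)\<^sup>2)) = sqrt (norm (cut (-I) (?\<alpha> j))) / h j"
          using h(1)[of j] by (simp add: real_sqrt_mult real_sqrt_inverse divide_inverse)
        moreover have "norm (cut I (?\<alpha> j) /\<^sub>R h j) = norm (cut I (?\<alpha> j)) / h j"
          using h(1)[of j] by (simp add: divide_inverse)
        ultimately show ?thesis
          using h(1)[of j] by (simp add: field_simps)
      qed
      also have "\<dots> \<le> h j * (c * norm (A ((\<tau> j - \<sigma> j) /\<^sub>R h j)) + e)"
        using elim(1,2) h(1)[of j] by (intro mult_left_mono) auto
      also have "\<dots> = c * norm (A (\<tau> j - \<sigma> j)) + e * h j"
      proof -
        have "norm (A ((\<tau> j - \<sigma> j) /\<^sub>R h j)) = norm (A (\<tau> j - \<sigma> j)) / h j"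
          using h(1)[of j] by (simp only: A_simps(3) norm_scaleR) (simp add: divide_inverse)
        then show ?thesis
          using h(1)[of j] by (simp add: distrib_left)
      qed
      finally show ?case .
    qed
  qed
  have "\<forall>\<^sub>F j in sequentially. \<forall>\<sigma>\<in>K \<inter> cball s (R * h j). \<forall>\<tau>\<in>K \<inter> cball s (R * h j).
      mdist d (f \<sigma>) (f \<tau>) \<le> c * norm (A (\<tau> - \<sigma>)) + e * h j" (is "eventually ?P _") if e: "e > 0" for R e
  proof (rule ccontr)
    assume "\<not> eventually ?P sequentially"
    define S where "S = {j. \<not> ?P j}"
    have "infinite S"
      using \<open>\<not> eventually ?P sequentially\<close>
      unfolding S_def cofinite_eq_sequentially[symmetric] eventually_cofinite .
    from infinite_enumerate[OF this] obtain \<phi> :: "nat \<Rightarrow> nat" where \<phi>: "strict_mono \<phi>" "\<And>n. \<phi> n \<in> S"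
      by blast
    define bad where "bad n p q \<longleftrightarrow> p \<in> K \<inter> cball s (R * h (\<phi> n)) \<and> q \<in> K \<inter> cball s (R * h (\<phi> n)) \<and>
        \<not> mdist d (f p) (f q) \<le> c * norm (A (q - p)) + e * h (\<phi> n)" for n p q
    have "\<exists>p q. bad n p q" for n
      using \<phi>(2)[of n] unfolding bad_def S_def by blast
    then obtain p q where bad: "\<And>n. bad n (p n) (q n)"
      by metis
    have pq: "p n \<in> K \<inter> cball s (R * h (\<phi> n))" "q n \<in> K \<inter> cball s (R * h (\<phi> n))"
      "\<not> mdist d (f (p n)) (f (q n)) \<le> c * norm (A (q n - p n)) + e * h (\<phi> n)" for n
      using bad[of n] unfolding bad_def by blast+
    have in_ball: "(x - s) /\<^sub>R h j \<in> cball 0 R" if x: "x \<in> K \<inter> cball s (R * h j)" for x j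
    proof -
      have "norm ((x - s) /\<^sub>R h j) = norm (x - s) / h j"
        using h(1)[of j] by (simp only: norm_scaleR) (simp add: divide_inverse)
      also have "\<dots> \<le> R"
        using x h(1)[of j] by (simp add: dist_norm norm_minus_commute pos_divide_le_eq)
      finally show ?thesis by simp
    qed
    have "\<forall>n. ((p n - s) /\<^sub>R h (\<phi> n), (q n - s) /\<^sub>R h (\<phi> n)) \<in> cball 0 R \<times> cball 0 R"
      using in_ball pq(1,2) by blast
    moreover have "compact (cball (0::real^'k) R \<times> cball (0::real^'k) R)"
      by (intro compact_Times compact_cball)
    ultimately obtain l r where r: "strict_mono r"
      "((\<lambda>n. ((p n - s) /\<^sub>R h (\<phi> n), (q n - s) /\<^sub>R h (\<phi> n))) \<circ> r) \<longlonglongrightarrow> l"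
      unfolding compact_def by meson
    define \<psi> where "\<psi> = \<phi> \<circ> r"
    have \<psi>: "strict_mono \<psi>" unfolding \<psi>_def using \<phi>(1) r(1) by (rule strict_mono_o)
    have l1: "(\<lambda>n. (p (r n) - s) /\<^sub>R h (\<psi> n)) \<longlonglongrightarrow> fst l"
      and l2: "(\<lambda>n. (q (r n) - s) /\<^sub>R h (\<psi> n)) \<longlonglongrightarrow> snd l"
      using tendsto_fst[OF r(2)] tendsto_snd[OF r(2)] by (simp_all add: o_def \<psi>_def)
    obtain \<sigma>0 \<tau>0 where "tangent_seq h K s \<sigma>0 (fst l)" "tangent_seq h K s \<tau>0 (snd l)"
      using ex_tangent by metis
    then obtain \<sigma> \<tau> where st: "tangent_seq h K s \<sigma> (fst l)" "tangent_seq h K s \<tau> (snd l)"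
      and eq: "\<And>n. \<sigma> (\<psi> n) = p (r n)" "\<And>n. \<tau> (\<psi> n) = q (r n)"
      using tangent_seq_interleave[OF _ \<psi> _ l1] tangent_seq_interleave[OF _ \<psi> _ l2] pq(1,2) by (metis IntD1)
    obtain N where N: "\<And>j. j \<ge> N \<Longrightarrow> mdist d (f (\<sigma> j)) (f (\<tau> j)) \<le> c * norm (A (\<tau> j - \<sigma> j)) + e * h j"
      using seq[OF st e] by (auto simp: eventually_sequentially)
    have "\<psi> N \<ge> N" using \<psi> by (rule strict_mono_imp_increasing)
    from N[OF this] show False
      using pq(3)[of "r N"] by (simp add: eq \<psi>_def[symmetric]) (simp add: \<psi>_def)
  qed
  then show thesis using that c by blast
qed

end

section \<open>Degenerate blow-ups and pure unrectifiability\<close>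

context horizontal_blow_up
begin

text \<open>Let \<open>A E = 0\<close> with \<open>E\<^sub>i\<^sub>0 = 1\<close>. The rescaled ball is projected along \<open>E\<close> onto the hyperplane
  \<open>u\<^sub>i\<^sub>0 = 0\<close>, and points are grouped according to the cell of mesh \<open>1/N\<close> of their projection. There
  are \<open>O(N\<^sup>k\<^sup>-\<^sup>1)\<close> cells, and in each of them \<open>A\<close> varies by \<open>O(1/N)\<close>.\<close>
lemma blow_up_small_premeasure:
  fixes d :: "(real^'n) metric"
  assumes sp: "mspace d = UNIV" and "\<rho> > 0" "C' \<ge> 0"
    and upper: "\<And>s t. s \<in> K \<Longrightarrow> t \<in> K \<Longrightarrow> norm (t - s) \<le> \<rho> \<Longrightarrow> mdist d (f s) (f t)
      \<le> C' * (norm (cut I (coords (f s) (f t - f s))) + sqrt (norm (cut (-I) (coords (f s) (f t - f s)))))"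
    and not_inj: "\<not> inj A" and \<delta>: "\<delta> > 0" and e: "e > 0" and R: "R \<ge> 0"
  shows "\<forall>\<^sub>F j in sequentially. hausdorff_premeasure d CARD('k) \<delta> (f ` (K \<inter> cball s (R * h j)))
      \<le> ennreal (e * h j ^ CARD('k))"
proof -
  let ?k = "CARD('k)"
  obtain e0 where e0: "A e0 = 0" "e0 \<noteq> 0"
    using not_inj linear_injective_0[OF A] by blast
  then obtain i0 where i0: "e0 $ i0 \<noteq> 0" by (auto simp: vec_eq_iff)
  define E where "E = e0 /\<^sub>R (e0 $ i0)"
  have E: "A E = 0" "E $ i0 = 1"
    using e0 i0 by (simp_all add: E_def A_simps)
  obtain c where c: "c \<ge> 0"
    "\<And>R e. e > 0 \<Longrightarrow> \<forall>\<^sub>F j in sequentially. \<forall>\<sigma>\<in>K \<inter> cball s (R * h j). \<forall>\<tau>\<in>K \<inter> cball s (R * h j).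
      mdist d (f \<sigma>) (f \<tau>) \<le> c * norm (A (\<tau> - \<sigma>)) + e * h j"
    using blow_up_distance[OF assms(2,3) upper] by blast
  obtain MA where MA: "MA > 0" "\<And>u. norm (A u) \<le> MA * norm u"
    using linear_bounded_pos[OF A] by blast
  (* Every group of points has an image of diameter at most M h / N. *)
  define M where "M = c * MA * real ?k + 1"
  have M: "M > 0" using c MA by (simp add: M_def add_nonneg_pos)
  obtain P :: nat where P: "R + R * norm E \<le> real P"
    using real_arch_simple by blast
  define v where "v = unit_ball_vol (real ?k) / 2 ^ ?k"
  have v: "v \<ge> 0" by (simp add: v_def)
  obtain N0 :: nat where N0: "v * (2 * real P + 1) ^ (?k - 1) * M ^ ?k / e \<le> real N0"
    using real_arch_simple by blast
  define N where "N = Suc N0"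
  have N: "N \<ge> 1" "v * (2 * real P + 1) ^ (?k - 1) * M ^ ?k / e \<le> real N"
    using N0 by (auto simp: N_def)
  define J where "J = PiE (UNIV - {i0}) (\<lambda>_. {- int (P * N)..int (P * N)})"
  have J: "finite J" unfolding J_def by (intro finite_PiE) auto
  have card_J: "real (card J) \<le> ((2 * real P + 1) * real N) ^ (?k - 1)"
  proof -
    have "card J = (2 * P * N + 1) ^ (?k - 1)"
      unfolding J_def by (subst card_PiE) (auto simp: card_Diff_singleton nat_add_distrib nat_mult_distrib algebra_simps)
    then have "real (card J) = (2 * real P * real N + 1) ^ (?k - 1)" by (simp add: add.commute)
    also have "\<dots> \<le> ((2 * real P + 1) * real N) ^ (?k - 1)"
      using N(1) by (intro power_mono) (auto simp: distrib_right)
    finally show ?thesis .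
  qed
  have invN: "1 / real N > 0" using N(1) by simp
  have "\<forall>\<^sub>F j in sequentially. h j < \<delta> / M"
    using h(2) \<delta> M by (intro order_tendstoD) auto
  with c(2)[OF invN, of R] show ?thesis
  proof eventually_elim
    case (elim j)
    have hj: "h j > 0" by (rule h(1))
    define r where "r = M * h j / real N"
    have r: "0 \<le> r" "r \<le> \<delta>"
    proof -
      show "0 \<le> r" using M hj by (simp add: r_def)
      have "M * h j / real N \<le> M * h j"
        using N(1) M hj divide_left_mono[of 1 "real N" "M * h j"] by simp
      also have "\<dots> \<le> \<delta>" using elim(2) M by (simp add: field_simps)
      finally show "r \<le> \<delta>" by (simp add: r_def)
    qed
    define w where "w \<sigma> = (\<sigma> - s) /\<^sub>R h j" for \<sigma>
    define p where "p \<sigma> = w \<sigma> - w \<sigma> $ i0 *\<^sub>R E" for \<sigma>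
    define cell where "cell \<sigma> = restrict (\<lambda>l. \<lfloor>real N * p \<sigma> $ l\<rfloor>) (UNIV - {i0})" for \<sigma>
    define S where "S z = f ` {\<sigma> \<in> K \<inter> cball s (R * h j). cell \<sigma> = z}" for z
    have cell_J: "cell \<sigma> \<in> J" if \<sigma>: "\<sigma> \<in> K \<inter> cball s (R * h j)" for \<sigma>
    proof -
      have "norm (w \<sigma>) = norm (\<sigma> - s) / h j"
        using hj unfolding w_def by (simp only: norm_scaleR) (simp add: divide_inverse)
      also have "\<dots> \<le> R"
        using \<sigma> hj by (simp add: dist_norm norm_minus_commute pos_divide_le_eq)
      finally have wR: "norm (w \<sigma>) \<le> R" .
      have "\<bar>p \<sigma> $ l\<bar> \<le> real P" for l
      proof -
        have "\<bar>p \<sigma> $ l\<bar> \<le> \<bar>w \<sigma> $ l\<bar> + \<bar>w \<sigma> $ i0\<bar> * \<bar>E $ l\<bar>"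
          using abs_triangle_ineq4[of "w \<sigma> $ l" "w \<sigma> $ i0 * E $ l"] by (simp add: p_def abs_mult)
        also have "\<dots> \<le> R + R * norm E"
          using wR component_le_norm_cart[of "w \<sigma>"] component_le_norm_cart[of E l] R
          by (intro add_mono mult_mono) (auto intro: order_trans)
        finally show ?thesis using P by linarith
      qed
      then have "\<bar>real N * p \<sigma> $ l\<bar> \<le> real (P * N)" for l
        by (simp add: abs_mult mult.commute mult_left_mono)
      then have "- int (P * N) \<le> \<lfloor>real N * p \<sigma> $ l\<rfloor>" "\<lfloor>real N * p \<sigma> $ l\<rfloor> \<le> int (P * N)" for l
        by (simp_all add: abs_le_iff le_floor_iff floor_le_iff) (smt (verit) of_nat_mult)+
      then show ?thesis
        unfolding J_def cell_def by (intro restrict_PiE_iff[THEN iffD2]) auto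
    qed
    have "hausdorff_premeasure d ?k \<delta> (f ` (K \<inter> cball s (R * h j)))
        \<le> ennreal (v * (real (card J) * r ^ ?k))"
      unfolding v_def
    proof (rule hausdorff_premeasure_finite_cover[OF J])
      show "f ` (K \<inter> cball s (R * h j)) \<subseteq> (\<Union>z\<in>J. S z)"
        using cell_J by (force simp: S_def)
      show "S z \<subseteq> mspace d" for z by (simp add: sp)
      fix z
      show "mdiam d (S z) \<le> ennreal r"
      proof (rule mdiam_le)
        fix x y assume "x \<in> S z" "y \<in> S z"
        then obtain \<sigma> \<tau> where st: "x = f \<sigma>" "y = f \<tau>" "\<sigma> \<in> K \<inter> cball s (R * h j)" "\<tau> \<in> K \<inter> cball s (R * h j)"
          and cells: "cell \<sigma> = z" "cell \<tau> = z"
          by (auto simp: S_def)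
        have comp: "\<bar>(p \<tau> - p \<sigma>) $ l\<bar> \<le> 1 / real N" for l
        proof (cases "l = i0")
          case True
          then show ?thesis by (simp add: p_def E(2))
        next
          case False
          moreover have "cell \<sigma> l = cell \<tau> l"
            by (simp only: cells)
          ultimately have "\<lfloor>real N * p \<sigma> $ l\<rfloor> = \<lfloor>real N * p \<tau> $ l\<rfloor>"
            by (simp add: cell_def)
          then have "\<bar>real N * p \<tau> $ l - real N * p \<sigma> $ l\<bar> \<le> 1" by linarith
          then have "real N * \<bar>p \<tau> $ l - p \<sigma> $ l\<bar> \<le> 1"
            by (metis abs_mult abs_of_nat right_diff_distrib)
          then show ?thesis using N(1) by (simp add: field_simps)
        qed
        have "A (\<tau> - \<sigma>) = h j *\<^sub>R A (w \<tau> - w \<sigma>)"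
          using hj by (simp add: w_def A_simps scaleR_diff_right)
        also have "A (w \<tau> - w \<sigma>) = A (p \<tau> - p \<sigma>)"
          by (simp add: p_def A_simps E(1))
        finally have "norm (A (\<tau> - \<sigma>)) = h j * norm (A (p \<tau> - p \<sigma>))"
          using hj by simp
        also have "\<dots> \<le> h j * (MA * (real ?k * (1 / real N)))"
          using hj MA(1) norm_le_card_cart[OF comp]
          by (intro mult_left_mono order_trans[OF MA(2)]) auto
        finally have "c * norm (A (\<tau> - \<sigma>)) \<le> c * (h j * (MA * (real ?k * (1 / real N))))"
          using c(1) by (rule mult_left_mono)
        moreover have "mdist d x y \<le> c * norm (A (\<tau> - \<sigma>)) + 1 / real N * h j"
          using elim(1) st by blast
        ultimately have "mdist d x y \<le> c * (h j * (MA * (real ?k * (1 / real N)))) + 1 / real N * h j"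
          by linarith
        also have "\<dots> = r"
          by (simp add: r_def M_def add_divide_distrib distrib_left distrib_right mult_ac)
        finally show "mdist d x y \<le> r" .
      qed
    qed (use r in auto)
    also have "\<dots> \<le> ennreal (e * h j ^ ?k)"
    proof (rule ennreal_leI)
      have k: "real N ^ (?k - 1) * real N = real N ^ ?k"
        by (rule power_minus_mult) (rule zero_less_card_finite)
      have "v * (real (card J) * r ^ ?k) \<le> v * (((2 * real P + 1) * real N) ^ (?k - 1) * r ^ ?k)"
        using v r card_J by (intro mult_left_mono mult_right_mono) auto
      also have "\<dots> = v * (2 * real P + 1) ^ (?k - 1) * M ^ ?k * (real N ^ (?k - 1) / real N ^ ?k) * h j ^ ?k"
        by (simp add: r_def power_mult_distrib power_divide)
      also have "real N ^ (?k - 1) / real N ^ ?k = 1 / real N"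
        using N(1) unfolding k[symmetric] by simp
      also have "v * (2 * real P + 1) ^ (?k - 1) * M ^ ?k * (1 / real N) * h j ^ ?k \<le> e * h j ^ ?k"
      proof (rule mult_right_mono)
        show "v * (2 * real P + 1) ^ (?k - 1) * M ^ ?k * (1 / real N) \<le> e"
          using N e by (simp add: field_simps)
      qed (use hj in simp)
      finally show "v * (real (card J) * r ^ ?k) \<le> e * h j ^ ?k" .
    qed
    finally show ?case .
  qed
qed

end

lemma ennreal_eq_0_if_le_all:
  fixes x :: ennreal
  assumes "\<And>e. e > 0 \<Longrightarrow> x \<le> ennreal (e * c)" and "c \<ge> 0"
  shows "x = 0"
proof -
  have "x \<le> 0 + ennreal e" if "e > 0" for e
  proof -
    have "x \<le> ennreal (e / (c + 1) * c)"
      using assms that by (intro assms(1)) simp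
    also have "\<dots> \<le> ennreal e"
      using assms(2) that by (intro ennreal_leI) (simp add: field_simps)
    finally show ?thesis by simp
  qed
  then have "x \<le> 0"
    by (rule ennreal_le_epsilon)
  then show ?thesis by simp
qed

text \<open>Points with a blow-up have arbitrarily small neighbourhoods whose images have small premeasure; for
  the remaining null set the Lipschitz bound suffices, because it can be enclosed in an open set of
  small volume.\<close>
lemma squeezed_2_purely_unrectifiable:
  fixes V W :: "real^'n::finite \<Rightarrow> (real^'n) set" and d :: "(real^'n) metric"
  assumes cd: "complementary_distributions CARD('k::finite) V W" and sp: "mspace d = UNIV"
    and sq: "squeezed 2 V W d" and ni: "non_involutive V"
  shows "purely_unrectifiable TYPE('k) d"
  unfolding purely_unrectifiable_def
proof (intro allI impI)
  fix K :: "(real^'k) set" and f :: "real^'k \<Rightarrow> real^'n"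
  assume K: "compact K" and lipf: "Lipschitz_continuous_map (submetric euclidean_metric K) d f"
  let ?k = "CARD('k)"
  obtain X and I :: "'n set" where fr: "adapted_frame X" and card: "card I = ?k"
    and V: "\<And>x. V x = {adapted_frame.comb X x (cut I a) | a. True}"
    and W: "\<And>x. W x = {adapted_frame.comb X x (cut (-I) a) | a. True}"
    by (rule obtain_adapted_frame[OF cd]) (rule that)
  interpret adapted_frame X by fact
  have V_iff: "v \<in> V x \<longleftrightarrow> cut (-I) (coords x v) = 0" for v x
  proof
    assume "cut (-I) (coords x v) = 0"
    then have "v = comb x (cut I (coords x v))"
      using cut_split[of I "coords x v"] comb_coords[of x v] by simp
    then show "v \<in> V x" unfolding V by blast
  qed (auto simp: V)
  have dimV: "dim {v. cut (-I) (coords x v) = 0} = ?k" for x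
  proof -
    have "{v. cut (-I) (coords x v) = 0} = V x" using V_iff by auto
    then show ?thesis
      using cd by (simp add: complementary_distributions_def plane_distribution_def)
  qed
  obtain B0 where B0: "\<And>s t. s \<in> K \<Longrightarrow> t \<in> K \<Longrightarrow> mdist d (f s) (f t) \<le> B0 * dist s t"
    using lipf by (auto simp: Lipschitz_continuous_map_def)
  define B where "B = \<bar>B0\<bar> + 1"
  have B: "B > 0" by (simp add: B_def)
  have lip: "mdist d (f s) (f t) \<le> B * norm (t - s)" if "s \<in> K" "t \<in> K" for s t
  proof -
    have "B0 * dist s t \<le> B * dist s t" by (intro mult_right_mono) (auto simp: B_def)
    then show ?thesis
      using B0[OF that] by (simp add: dist_norm norm_minus_commute)
  qed
  obtain C L \<rho> where C: "C \<ge> 0" and L: "L \<ge> 0" and \<rho>: "\<rho> > 0"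
    and lipE: "\<And>s t. s \<in> K \<Longrightarrow> t \<in> K \<Longrightarrow> norm (f s - f t) \<le> L * norm (s - t)"
    and horizontal: "\<And>s t. s \<in> K \<Longrightarrow> t \<in> K \<Longrightarrow>
      norm (cut (-I) (coords (f s) (f t - f s))) \<le> C * (norm (t - s))\<^sup>2"
    and upper: "\<And>s t. s \<in> K \<Longrightarrow> t \<in> K \<Longrightarrow> norm (t - s) \<le> \<rho> \<Longrightarrow> mdist d (f s) (f t)
      \<le> C * (norm (cut I (coords (f s) (f t - f s))) + sqrt (norm (cut (-I) (coords (f s) (f t - f s)))))"
    by (rule lipschitz_into_squeezed_2[OF sq sp fr V W K B lip]) (assumption+, rule that)
  let ?P = "\<lambda>s. \<exists>h A. (\<forall>j. h j > 0) \<and> h \<longlonglongrightarrow> 0 \<and> linear A \<and>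
     (\<forall>u. \<exists>\<sigma>. tangent_seq h K s \<sigma> u) \<and>
     (\<forall>\<sigma> u. tangent_seq h K s \<sigma> u \<longrightarrow> (\<lambda>j. (f (\<sigma> j) - f s) /\<^sub>R h j) \<longlonglongrightarrow> A u)"
  obtain Z where Z: "{s. \<not> (s \<in> K \<longrightarrow> ?P s)} \<subseteq> Z" "emeasure lborel Z = 0" "Z \<in> sets borel"
    using AE_E[OF AE_blow_up[OF K L lipE]] by auto
  let ?u = "unit_ball_vol (real DIM(real^'k))"
  have u: "?u > 0" using unit_ball_vol_pos[of "real DIM(real^'k)"] by linarith
  have "hausdorff_premeasure d ?k \<delta> (f ` K) = 0" if \<delta>: "\<delta> > 0" for \<delta>
  proof -
    let ?H = "hausdorff_premeasure d ?k \<delta>"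
    have good: "?H (f ` (K - Z)) = 0"
    proof -
      obtain b where b: "\<And>x. x \<in> K \<Longrightarrow> norm x < b"
        using compact_imp_bounded[OF K] by (auto simp: bounded_pos_less)
      let ?U = "ball (0 :: real^'k) b"
      have fin: "emeasure lborel ?U = ennreal (measure lborel ?U)"
        using emeasure_bounded_finite[of ?U] by (intro emeasure_eq_ennreal_measure) auto
      have est: "?H (f ` (K - Z)) \<le> ennreal (e * (measure lborel ?U / ?u))" if e: "e > 0" for e
      proof -
        have "?H (f ` (K - Z)) \<le> ennreal (e / ?u) * emeasure lborel ?U"
        proof (rule hausdorff_premeasure_Vitali[where K = K])
          fix s and e' :: real assume s: "s \<in> K - Z" and e': "e' > 0"
          then have "?P s" using Z(1) by blast
          then obtain h A where h: "\<And>j. h j > 0" "h \<longlonglongrightarrow> 0" and A: "linear A"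
            and ex: "\<And>u. \<exists>\<sigma>. tangent_seq h K s \<sigma> u"
            and bl: "\<And>\<sigma> u. tangent_seq h K s \<sigma> u \<Longrightarrow> (\<lambda>j. (f (\<sigma> j) - f s) /\<^sub>R h j) \<longlonglongrightarrow> A u"
            by blast
          interpret B: horizontal_blow_up X I K f s h A C
            by unfold_locales (use h A ex bl s C horizontal in \<open>auto simp: linear_add linear_scale\<close>)
          obtain Y Y' where Y: "C_diff 1 Y" "C_diff 1 Y'" "\<forall>y. Y y \<in> V y \<and> Y' y \<in> V y"
            "lie_bracket Y Y' (f s) \<notin> V (f s)"
            using ni unfolding non_involutive_def by blast
          have "\<not> inj A"
          proof (rule B.blow_up_not_inj[OF dimV])
            show "Y differentiable (at (f s))" "Y' differentiable (at (f s))"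
              using Y(1,2) by (simp_all add: One_nat_def)
            show "cut (-I) (coords y (Y y)) = 0" "cut (-I) (coords y (Y' y)) = 0" for y
              using Y(3) V_iff by auto
            show "cut (-I) (coords (f s) (lie_bracket Y Y' (f s))) \<noteq> 0"
              using Y(4) V_iff by auto
          qed
          then have ev: "\<forall>\<^sub>F j in sequentially. ?H (f ` (K \<inter> cball s (5 * h j))) \<le> ennreal (e * h j ^ ?k)"
            by (intro B.blow_up_small_premeasure[OF sp \<rho> C upper _ \<delta> e]) auto
          moreover have "\<forall>\<^sub>F j in sequentially. h j < e'"
            using order_tendstoD(2)[OF h(2) e'] .
          ultimately have "\<forall>\<^sub>F j in sequentially. ?H (f ` (K \<inter> cball s (5 * h j))) \<le> ennreal (e * h j ^ ?k) \<and> h j < e'"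
            by (rule eventually_conj)
          then obtain j where "?H (f ` (K \<inter> cball s (5 * h j))) \<le> ennreal (e * h j ^ ?k)" "h j < e'"
            by (auto simp: eventually_sequentially)
          then show "\<exists>h. 0 < h \<and> h < e' \<and> ?H (f ` (K \<inter> cball s (5 * h))) \<le> ennreal (e * h ^ DIM(real^'k))"
            using h(1)[of j] by (intro exI[of _ "h j"]) simp
        qed (use b e in auto)
        also have "\<dots> = ennreal (e * (measure lborel ?U / ?u))"
          unfolding fin using e u by (subst ennreal_mult[symmetric]) (auto simp: field_simps)
        finally show ?thesis .
      qed
      show ?thesis
        by (rule ennreal_eq_0_if_le_all[OF est]) (use u in auto)
    qed
    have null: "?H (f ` (K \<inter> Z)) = 0"
    proof -
      define M where "M = unit_ball_vol (real ?k) / 2 ^ ?k * (10 * B) ^ ?k"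
      have M: "M \<ge> 0" using B by (simp add: M_def)
      have est: "?H (f ` (K \<inter> Z)) \<le> ennreal (e * (M / ?u))" if e: "e > 0" for e
      proof -
        obtain U where U: "open U" "Z \<subseteq> U" "emeasure lborel (U - Z) < e"
          using outer_regular_lborel[OF Z(3) e] by blast
        have "emeasure lborel U \<le> emeasure lborel ((U - Z) \<union> Z)"
          using U Z(3) by (intro emeasure_mono) auto
        also have "\<dots> \<le> emeasure lborel (U - Z) + emeasure lborel Z"
          using U Z(3) by (intro emeasure_subadditive) auto
        also have "\<dots> \<le> ennreal e" using U(3) Z(2) by simp
        finally have Ue: "emeasure lborel U \<le> ennreal e" .
        have "?H (f ` (K \<inter> Z)) \<le> ennreal (M / ?u) * emeasure lborel U"
        proof (rule hausdorff_premeasure_Vitali[where K = K])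
          fix s and e' :: real assume s: "s \<in> K \<inter> Z" and e': "e' > 0"
          define h where "h = min (e' / 2) (\<delta> / (10 * B))"
          have h: "h > 0" "h < e'" "10 * B * h \<le> \<delta>"
          proof -
            show "h > 0" "h < e'" using e' \<delta> B by (auto simp: h_def)
            have "h \<le> \<delta> / (10 * B)" by (simp add: h_def)
            then show "10 * B * h \<le> \<delta>" using B by (simp add: field_simps)
          qed
          have "?H (f ` (K \<inter> cball s (5 * h)))
            \<le> ennreal (unit_ball_vol (real ?k) / 2 ^ ?k * (real (card {()}) * (10 * B * h) ^ ?k))"
          proof (rule hausdorff_premeasure_finite_cover)
            show "mdiam d (f ` (K \<inter> cball s (5 * h))) \<le> ennreal (10 * B * h)"
            proof (rule mdiam_le, clarify)
              fix x y assume xy: "x \<in> K" "y \<in> K" "x \<in> cball s (5 * h)" "y \<in> cball s (5 * h)"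
              have "norm (y - x) \<le> 10 * h"
                using xy dist_triangle3[of x y s] by (simp add: dist_norm norm_minus_commute)
              then have "B * norm (y - x) \<le> B * (10 * h)" using B by (intro mult_left_mono) auto
              then show "mdist d (f x) (f y) \<le> 10 * B * h"
                using lip[OF xy(1,2)] by simp
            qed
          qed (use h B sp in auto)
          also have "\<dots> = ennreal (M * h ^ DIM(real^'k))"
            by (simp add: M_def power_mult_distrib mult.assoc)
          finally show "\<exists>h. 0 < h \<and> h < e' \<and> ?H (f ` (K \<inter> cball s (5 * h))) \<le> ennreal (M * h ^ DIM(real^'k))"
            using h by blast
        qed (use U M in auto)
        also have "\<dots> \<le> ennreal (M / ?u) * ennreal e"
          using Ue by (rule mult_left_mono) simp
        also have "\<dots> = ennreal (e * (M / ?u))"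
          using e M u by (subst ennreal_mult[symmetric]) (auto simp: mult.commute)
        finally show ?thesis .
      qed
      show ?thesis
        by (rule ennreal_eq_0_if_le_all[OF est]) (use u M in auto)
    qed
    have "f ` K = f ` (K - Z) \<union> f ` (K \<inter> Z)" by auto
    then have "?H (f ` K) \<le> 0"
      using hausdorff_premeasure_Un[of d ?k \<delta> "f ` (K - Z)" "f ` (K \<inter> Z)"] good null by simp
    then show ?thesis by simp
  qed
  then show "hausdorff_measure d ?k (f ` K) = 0"
    by (simp add: hausdorff_measure_def)
qed

theorem proposition1p1p4:
  fixes V W :: "real^'n \<Rightarrow> (real^'n) set"
    and d :: "(real^'n) metric"
  assumes "complementary_distributions CARD('k::finite) V W"
    and "mspace d = UNIV"
  shows "(mtopology_of d = euclidean \<longrightarrow> (\<exists>\<eta>. 1 < \<eta> \<and> \<eta> < 2 \<and> squeezed \<eta> V W d) \<longrightarrow>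
           (\<exists>(K :: (real^'k) set) f. compact K \<and>
              Lipschitz_continuous_map (submetric euclidean_metric K) d f \<and>
              hausdorff_measure d CARD('k) (f ` K) > 0)) \<and>
         (squeezed 2 V W d \<and> non_involutive V \<longrightarrow> purely_unrectifiable TYPE('k) d)"
proof (intro conjI impI)
  assume top: "mtopology_of d = euclidean" and "\<exists>\<eta>. 1 < \<eta> \<and> \<eta> < 2 \<and> squeezed \<eta> V W d"
  then obtain \<eta> where \<eta>: "1 < \<eta>" "\<eta> < 2" "squeezed \<eta> V W d" by blast
  show "\<exists>(K :: (real^'k) set) f. compact K \<and>
              Lipschitz_continuous_map (submetric euclidean_metric K) d f \<and>
              hausdorff_measure d CARD('k) (f ` K) > 0"
    using squeezed_not_purely_unrectifiable[OF assms top \<eta>] by metis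
next
  assume "squeezed 2 V W d \<and> non_involutive V"
  then show "purely_unrectifiable TYPE('k) d"
    using squeezed_2_purely_unrectifiable[OF assms] by blast
qed

end
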